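(* For a positive integer $n$, let $F_{5n+1}$ be the friendship graph consisting of $n$ triangles sharing one common vertex (so it has $2n+1$ vertices and $3n$ edges), and let $K$ be a field. Then the total simplicial complex $\Delta_T(F_{5n+1})$ is Cohen–Macaulay over $K$.
   Context: Total simplicial complex: for a finite simple graph $G$ with vertex set $[m]$ and edge set $E(G)$, the set of total indices $\Upsilon_T(G)$ is the collection of subsets of $[m]\cup E(G)$ consisting of the sets $\{p,q,r\}$ such that (i) $p,q,r$ are adjacent vertices in $G$; or (ii) $p,q,r$ are adjacent edges in $G$; or (iii) $p$ and $q$ are adjacent vertices and $r$ is an edge incident to $p$ or $q$; or (iv) $p$ and $q$ are adjacent edges and $r$ is a vertex incident to $p$ or $q$; together with the singletons $\{p\}$ for each isolated vertex $p$ of $G$. The total simplicial complex $\Delta_T(G)$ is the simplicial complex on vertex set $[m]\cup E(G)$ generated by the sets in $\Upsilon_T(G)$. A simplicial complex $\Delta$ is Cohen–Macaulay over $K$ if its Stanley–Reisner ring $K[\Delta]$ is Cohen–Macaulay. *)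

theory Defs
  imports
    "HOL-Algebra.Algebra"
    "HOL-Library.Poly_Mapping"
    "HOL-Library.Extended_Nat"
begin

section \<open>Cohen--Macaulay rings\<close>

text \<open>
  \<open>x\<^sub>1, \<dots>, x\<^sub>k\<close> is a regular sequence on \<open>R\<close> if each \<open>x\<^sub>i\<close> is a nonzerodivisor on
  \<open>R / (x\<^sub>1, \<dots>, x\<^sub>i\<^sub>-\<^sub>1)\<close> and \<open>(x\<^sub>1, \<dots>, x\<^sub>k)\<close> is a proper ideal.
  The library's \<open>genideal\<close> of the empty set is the zero ideal.
\<close>

definition regular_sequence :: "('a, 'b) ring_scheme \<Rightarrow> 'a list \<Rightarrow> bool" where
  "regular_sequence R xs \<longleftrightarrow>
     set xs \<subseteq> carrier R \<and>
     (\<forall>i < length xs. \<forall>y \<in> carrier R.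
        xs ! i \<otimes>\<^bsub>R\<^esub> y \<in> Idl\<^bsub>R\<^esub> (set (take i xs)) \<longrightarrow> y \<in> Idl\<^bsub>R\<^esub> (set (take i xs))) \<and>
     Idl\<^bsub>R\<^esub> (set xs) \<noteq> carrier R"

definition ideal_depth :: "('a, 'b) ring_scheme \<Rightarrow> 'a set \<Rightarrow> enat" where
  "ideal_depth R I = Sup {enat (length xs) | xs. set xs \<subseteq> I \<and> regular_sequence R xs}"

definition prime_height :: "('a, 'b) ring_scheme \<Rightarrow> 'a set \<Rightarrow> enat" where
  "prime_height R P = Sup {enat k | k. \<exists>C :: nat \<Rightarrow> 'a set.
     (\<forall>i \<le> k. primeideal (C i) R) \<and> (\<forall>i < k. C i \<subset> C (Suc i)) \<and> C k = P}"

text \<open>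
  A Noetherian commutative ring is Cohen--Macaulay if \<open>depth P = codim P\<close> for every maximal
  ideal \<open>P\<close> (Eisenbud, \<^emph>\<open>Commutative Algebra with a View Toward Algebraic Geometry\<close>,
  Section 18.2). Here \<open>depth P\<close> is the length of a longest regular sequence contained in \<open>P\<close>,
  which is the depth of the localization at \<open>P\<close>, and \<open>codim P\<close> is the height of \<open>P\<close>, which
  is the dimension of that localization.
\<close>

definition cohen_macaulay_ring :: "('a, 'b) ring_scheme \<Rightarrow> bool" where
  "cohen_macaulay_ring R \<longleftrightarrow>
     cring R \<and> noetherian_ring R \<and>
     (\<forall>P. maximalideal P R \<longrightarrow> ideal_depth R P = prime_height R P)"


section \<open>Stanley--Reisner rings\<close>

text \<open>
  A polynomial is a finitely supported map from exponent vectors to coefficients; the carrier of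
  \<open>K[x\<^sub>v | v \<in> V]\<close> consists of those in which only the variables indexed by \<open>V\<close> occur.
\<close>

definition poly_ring_on :: "'x set \<Rightarrow> (('x \<Rightarrow>\<^sub>0 nat) \<Rightarrow>\<^sub>0 'k::comm_ring_1) ring" where
  "poly_ring_on V =
     \<lparr>carrier = {p. \<forall>m \<in> Poly_Mapping.keys p. Poly_Mapping.keys m \<subseteq> V},
      monoid.mult = (*), one = 1, ring.zero = 0, add = (+)\<rparr>"

definition face_monomial :: "'x set \<Rightarrow> (('x \<Rightarrow>\<^sub>0 nat) \<Rightarrow>\<^sub>0 'k::comm_ring_1)" where
  "face_monomial F = (\<Prod>v\<in>F. Poly_Mapping.single (Poly_Mapping.single v 1) 1)"

definition simplicial_complex :: "'x set \<Rightarrow> 'x set set \<Rightarrow> bool" where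
  "simplicial_complex V \<Delta> \<longleftrightarrow>
     finite V \<and> {} \<in> \<Delta> \<and> (\<forall>F \<in> \<Delta>. F \<subseteq> V) \<and> (\<forall>v \<in> V. {v} \<in> \<Delta>) \<and>
     (\<forall>F \<in> \<Delta>. \<forall>F'. F' \<subseteq> F \<longrightarrow> F' \<in> \<Delta>)"

definition stanley_reisner_ideal ::
    "'x set \<Rightarrow> 'x set set \<Rightarrow> (('x \<Rightarrow>\<^sub>0 nat) \<Rightarrow>\<^sub>0 'k::comm_ring_1) set" where
  "stanley_reisner_ideal V \<Delta> =
     Idl\<^bsub>poly_ring_on V\<^esub> {face_monomial F | F. F \<subseteq> V \<and> F \<notin> \<Delta>}"

definition stanley_reisner_ring ::
    "'x set \<Rightarrow> 'x set set \<Rightarrow> (('x \<Rightarrow>\<^sub>0 nat) \<Rightarrow>\<^sub>0 'k::comm_ring_1) set ring" where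
  "stanley_reisner_ring V \<Delta> = poly_ring_on V Quot stanley_reisner_ideal V \<Delta>"

definition cohen_macaulay_over :: "'k::field itself \<Rightarrow> 'x set \<Rightarrow> 'x set set \<Rightarrow> bool" where
  "cohen_macaulay_over K V \<Delta> \<longleftrightarrow>
     cohen_macaulay_ring
       (stanley_reisner_ring V \<Delta> :: (('x \<Rightarrow>\<^sub>0 nat) \<Rightarrow>\<^sub>0 'k) set ring)"


section \<open>The total simplicial complex of a graph\<close>

text \<open>A graph is given by its vertex set \<open>V\<close> and its set \<open>E\<close> of two-element edges.\<close>

definition simple_graph :: "'v set \<Rightarrow> 'v set set \<Rightarrow> bool" where
  "simple_graph V E \<longleftrightarrow> finite V \<and> (\<forall>e \<in> E. e \<subseteq> V \<and> card e = 2)"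

definition adj_edges :: "'v set set \<Rightarrow> 'v set \<Rightarrow> 'v set \<Rightarrow> bool" where
  "adj_edges E e f \<longleftrightarrow> e \<in> E \<and> f \<in> E \<and> e \<noteq> f \<and> e \<inter> f \<noteq> {}"

text \<open>The disjoint union of \<open>V\<close> and \<open>E\<close>: vertices are tagged \<open>Inl\<close>, edges \<open>Inr\<close>.\<close>

definition total_vertices :: "'v set \<Rightarrow> 'v set set \<Rightarrow> ('v + 'v set) set" where
  "total_vertices V E = Inl ` V \<union> Inr ` E"

text \<open>
  Three distinct vertices (or three distinct edges) \<open>p, q, r\<close> are called adjacent if they are
  consecutively adjacent in some order: \<open>p\<close> to \<open>q\<close> and \<open>q\<close> to \<open>r\<close>, while \<open>p\<close> and \<open>r\<close> may or may
  not be adjacent. The two mixed kinds of index follow the same pattern, \<open>r\<close> being incident to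
  only one of \<open>p, q\<close> in general. With this convention the four kinds together are exactly the
  three-element sets that induce a connected subgraph of the total graph.
\<close>

definition total_indices :: "'v set \<Rightarrow> 'v set set \<Rightarrow> ('v + 'v set) set set" where
  "total_indices V E =
     {{Inl p, Inl q, Inl r} | p q r. {p, q} \<in> E \<and> {q, r} \<in> E \<and> p \<noteq> r} \<union>
     {{Inr p, Inr q, Inr r} | p q r. adj_edges E p q \<and> adj_edges E q r \<and> p \<noteq> r} \<union>
     {{Inl p, Inl q, Inr r} | p q r. {p, q} \<in> E \<and> r \<in> E \<and> (p \<in> r \<or> q \<in> r)} \<union>
     {{Inr p, Inr q, Inl r} | p q r. adj_edges E p q \<and> r \<in> V \<and> (r \<in> p \<or> r \<in> q)} \<union>
     {{Inl p} | p. p \<in> V \<and> (\<forall>q \<in> V. {p, q} \<notin> E)}"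

definition generated_complex :: "'x set set \<Rightarrow> 'x set set" where
  "generated_complex S = {F. \<exists>G \<in> S. F \<subseteq> G}"

definition total_complex :: "'v set \<Rightarrow> 'v set set \<Rightarrow> ('v + 'v set) set set" where
  "total_complex V E = generated_complex (total_indices V E)"

lemma simplicial_complex_total_complex:
  assumes G: "simple_graph V E" and "V \<noteq> {}"
  shows "simplicial_complex (total_vertices V E) (total_complex V E)"
proof -
  have edge: "p \<in> V \<and> q \<in> V" if "{p, q} \<in> E" for p q
    using G that by (auto simp: simple_graph_def)
  have mixed: "{Inl p, Inl q, Inr {p, q}} \<in> total_indices V E" if "{p, q} \<in> E" for p q
  proof -
    have "{Inl p, Inl q, Inr {p, q}} \<in>
        {{Inl p, Inl q, Inr r} | p q r. {p, q} \<in> E \<and> r \<in> E \<and> (p \<in> r \<or> q \<in> r)}"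
      using that by (intro CollectI exI[of _ p] exI[of _ q] exI[of _ "{p, q}"]) simp
    then show ?thesis
      unfolding total_indices_def by (intro UnI1 UnI2)
  qed
  have fin: "finite (total_vertices V E)"
    using G finite_subset[of E "Pow V"] by (auto simp: simple_graph_def total_vertices_def)
  have sub: "F \<subseteq> total_vertices V E" if "F \<in> total_indices V E" for F
    using that edge unfolding total_indices_def
    by (elim UnE CollectE exE conjE) (simp_all add: total_vertices_def adj_edges_def)
  have sing: "\<exists>S \<in> total_indices V E. v \<in> S" if v: "v \<in> total_vertices V E" for v
  proof (cases v)
    case (Inl p)
    show ?thesis
    proof (cases "\<forall>q \<in> V. {p, q} \<notin> E")
      case True
      then have "{Inl p} \<in> total_indices V E"
        using v Inl by (auto simp: total_indices_def total_vertices_def)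
      then show ?thesis
        using Inl by (intro bexI[of _ "{Inl p}"]) simp_all
    next
      case False
      then obtain q where "{p, q} \<in> E"
        by blast
      from mixed[OF this] show ?thesis
        using Inl by (rule_tac bexI) simp_all
    qed
  next
    case (Inr e)
    then have e: "e \<in> E"
      using v by (auto simp: total_vertices_def)
    then have "card e = 2"
      using G by (simp add: simple_graph_def)
    then obtain p q where "e = {p, q}"
      by (meson card_2_iff)
    then show ?thesis
      using mixed[of p q] e Inr by (intro bexI[of _ "{Inl p, Inl q, Inr {p, q}}"]) simp_all
  qed
  have empty: "{} \<in> total_complex V E"
  proof -
    obtain p where "p \<in> V"
      using assms by blast
    then have "Inl p \<in> total_vertices V E"
      by (simp add: total_vertices_def)
    from sing[OF this] show ?thesis
      by (auto simp: total_complex_def generated_complex_def)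
  qed
  show ?thesis
    unfolding simplicial_complex_def
  proof (intro conjI ballI allI impI)
    fix F assume "F \<in> total_complex V E"
    then show "F \<subseteq> total_vertices V E"
      using sub unfolding total_complex_def generated_complex_def by blast
  next
    fix v assume "v \<in> total_vertices V E"
    then show "{v} \<in> total_complex V E"
      using sing unfolding total_complex_def generated_complex_def by simp
  next
    fix F F' assume "F \<in> total_complex V E" "F' \<subseteq> F"
    then show "F' \<in> total_complex V E"
      unfolding total_complex_def generated_complex_def by blast
  qed (fact fin empty)+
qed

section \<open>Friendship graphs\<close>

text \<open>The \<open>n\<close> triangles \<open>{1, 2i, 2i + 1}\<close> for \<open>i = 1, \<dots>, n\<close>, with common vertex \<open>1\<close>.\<close>

definition friendship_triangle :: "nat \<Rightarrow> nat set" where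
  "friendship_triangle i = {1, 2 * i, 2 * i + 1}"

definition friendship_vertices :: "nat \<Rightarrow> nat set" where
  "friendship_vertices n = (\<Union>i \<in> {1..n}. friendship_triangle i)"

definition friendship_edges :: "nat \<Rightarrow> nat set set" where
  "friendship_edges n = (\<Union>i \<in> {1..n}. {e. e \<subseteq> friendship_triangle i \<and> card e = 2})"

lemma simple_graph_friendship: "simple_graph (friendship_vertices n) (friendship_edges n)"
  by (auto simp: simple_graph_def friendship_vertices_def friendship_edges_def
      friendship_triangle_def)

lemma friendship_vertices_eq:
  assumes "n \<ge> 1"
  shows "friendship_vertices n = {1..2 * n + 1}"
proof -
  have "v \<in> friendship_vertices n" if v: "v \<in> {1..2 * n + 1}" for v
  proof (cases "v = 1")
    case True
    then show ?thesis
      using assms by (auto simp: friendship_vertices_def friendship_triangle_def)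
  next
    case False
    then have "v div 2 \<in> {1..n}" and "v = 2 * (v div 2) \<or> v = 2 * (v div 2) + 1"
      using v by auto
    then show ?thesis
      unfolding friendship_vertices_def friendship_triangle_def by blast
  qed
  moreover have "friendship_vertices n \<subseteq> {1..2 * n + 1}"
    by (auto simp: friendship_vertices_def friendship_triangle_def)
  ultimately show ?thesis
    by blast
qed

lemma card_friendship_edges: "card (friendship_edges n) = 3 * n"
proof -
  let ?T = "\<lambda>i. {e. e \<subseteq> friendship_triangle i \<and> card e = 2}"
  have fin: "finite (friendship_triangle i)" for i
    by (simp add: friendship_triangle_def)
  have "card (?T i) = 3" if "i \<in> {1..n}" for i
  proof -
    have "card (friendship_triangle i) = 3"
      using that by (auto simp: friendship_triangle_def card_insert_if)
    moreover have "(3::nat) choose 2 = 3"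
      by (simp add: numeral_eq_Suc)
    ultimately show ?thesis
      using n_subsets[OF fin] by metis
  qed
  moreover have "?T i \<inter> ?T j = {}" if "i \<in> {1..n}" "j \<in> {1..n}" "i \<noteq> j" for i j
  proof -
    have "friendship_triangle i \<inter> friendship_triangle j \<subseteq> {1}"
      using that by (auto simp: friendship_triangle_def; presburger)
    then have "e \<subseteq> {1}" if "e \<in> ?T i \<inter> ?T j" for e
      using that by blast
    then have "card e \<le> 1" if "e \<in> ?T i \<inter> ?T j" for e
      using that card_mono[of "{1::nat}" e] by auto
    then show ?thesis
      by fastforce
  qed
  moreover have "finite (?T i)" for i
    by (rule finite_subset[of _ "Pow (friendship_triangle i)"]) (use fin in auto)
  ultimately show ?thesis
    unfolding friendship_edges_def by (subst card_UN_disjoint) auto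
qed

end

theory Submission
  imports Defs "HOL-Computational_Algebra.Polynomial"
begin

text \<open>
  The connected triples of the total graph form a shellable two-dimensional complex. Let \<open>P\<close> be a
  maximal ideal containing the Stanley--Reisner ideal. By Zariski's lemma there is a monic univariate \<open>h\<close> with \<open>h(0) = 0\<close>
  and \<open>h(x\<^sub>v) \<in> P\<close> for all \<open>v\<close>. The three elementary symmetric polynomials in the \<open>h(x\<^sub>v)\<close> lie in
  \<open>P\<close>; on each facet \<open>{x, y, z}\<close> they restrict to the elementary symmetric polynomials in
  \<open>h(x), h(y), h(z)\<close>, which are regular on \<open>K[x, y, z]\<close> for every field \<open>K\<close>. A shelling filters
  \<open>K[\<Delta>]\<close> with quotients \<open>K[F]\<close>, so the sequence is regular on \<open>K[\<Delta>]\<close> and \<open>depth P \<ge> 3\<close>. Counting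
  monomials bounds every chain of primes by \<open>3\<close>, and \<open>depth P \<le> height P\<close> holds in every commutative ring.
\<close>

section \<open>Polynomials with exponents in a set of variables\<close>

text \<open>All maximal ideals of \<open>K[\<Delta>]\<close> have to be treated, not just the one
  generated by the variables, and over an arbitrary field they need not come from points. Replacing
  \<open>x_v\<close> by \<open>h(x_v)\<close>, with one \<open>h\<close> for all vertices, moves the
  problem back to a situation that looks like the origin. Symmetric expressions are used because
  they restrict to the same formula on every facet, so one computation in three variables settles
  all facets at once; generic linear forms would call for an infinite field. The nonzerodivisor
  conditions and properness are handled separately: the exact sequences of the shelling concern only
  the former, while properness is inherited from \<open>P\<close>. No localization is ever formed.
  In the height estimate a multiplicative set takes its place, in Zariski's lemma the powers of a
  single element. Rings are subsets of a type-class ring for most of the way, so that arithmetic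
  uses the ordinary operators; quotient structures enter only when the results are transferred to
  the Stanley--Reisner ring.\<close>

abbreviation keys :: "('a \<Rightarrow>\<^sub>0 'b::zero) \<Rightarrow> 'a set" where "keys \<equiv> Poly_Mapping.keys"
abbreviation lookup :: "('a \<Rightarrow>\<^sub>0 'b::zero) \<Rightarrow> 'a \<Rightarrow> 'b" where "lookup \<equiv> Poly_Mapping.lookup"
abbreviation single :: "'a \<Rightarrow> 'b \<Rightarrow> 'a \<Rightarrow>\<^sub>0 'b::zero" where "single \<equiv> Poly_Mapping.single"

type_synonym ('x, 'k) mpoly = "('x \<Rightarrow>\<^sub>0 nat) \<Rightarrow>\<^sub>0 'k"

definition polys :: "'x set \<Rightarrow> ('x, 'k::comm_ring_1) mpoly set" where
  "polys V = {p. \<forall>m \<in> keys p. keys m \<subseteq> V}"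

definition Const :: "'k \<Rightarrow> ('x, 'k::comm_ring_1) mpoly" where
  "Const c = single 0 c"

definition Var :: "'x \<Rightarrow> ('x, 'k::comm_ring_1) mpoly" where
  "Var v = single (single v 1) 1"

locale subring_on =
  fixes S :: "'a::comm_ring_1 set"
  assumes one_mem [simp]: "1 \<in> S"
    and diff_mem [simp]: "a \<in> S \<Longrightarrow> b \<in> S \<Longrightarrow> a - b \<in> S"
    and mult_mem [simp]: "a \<in> S \<Longrightarrow> b \<in> S \<Longrightarrow> a * b \<in> S"
begin

lemma zero_mem [simp]: "0 \<in> S"
  using diff_mem[of 1 1] by simp

lemma uminus_mem [simp]: "a \<in> S \<Longrightarrow> - a \<in> S"
  using diff_mem[of 0 a] by simp

lemma add_mem [simp]: "a \<in> S \<Longrightarrow> b \<in> S \<Longrightarrow> a + b \<in> S"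
  using diff_mem[of a "- b"] by simp

lemma power_mem [simp]: "a \<in> S \<Longrightarrow> a ^ n \<in> S"
  by (induction n) auto

lemma sum_mem [simp]: "(\<And>i. i \<in> B \<Longrightarrow> f i \<in> S) \<Longrightarrow> sum f B \<in> S"
  by (induction B rule: infinite_finite_induct) auto

lemma prod_mem [simp]: "(\<And>i. i \<in> B \<Longrightarrow> f i \<in> S) \<Longrightarrow> prod f B \<in> S"
  by (induction B rule: infinite_finite_induct) auto

end

text \<open>Counterpart of the library's \<open>ideal\<close> for subrings of a type-class ring;
  \<open>ideal_poly_ring_on\<close> is the bridge between the two.\<close>

definition ideal_on :: "'a::comm_ring_1 set \<Rightarrow> 'a set \<Rightarrow> bool" where
  "ideal_on S I \<longleftrightarrow> I \<subseteq> S \<and> 0 \<in> I \<and> (\<forall>a\<in>I. \<forall>b\<in>I. a + b \<in> I) \<and> (\<forall>s\<in>S. \<forall>a\<in>I. s * a \<in> I)"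

lemma ideal_onD:
  assumes "ideal_on S I"
  shows ideal_on_mem: "a \<in> I \<Longrightarrow> a \<in> S" and ideal_on_zero: "0 \<in> I"
    and ideal_on_add: "a \<in> I \<Longrightarrow> b \<in> I \<Longrightarrow> a + b \<in> I"
    and ideal_on_mult: "s \<in> S \<Longrightarrow> a \<in> I \<Longrightarrow> s * a \<in> I"
    and ideal_on_mult2: "s \<in> S \<Longrightarrow> a \<in> I \<Longrightarrow> a * s \<in> I"
  using assms by (auto simp: ideal_on_def mult.commute)

context subring_on
begin

lemma ideal_on_uminus: "ideal_on S I \<Longrightarrow> a \<in> I \<Longrightarrow> - a \<in> I"
  using ideal_on_mult[of S I "-1" a] by simp

lemma ideal_on_diff: "ideal_on S I \<Longrightarrow> a \<in> I \<Longrightarrow> b \<in> I \<Longrightarrow> a - b \<in> I"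
  using ideal_on_add[of S I a "- b"] ideal_on_uminus[of I b] by simp

lemma ideal_on_sum: "ideal_on S I \<Longrightarrow> (\<And>i. i \<in> B \<Longrightarrow> f i \<in> I) \<Longrightarrow> sum f B \<in> I"
  by (induction B rule: infinite_finite_induct) (auto simp: ideal_onD)

end

lemma keys_mult_subset:
  fixes p q :: "('x, 'k::comm_ring_1) mpoly"
  assumes "m \<in> keys (p * q)"
  obtains a b where "a \<in> keys p" "b \<in> keys q" "m = a + b"
  using keys_mult[of p q] assms by blast

lemma keys_add_nat:
  "keys (a + b :: 'x \<Rightarrow>\<^sub>0 nat) = keys a \<union> keys b"
  by (auto simp: in_keys_iff lookup_add)

interpretation polys: subring_on "polys V :: ('x, 'k::comm_ring_1) mpoly set" for V
proof
  fix a b :: "('x, 'k) mpoly" assume *: "a \<in> polys V" "b \<in> polys V"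
  then show "a - b \<in> polys V"
    using keys_diff[of a b] by (auto simp: polys_def in_keys_iff lookup_minus)
  show "a * b \<in> polys V"
    using * by (fastforce simp: polys_def keys_add_nat elim!: keys_mult_subset)
qed (simp add: polys_def)

lemma single_mem_polys [simp]: "keys m \<subseteq> V \<Longrightarrow> single m c \<in> polys V"
  by (simp add: polys_def)

lemma Const_mem_polys [simp]: "Const c \<in> polys V"
  by (simp add: Const_def)

lemma Var_mem_polys [simp]: "v \<in> V \<Longrightarrow> Var v \<in> polys V"
  by (simp add: Var_def)

lemma polys_mono: "U \<subseteq> V \<Longrightarrow> polys U \<subseteq> polys V"
  by (auto simp: polys_def)

lemma Const_0 [simp]: "Const 0 = 0" and Const_1 [simp]: "Const 1 = 1"
  and Const_add: "Const (a + b) = Const a + Const b"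
  and Const_mult: "Const (a * b) = Const a * Const b"
  by (simp_all add: Const_def single_add mult_single)

lemma single_Var_power: "Var v ^ n = single (single v n) 1"
  by (induction n) (simp_all add: Var_def mult_single single_add[symmetric])

lemma poly_mapping_sum_singles:
  "(p :: 'a \<Rightarrow>\<^sub>0 'b::comm_monoid_add) =
     (\<Sum>m\<in>keys p. single m (lookup p m))"
  by (rule poly_mapping_eqI)
     (auto simp: lookup_sum lookup_single when_def in_keys_iff sum.delta)

text \<open>The type of exponents carries no linear order, so an order is imported from \<^typ>\<open>nat \<Rightarrow>\<^sub>0 nat\<close>
  along an enumeration of the finitely many variables.\<close>

definition mon_key :: "'x set \<Rightarrow> ('x \<Rightarrow>\<^sub>0 nat) \<Rightarrow> (nat \<Rightarrow>\<^sub>0 nat)" where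
  "mon_key V m = (\<Sum>v\<in>V. single (to_nat_on V v) (lookup m v))"

lemma mon_key_add: "mon_key V (a + b) = mon_key V a + mon_key V b"
  by (simp add: mon_key_def lookup_add single_add sum.distrib)

lemma mon_key_inj:
  assumes "finite V" "keys a \<subseteq> V" "keys b \<subseteq> V" "mon_key V a = mon_key V b"
  shows "a = b"
proof -
  have inj: "inj_on (to_nat_on V) V"
    using assms(1) countable_finite inj_on_to_nat_on by blast
  have "lookup (mon_key V m) (to_nat_on V v) = lookup m v" if "v \<in> V" for v m
  proof -
    have "lookup (mon_key V m) (to_nat_on V v)
        = (\<Sum>w\<in>V. if w = v then lookup m w else 0)"
      unfolding mon_key_def lookup_sum lookup_single when_def
      using inj that by (intro sum.cong) (auto simp: inj_on_def)
    then show ?thesis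
      using assms(1) that by simp
  qed
  then have "lookup a v = lookup b v" for v
    using assms by (cases "v \<in> V") (metis, metis in_keys_iff subsetD)
  then show ?thesis
    by (rule poly_mapping_eqI)
qed

text \<open>If two exponents are bounded by the leading ones and have the same sum, both bounds are
  attained. Hence exactly one pair of terms contributes to \<open>a + b\<close>, and its coefficient
  is a product of two nonzero scalars.\<close>

lemma polys_mult_leading_keys:
  fixes p q :: "('x, 'k::idom) mpoly"
  assumes V: "finite V" and p: "p \<in> polys V" "p \<noteq> 0" and q: "q \<in> polys V" "q \<noteq> 0"
  obtains a b where "a \<in> keys p" "b \<in> keys q"
    "\<And>m. m \<in> keys p \<Longrightarrow> mon_key V m \<le> mon_key V a"
    "\<And>m. m \<in> keys q \<Longrightarrow> mon_key V m \<le> mon_key V b"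
    "a + b \<in> keys (p * q)"
proof -
  have ex: "\<exists>a\<in>keys r. \<forall>m\<in>keys r. mon_key V m \<le> mon_key V a"
    if "r \<noteq> 0" for r :: "('x, 'k) mpoly"
  proof -
    have "Max (mon_key V ` keys r) \<in> mon_key V ` keys r"
      using that by (intro Max_in) auto
    moreover have "mon_key V m \<le> Max (mon_key V ` keys r)" if "m \<in> keys r" for m
      using that by (intro Max_ge) auto
    ultimately show ?thesis
      by fastforce
  qed
  obtain a where a: "a \<in> keys p" "\<And>m. m \<in> keys p \<Longrightarrow> mon_key V m \<le> mon_key V a"
    using ex[OF p(2)] by blast
  obtain b where b: "b \<in> keys q" "\<And>m. m \<in> keys q \<Longrightarrow> mon_key V m \<le> mon_key V b"
    using ex[OF q(2)] by blast
  have uniq: "m = a \<and> m' = b"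
    if "m \<in> keys p" "m' \<in> keys q" "m + m' = a + b" for m m'
  proof -
    have eq: "mon_key V m + mon_key V m' = mon_key V a + mon_key V b"
      using that(3) by (metis mon_key_add)
    have "mon_key V m = mon_key V a"
      using a(2)[OF that(1)] b(2)[OF that(2)] eq
      by (metis add_le_cancel_left antisym add_right_mono add.commute)
    then have "m = a"
      using that(1) a(1) p(1) by (intro mon_key_inj[OF V]) (auto simp: polys_def)
    then show ?thesis
      using that(3) by simp
  qed
  have "p * q = (\<Sum>m\<in>keys p. \<Sum>m'\<in>keys q.
      single (m + m') (lookup p m * lookup q m'))"
    by (subst poly_mapping_sum_singles[of p], subst poly_mapping_sum_singles[of q])
       (simp add: sum_product mult_single)
  then have "lookup (p * q) (a + b) = (\<Sum>m\<in>keys p. \<Sum>m'\<in>keys q.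
      if m = a then (if m' = b then lookup p a * lookup q b else 0) else 0)"
    unfolding lookup_sum by (auto simp: lookup_sum lookup_single when_def intro!: sum.cong dest: uniq)
  also have "\<dots> = lookup p a * lookup q b"
    using a(1) b(1) by (simp add: sum.If_cases if_distrib[of "\<lambda>x. sum x _"] flip: sum.inter_filter cong: if_cong)
  finally have "a + b \<in> keys (p * q)"
    using a(1) b(1) by (simp add: in_keys_iff)
  then show ?thesis
    using that a b by blast
qed

lemma polys_no_zero_divisors:
  fixes p q :: "('x, 'k::idom) mpoly"
  assumes "finite V" "p \<in> polys V" "p \<noteq> 0" "q \<in> polys V" "q \<noteq> 0"
  shows "p * q \<noteq> 0"
  using polys_mult_leading_keys[OF assms] by (metis empty_iff keys_zero)

text \<open>The leading exponents of a unit and its inverse add up to 0, so both are 0; since 0 is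
  also the smallest key, no other exponent remains.\<close>

lemma polys_unit_const:
  fixes p q :: "('x, 'k::idom) mpoly"
  assumes "finite V" "p \<in> polys V" "q \<in> polys V" "p * q = 1"
  shows "keys p = {0}"
proof -
  have "p \<noteq> 0" "q \<noteq> 0"
    using assms(4) by auto
  then obtain a b where ab: "a \<in> keys p" "b \<in> keys q"
    "\<And>m. m \<in> keys p \<Longrightarrow> mon_key V m \<le> mon_key V a"
    "a + b \<in> keys (p * q)"
    using polys_mult_leading_keys[OF assms(1,2) _ assms(3)] by metis
  have "a + b = 0"
    using ab(4) assms(4) by simp
  then have "a = 0"
    by (metis keys_add_nat keys_zero keys_eq_empty Un_empty poly_mapping_eqI lookup_zero in_keys_iff empty_iff)
  have 0: "mon_key V 0 = 0"
    by (simp add: mon_key_def)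
  have "m = 0" if "m \<in> keys p" for m
  proof -
    have nonneg: "(x :: nat \<Rightarrow>\<^sub>0 nat) \<le> 0 \<Longrightarrow> x = 0" for x
      by (transfer) (auto simp: less_fun_def)
    have "mon_key V m = 0"
      using ab(3)[OF that] \<open>a = 0\<close> 0 nonneg by simp
    then show ?thesis
      using that assms(2) mon_key_inj[OF assms(1), of m 0] 0 by (auto simp: polys_def)
  qed
  then show ?thesis
    using ab(1) by blast
qed

section \<open>Weakly regular sequences\<close>

text \<open>This is \<open>I + (g 0, ..., g (i - 1))\<close>, built one generator at a time so that
  membership in stage \<open>i + 1\<close> unfolds to a relation modulo stage
  \<open>i\<close>.\<close>

primrec adjoin :: "'a::comm_ring_1 set \<Rightarrow> (nat \<Rightarrow> 'a) \<Rightarrow> 'a set \<Rightarrow> nat \<Rightarrow> 'a set" where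
  "adjoin S g I 0 = I"
| "adjoin S g I (Suc i) = {a + g i * c | a c. a \<in> adjoin S g I i \<and> c \<in> S}"

text \<open>Unlike \<open>regular_sequence\<close>, properness is not demanded. The notion therefore
  holds for \<open>I = S\<close>, which is where the induction along a shelling starts.\<close>

definition weakly_regular :: "'a::comm_ring_1 set \<Rightarrow> (nat \<Rightarrow> 'a) \<Rightarrow> nat \<Rightarrow> 'a set \<Rightarrow> bool" where
  "weakly_regular S g n I \<longleftrightarrow>
     (\<forall>i<n. \<forall>y\<in>S. g i * y \<in> adjoin S g I i \<longrightarrow> y \<in> adjoin S g I i)"

context subring_on
begin

lemma adjoin_sub: "a \<in> adjoin S g I i \<Longrightarrow> a \<in> adjoin S g I (Suc i)"
  by simp (metis add_0_right mult_zero_right zero_mem)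

lemma adjoin_base: "a \<in> I \<Longrightarrow> a \<in> adjoin S g I i"
  by (induction i) (auto simp del: adjoin.simps(2) intro: adjoin_sub)

lemma adjoin_mono: "I \<subseteq> J \<Longrightarrow> adjoin S g I i \<subseteq> adjoin S g J i"
  by (induction i) auto

lemma ideal_on_adjoin:
  assumes "ideal_on S I" "\<And>i. i < n \<Longrightarrow> g i \<in> S"
  shows "ideal_on S (adjoin S g I n)"
  using assms(2)
proof (induction n)
  case (Suc n)
  then have n: "ideal_on S (adjoin S g I n)" "g n \<in> S"
    by auto
  show ?case
    unfolding ideal_on_def
  proof (intro conjI ballI subsetI)
    show "0 \<in> adjoin S g I (Suc n)"
      using adjoin_sub ideal_on_zero[OF n(1)] by blast
  next
    fix a assume "a \<in> adjoin S g I (Suc n)"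
    then show "a \<in> S"
      using n by (auto dest: ideal_on_mem)
  next
    fix a b assume "a \<in> adjoin S g I (Suc n)" "b \<in> adjoin S g I (Suc n)"
    then obtain a' c b' d where *: "a = a' + g n * c" "b = b' + g n * d" "c \<in> S" "d \<in> S"
      "a' \<in> adjoin S g I n" "b' \<in> adjoin S g I n"
      by auto
    then have "a + b = (a' + b') + g n * (c + d)" "a' + b' \<in> adjoin S g I n" "c + d \<in> S"
      using ideal_on_add[OF n(1)] by (auto simp: algebra_simps)
    then show "a + b \<in> adjoin S g I (Suc n)"
      by auto
  next
    fix s a assume "s \<in> S" "a \<in> adjoin S g I (Suc n)"
    then obtain a' c where *: "a = a' + g n * c" "c \<in> S" "a' \<in> adjoin S g I n"
      by auto
    then have "s * a = s * a' + g n * (s * c)" "s * a' \<in> adjoin S g I n" "s * c \<in> S"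
      using ideal_on_mult[OF n(1)] \<open>s \<in> S\<close> by (auto simp: distrib_left mult.left_commute)
    then show "s * a \<in> adjoin S g I (Suc n)"
      by auto
  qed
qed (use assms in simp)

lemma colon_adjoin:
  assumes "x \<in> S" "s \<in> adjoin S g {s \<in> S. x * s \<in> I} i"
  shows "x * s \<in> adjoin S g I i"
  using assms(2)
proof (induction i arbitrary: s)
  case (Suc i)
  then obtain a c where *: "s = a + g i * c" "c \<in> S" "a \<in> adjoin S g {s \<in> S. x * s \<in> I} i"
    by auto
  then have "x * s = x * a + g i * (x * c)" "x * c \<in> S" "x * a \<in> adjoin S g I i"
    using Suc.IH[of a] assms(1) by (auto simp: algebra_simps)
  then show ?case
    by auto
qed simp

lemma sum_adjoin:
  assumes "s \<in> adjoin S g {a + x * s | a s. a \<in> I \<and> s \<in> S} i"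
  shows "\<exists>a\<in>adjoin S g I i. \<exists>b\<in>S. s = a + x * b"
  using assms
proof (induction i arbitrary: s)
  case (Suc i)
  then obtain s' c where *: "s = s' + g i * c" "c \<in> S"
    "s' \<in> adjoin S g {a + x * s | a s. a \<in> I \<and> s \<in> S} i"
    by auto
  then obtain a b where "a \<in> adjoin S g I i" "b \<in> S" "s' = a + x * b"
    using Suc.IH by blast
  then have "s = (a + g i * c) + x * b" "a + g i * c \<in> adjoin S g I (Suc i)"
    using * by auto
  then show ?case
    using \<open>b \<in> S\<close> by blast
qed auto

text \<open>A relation \<open>x * b = a + g i * c\<close> forces \<open>c\<close> into \<open>I + (x) + (g\<^sub>0, \<dots>, g\<^sub>i\<^sub>-\<^sub>1)\<close> by regularity,
  so that \<open>c\<close> can be absorbed into \<open>b\<close> and \<open>i\<close> decreases.\<close>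

lemma colon_adjoin_conv:
  assumes I: "ideal_on S I" and x: "x \<in> S" and g: "\<And>i. i < n \<Longrightarrow> g i \<in> S"
    and reg: "weakly_regular S g n {a + x * s | a s. a \<in> I \<and> s \<in> S}"
    and "i \<le> n" "b \<in> S" "x * b \<in> adjoin S g I i"
  shows "b \<in> adjoin S g {s \<in> S. x * s \<in> I} i"
  using assms(5-7)
proof (induction i arbitrary: b)
  case (Suc i)
  let ?J = "{a + x * s | a s. a \<in> I \<and> s \<in> S}"
  have i: "i < n" "g i \<in> S"
    using Suc.prems g by auto
  note ad = ideal_on_adjoin[OF I, of i g]
  have I': "ideal_on S (adjoin S g I i)"
    using ad g i by auto
  have J: "ideal_on S ?J"
    unfolding ideal_on_def
  proof (intro conjI ballI subsetI)
    show "0 \<in> ?J"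
      using ideal_on_zero[OF I] by (intro CollectI exI[of _ 0]) auto
  next
    fix a b assume "a \<in> ?J" "b \<in> ?J"
    then obtain a' b' s t where "a = a' + x * s" "b = b' + x * t" "a' \<in> I" "b' \<in> I" "s \<in> S" "t \<in> S"
      by auto
    then have "a + b = (a' + b') + x * (s + t)" "a' + b' \<in> I" "s + t \<in> S"
      using ideal_on_add[OF I] by (auto simp: algebra_simps)
    then show "a + b \<in> ?J"
      by blast
  next
    fix t a assume "t \<in> S" "a \<in> ?J"
    then obtain a' s where "a = a' + x * s" "a' \<in> I" "s \<in> S" "t \<in> S"
      by auto
    then have "t * a = t * a' + x * (t * s)" "t * a' \<in> I" "t * s \<in> S"
      using ideal_on_mult[OF I] by (auto simp: distrib_left mult.left_commute)
    then show "t * a \<in> ?J"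
      by blast
  qed (use ideal_on_mem[OF I] x in auto)
  have J': "ideal_on S (adjoin S g ?J i)"
    using ideal_on_adjoin[OF J, of i g] g i by auto
  have sub: "adjoin S g I i \<subseteq> adjoin S g ?J i"
    by (rule adjoin_mono, rule subsetI, simp) (metis add_0_right mult_zero_right zero_mem)
  obtain a c where ac: "x * b = a + g i * c" "a \<in> adjoin S g I i" "c \<in> S"
    using Suc.prems by auto
  have "x * b \<in> adjoin S g ?J i"
    using Suc.prems ideal_on_zero[OF I] by (intro adjoin_base) (force intro: exI[of _ 0])
  then have "x * b - a \<in> adjoin S g ?J i"
    using ideal_on_diff[OF J'] ac sub by blast
  then have "c \<in> adjoin S g ?J i"
    using reg ac i by (simp add: weakly_regular_def)
  then obtain a' b' where *: "a' \<in> adjoin S g I i" "b' \<in> S" "c = a' + x * b'"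
    using sum_adjoin by blast
  then have "x * (b - g i * b') = a + g i * a'"
    using ac by (simp add: algebra_simps)
  moreover have "a + g i * a' \<in> adjoin S g I i"
    using ac * i ideal_onD[OF I'] by auto
  ultimately have "b - g i * b' \<in> adjoin S g {s \<in> S. x * s \<in> I} i"
    using Suc.IH[of "b - g i * b'"] Suc.prems * i by auto
  then show ?case
    using *(2) unfolding adjoin.simps
    by (intro CollectI exI[of _ "b - g i * b'"] exI[of _ b']) simp
qed simp

text \<open>Regularity passes from the outer terms to the middle term of
  \<open>0 -> S/(I : x) -> S/I -> S/(I + (x)) -> 0\<close>. The point is that the sequence stays
  exact on the left modulo the earlier \<open>g i\<close>, which is
  \<open>colon_adjoin_conv\<close>.\<close>

lemma weakly_regular_extend:
  assumes I: "ideal_on S I" and x: "x \<in> S" and g: "\<And>i. i < n \<Longrightarrow> g i \<in> S"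
    and colon: "weakly_regular S g n {s \<in> S. x * s \<in> I}"
    and sum: "weakly_regular S g n {a + x * s | a s. a \<in> I \<and> s \<in> S}"
  shows "weakly_regular S g n I"
  unfolding weakly_regular_def
proof (intro allI impI ballI)
  let ?J = "{a + x * s | a s. a \<in> I \<and> s \<in> S}"
  fix i y assume i: "i < n" and y: "y \<in> S" "g i * y \<in> adjoin S g I i"
  have I': "ideal_on S (adjoin S g I i)"
    using ideal_on_adjoin[OF I, of i g] g i by auto
  have "adjoin S g I i \<subseteq> adjoin S g ?J i"
    by (rule adjoin_mono, rule subsetI, simp) (metis add_0_right mult_zero_right zero_mem)
  then have "y \<in> adjoin S g ?J i"
    using sum i y by (auto simp: weakly_regular_def)
  then obtain a b where ab: "a \<in> adjoin S g I i" "b \<in> S" "y = a + x * b"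
    using sum_adjoin by blast
  then have "x * (g i * b) = g i * y - g i * a"
    by (simp add: algebra_simps)
  also have "\<dots> \<in> adjoin S g I i"
    using ab y i g ideal_on_diff[OF I'] ideal_onD[OF I'] by auto
  finally have "g i * b \<in> adjoin S g {s \<in> S. x * s \<in> I} i"
    using ab i g by (intro colon_adjoin_conv[OF I x g sum]) auto
  then have "b \<in> adjoin S g {s \<in> S. x * s \<in> I} i"
    using colon i ab by (simp add: weakly_regular_def)
  then have "x * b \<in> adjoin S g I i"
    by (rule colon_adjoin[OF x])
  then show "y \<in> adjoin S g I i"
    using ab ideal_on_add[OF I'] by auto
qed

end

section \<open>Elementary symmetric polynomials in h(x), h(y), h(z) form a regular sequence\<close>

lemma monic_division:
  fixes f g :: "'a::idom poly"
  assumes "lead_coeff g = 1"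
  obtains q r where "f = g * q + r" "r = 0 \<or> degree r < degree g"
proof -
  have "g \<noteq> 0"
    using assms by auto
  from pseudo_divmod[OF this, of f "fst (pseudo_divmod f g)" "snd (pseudo_divmod f g)"]
  show ?thesis
    using that assms by simp
qed

text \<open>For monic \<open>g\<close> the quotient \<open>A[t]/(g)\<close> is free over
  \<open>A\<close> on the powers of \<open>t\<close> below \<open>degree g\<close>. So a constant
  \<open>a\<close> that is regular modulo \<open>c\<close> in \<open>A\<close> stays regular modulo
  \<open>c\<close> on it, coefficient by coefficient of the remainders.\<close>

lemma monic_regular:
  fixes b g q j :: "'a::idom poly"
  assumes g: "lead_coeff g = 1"
    and nzd: "\<And>y. c dvd a * y \<Longrightarrow> c dvd y"
    and eq: "[:a:] * b = g * q + [:c:] * j"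
  obtains q' j' where "b = g * q' + [:c:] * j'"
proof -
  obtain q0 r0 where 0: "b = g * q0 + r0" "r0 = 0 \<or> degree r0 < degree g"
    using monic_division[OF g] .
  obtain q1 r1 where 1: "j = g * q1 + r1" "r1 = 0 \<or> degree r1 < degree g"
    using monic_division[OF g] .
  \<comment> \<open>Collects all quotients: the difference of the two remainder terms becomes
    \<open>g * t\<close>, and comparing degrees leaves only \<open>t = 0\<close>.\<close>
  define t where "t = q + [:c:] * q1 - [:a:] * q0"
  have *: "[:a:] * r0 - [:c:] * r1 = g * t"
    using eq unfolding 0 1 t_def by (simp add: algebra_simps)
  have "t = 0"
  proof (rule ccontr)
    assume "t \<noteq> 0"
    moreover have "g \<noteq> 0"
      using g by auto
    ultimately have "degree (g * t) \<ge> degree g" "g * t \<noteq> 0"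
      by (auto simp: degree_mult_eq)
    moreover have "degree ([:a:] * r0 - [:c:] * r1) < degree g \<or> [:a:] * r0 - [:c:] * r1 = 0"
    proof (cases "degree g = 0")
      case False
      have "degree ([:a:] * r0) < degree g" "degree ([:c:] * r1) < degree g"
        using 0(2) 1(2) False degree_smult_le[of a r0] degree_smult_le[of c r1] by auto
      then show ?thesis
        using degree_diff_less by blast
    qed (use 0 1 in auto)
    ultimately show False
      unfolding * by linarith
  qed
  then have eq': "[:a:] * r0 = [:c:] * r1"
    using * by simp
  have "c dvd coeff r0 i" for i
  proof -
    have "a * coeff r0 i = c * coeff r1 i"
      using arg_cong[OF eq', of "\<lambda>p. coeff p i"] by simp
    then show ?thesis
      using nzd by (metis dvd_triv_left)
  qed
  then have "[:c:] dvd r0"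
    by (simp add: const_poly_dvd_iff)
  then show ?thesis
    using 0(1) that by (metis dvdE)
qed

text \<open>The three variables are eliminated from the outside in. The sum is monic in the
  outermost variable; modulo it the second polynomial becomes one that is monic in the middle
  variable; modulo both the third becomes the cube of \<open>U\<close>, which involves only the
  innermost variable. Each stage is then an instance of \<open>monic_regular\<close>.\<close>

lemma elementary_symmetric_regular:
  fixes h :: "'k::field poly" and U V W b q r :: "'k poly poly poly"
  assumes h: "lead_coeff h = 1" "degree h > 0"
  defines "U \<equiv> [:[:h:]:]" and "V \<equiv> [:map_poly (\<lambda>c. [:c:]) h:]" and "W \<equiv> map_poly (\<lambda>c. [:[:c:]:]) h"
  shows "U + V + W \<noteq> 0"
    and "(U * V + V * W + W * U) * b = (U + V + W) * q \<Longrightarrow> \<exists>q'. b = (U + V + W) * q'"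
    and "U * V * W * b = (U + V + W) * q + (U * V + V * W + W * U) * r \<Longrightarrow>
         \<exists>q' r'. b = (U + V + W) * q' + (U * V + V * W + W * U) * r'"
proof -
  define x y where "x = [:h:]" and "y = map_poly (\<lambda>c. [:c:]) h"
  have Xx: "U = [:x:]" and Yy: "V = [:y:]"
    by (simp_all add: U_def V_def x_def y_def)
  have h0: "h \<noteq> 0"
    using h by auto
  have dy: "degree y = degree h" and ly: "lead_coeff y = 1"
    using h by (auto simp: y_def degree_map_poly coeff_map_poly one_pCons)
  have dz: "degree W = degree h" and lz: "lead_coeff W = 1"
    using h by (auto simp: W_def degree_map_poly coeff_map_poly one_pCons)
  have dg: "degree (U + V + W) = degree h"
    unfolding Xx Yy using dz h by (subst degree_add_eq_right) auto
  have g1: "lead_coeff (U + V + W) = 1"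
    unfolding dg using lz dz h unfolding Xx Yy by (simp add: coeff_pCons split: nat.split)
  show "U + V + W \<noteq> 0"
    using g1 by (metis leading_coeff_0_iff zero_neq_one)
  \<comment> \<open>Substituting \<open>W = - (U + V)\<close> turns the second elementary symmetric
    polynomial into the negative of \<open>U^2 + U V + V^2\<close>; this is \<open>w\<close>, free
    of the outermost variable.\<close>
  define w where "w = y * y + (x * y + x * x)"
  have y0: "y \<noteq> 0"
    using ly by auto
  have "degree (y * y) = 2 * degree h"
    using y0 dy by (simp add: degree_mult_eq)
  moreover have "degree (x * y + x * x) \<le> degree h"
    using dy h0 by (intro degree_add_le) (auto simp: x_def degree_mult_eq)
  ultimately have dw: "degree (x * y + x * x) < degree (y * y)"
    using h by simp
  have g2: "lead_coeff w = 1"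
    unfolding w_def using lead_coeff_add_le[OF dw] ly by (simp add: add.commute lead_coeff_mult)
  then have w0: "w \<noteq> 0"
    by auto
  have e2: "U * V + V * W + W * U = (U + V + W) * (U + V) - [:w:]"
    unfolding Xx Yy w_def by (simp add: algebra_simps smult_add_left)
  show "\<exists>q'. b = (U + V + W) * q'" if "(U * V + V * W + W * U) * b = (U + V + W) * q"
  proof -
    have "[:w:] * b = (U + V + W) * ((U + V) * b - q) + [:0:] * 0"
      using that unfolding e2 by (simp add: algebra_simps)
    from monic_regular[OF g1 _ this] show ?thesis
      using w0 by auto
  qed
  \<comment> \<open>The same descent one level lower: \<open>w\<close> is monic over
    \<open>K[x]\<close>, and \<open>h ^ 3\<close> is a nonzero element of the domain
    \<open>K[x]\<close>.\<close>
  have nzd: "w dvd y'" if dvd: "w dvd x ^ 3 * y'" for y'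
  proof -
    obtain q where "x ^ 3 * y' = w * q"
      using dvd by (elim dvdE)
    then have eq: "[:h ^ 3:] * y' = w * q + [:0:] * 0"
      by (simp add: x_def poly_const_pow)
    have "0 dvd c" if "0 dvd h ^ 3 * c" for c
      using that h0 by simp
    from monic_regular[OF g2 this eq] obtain q' j' where "y' = w * q' + [:0:] * j'" .
    then show ?thesis
      by simp
  qed
  show "\<exists>q' r'. b = (U + V + W) * q' + (U * V + V * W + W * U) * r'"
    if "U * V * W * b = (U + V + W) * q + (U * V + V * W + W * U) * r"
  proof -
    \<comment> \<open>\<open>U\<close> is a root of the cubic with roots \<open>U\<close>,
      \<open>V\<close>, \<open>W\<close>, so the product equals \<open>U ^ 3\<close> modulo the
      first two symmetric polynomials.\<close>
    have "U * V * W = U ^ 3 - (U + V + W) * U ^ 2 + (U * V + V * W + W * U) * U"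
      by (simp add: algebra_simps power2_eq_square power3_eq_cube)
    then have "U ^ 3 * b = (U + V + W) * (q + U ^ 2 * b) + (U * V + V * W + W * U) * (r - U * b)"
      using that by (simp add: algebra_simps)
    also have "\<dots> = (U + V + W) * (q + U ^ 2 * b + (U + V) * (r - U * b)) + [:w:] * (U * b - r)"
      unfolding e2 by (simp add: algebra_simps)
    finally have "[:x ^ 3:] * b = (U + V + W) * (q + U ^ 2 * b + (U + V) * (r - U * b)) + [:w:] * (U * b - r)"
      by (simp add: Xx poly_const_pow)
    from monic_regular[OF g1 nzd this] obtain q' j' where "b = (U + V + W) * q' + [:w:] * j'" .
    then have "b = (U + V + W) * (q' + (U + V) * j') + (U * V + V * W + W * U) * (- j')"
      unfolding e2 by (simp add: algebra_simps)
    then show ?thesis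
      by blast
  qed
qed

section \<open>Evaluation homomorphisms and the coordinate ring of a triangle\<close>

definition poly_eval :: "('k \<Rightarrow> 'b) \<Rightarrow> ('x \<Rightarrow> 'b) \<Rightarrow> ('x, 'k::comm_ring_1) mpoly \<Rightarrow> 'b::comm_ring_1" where
  "poly_eval \<kappa> \<rho> p = (\<Sum>m\<in>keys p.
     \<kappa> (lookup p m) * (\<Prod>v\<in>keys m. \<rho> v ^ lookup m v))"

locale coeff_hom =
  fixes \<kappa> :: "'k::comm_ring_1 \<Rightarrow> 'b::comm_ring_1" and \<rho> :: "'x \<Rightarrow> 'b"
  assumes hom_1: "\<kappa> 1 = 1" and hom_add: "\<kappa> (a + b) = \<kappa> a + \<kappa> b" and hom_mult: "\<kappa> (a * b) = \<kappa> a * \<kappa> b"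
begin

lemma hom_0: "\<kappa> 0 = 0"
  using hom_add[of 0 0] by simp

lemma eval_prod:
  assumes "finite B" "keys m \<subseteq> B"
  shows "(\<Prod>v\<in>keys m. \<rho> v ^ lookup m v) = (\<Prod>v\<in>B. \<rho> v ^ lookup m v)"
  using assms by (intro prod.mono_neutral_left) (auto simp: in_keys_iff)

lemma eval_sum:
  assumes "finite B" "keys p \<subseteq> B"
  shows "poly_eval \<kappa> \<rho> p = (\<Sum>m\<in>B. \<kappa> (lookup p m) *
    (\<Prod>v\<in>keys m. \<rho> v ^ lookup m v))"
  unfolding poly_eval_def using assms by (intro sum.mono_neutral_left) (auto simp: in_keys_iff hom_0)

lemma eval_add: "poly_eval \<kappa> \<rho> (p + q) = poly_eval \<kappa> \<rho> p + poly_eval \<kappa> \<rho> q"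
proof -
  let ?B = "keys p \<union> keys q"
  have *: "finite ?B" "keys p \<subseteq> ?B" "keys q \<subseteq> ?B" "keys (p + q) \<subseteq> ?B"
    using keys_add[of p q] by auto
  show ?thesis
    by (simp add: eval_sum[OF *(1,2)] eval_sum[OF *(1,3)] eval_sum[OF *(1,4)] lookup_add hom_add
        distrib_right sum.distrib)
qed

lemma eval_0: "poly_eval \<kappa> \<rho> 0 = 0"
  by (simp add: poly_eval_def)

lemma eval_Sum: "poly_eval \<kappa> \<rho> (sum f B) = (\<Sum>i\<in>B. poly_eval \<kappa> \<rho> (f i))"
  by (induction B rule: infinite_finite_induct) (auto simp: eval_0 eval_add)

lemma eval_single:
  "poly_eval \<kappa> \<rho> (single m c) = \<kappa> c * (\<Prod>v\<in>keys m. \<rho> v ^ lookup m v)"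
  by (simp add: poly_eval_def hom_0)

lemma eval_mult: "poly_eval \<kappa> \<rho> (p * q) = poly_eval \<kappa> \<rho> p * poly_eval \<kappa> \<rho> q"
proof -
  have single: "poly_eval \<kappa> \<rho> (single (m + m') (a * b)) =
      poly_eval \<kappa> \<rho> (single m a) * poly_eval \<kappa> \<rho> (single m' b)" for m m' a b
    using eval_prod[of "keys m \<union> keys m'" m]
      eval_prod[of "keys m \<union> keys m'" m']
    by (simp add: eval_single keys_add_nat lookup_add power_add prod.distrib hom_mult mult_ac)
  have "p * q = (\<Sum>m\<in>keys p. \<Sum>m'\<in>keys q.
      single (m + m') (lookup p m * lookup q m'))"
    by (subst poly_mapping_sum_singles[of p], subst poly_mapping_sum_singles[of q])
       (simp add: sum_product mult_single)
  then have "poly_eval \<kappa> \<rho> (p * q) =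
      poly_eval \<kappa> \<rho> (\<Sum>m\<in>keys p. single m (lookup p m)) *
      poly_eval \<kappa> \<rho> (\<Sum>m\<in>keys q. single m (lookup q m))"
    by (simp only: eval_Sum single sum_product)
  then show ?thesis
    using poly_mapping_sum_singles[of p] poly_mapping_sum_singles[of q] by simp
qed

lemma eval_Const: "poly_eval \<kappa> \<rho> (Const c) = \<kappa> c"
  by (simp add: Const_def eval_single)

lemma eval_1: "poly_eval \<kappa> \<rho> 1 = 1"
  using eval_Const[of 1] by (simp add: hom_1)

lemma eval_Var: "poly_eval \<kappa> \<rho> (Var v) = \<rho> v"
  by (simp add: Var_def eval_single hom_1)

lemma eval_power: "poly_eval \<kappa> \<rho> (p ^ n) = poly_eval \<kappa> \<rho> p ^ n"
  by (induction n) (auto simp: eval_1 eval_mult)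

lemma eval_diff: "poly_eval \<kappa> \<rho> (p - q) = poly_eval \<kappa> \<rho> p - poly_eval \<kappa> \<rho> q"
  using eval_add[of "p - q" q] by simp

end

text \<open>The Stanley--Reisner ideal described by the supports of its monomials instead of by
  generators; \<open>stanley_reisner_ideal_eq\<close> reconciles the two. For \<open>Pow F\<close>
  it is the ideal of the variables outside \<open>F\<close>, and for the complex without any face it
  is the whole ring.\<close>

definition sr_ideal :: "'x set \<Rightarrow> 'x set set \<Rightarrow> ('x, 'k::comm_ring_1) mpoly set" where
  "sr_ideal V \<Delta> = {p \<in> polys V. \<forall>m\<in>keys p. keys m \<notin> \<Delta>}"

text \<open>Modulo \<open>P\<^sub>F\<close> with \<open>F = {x, y, z}\<close>, the polynomial ring becomes \<open>K[x][y][z]\<close>.\<close>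

definition simplex_var :: "'x \<Rightarrow> 'x \<Rightarrow> 'x \<Rightarrow> 'x \<Rightarrow> 'k::comm_ring_1 poly poly poly" where
  "simplex_var x y z v =
     (if v = x then [:[:[:0, 1:]:]:] else if v = y then [:[:0, 1:]:] else if v = z then [:0, 1:] else 0)"

definition simplex_map :: "'x \<Rightarrow> 'x \<Rightarrow> 'x \<Rightarrow> ('x, 'k::comm_ring_1) mpoly \<Rightarrow> 'k poly poly poly" where
  "simplex_map x y z = poly_eval (\<lambda>c. [:[:[:c:]:]:]) (simplex_var x y z)"

interpretation simplex: coeff_hom "\<lambda>c. [:[:[:c:]:]:]" "simplex_var x y z" for x y z
  by unfold_locales (auto simp: one_pCons)

lemmas simplex_simps = simplex.eval_add simplex.eval_mult simplex.eval_diff simplex.eval_Const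
  simplex.eval_Var simplex.eval_Sum simplex.eval_power simplex.eval_0 simplex.eval_1

lemma const_mult_X_power: "[:c:] * [:0, 1:] ^ n = monom (c::'a::comm_ring_1) n"
  by (simp add: monom_altdef)

lemma simplex_map_single:
  assumes "x \<noteq> y" "x \<noteq> z" "y \<noteq> z"
  shows "simplex_map x y z (single m c) =
    (if keys m \<subseteq> {x, y, z}
     then monom (monom (monom c (lookup m x)) (lookup m y)) (lookup m z)
     else 0)"
proof (cases "keys m \<subseteq> {x, y, z}")
  case True
  then have "simplex_map x y z (single m c) = [:[:[:c:]:]:] *
      (\<Prod>v\<in>{x, y, z}. simplex_var x y z v ^ lookup m v)"
    unfolding simplex_map_def simplex.eval_single
    by (subst simplex.eval_prod[of "{x, y, z}"]) auto
  also have "\<dots> = [:[:[:c:] * [:0, 1:] ^ lookup m x:] * [:0, 1:] ^ lookup m y:]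
      * [:0, 1:] ^ lookup m z"
    using assms by (simp add: simplex_var_def poly_const_pow)
  finally show ?thesis
    using True by (simp only: const_mult_X_power if_True)
next
  case False
  then obtain v where v: "v \<in> keys m" "v \<notin> {x, y, z}"
    by blast
  then have "simplex_var x y z v ^ lookup m v = (0 :: 'b poly poly poly)"
    by (auto simp: simplex_var_def in_keys_iff zero_power)
  then have "(\<Prod>v\<in>keys m. simplex_var x y z v ^ lookup m v) = (0 :: 'b poly poly poly)"
    using v by (intro prod_zero) auto
  then show ?thesis
    using False by (simp add: simplex_map_def simplex.eval_single)
qed

text \<open>Distinct monomials supported in \<open>{x, y, z}\<close> have distinct monomials as
  images, and all others are killed. Three nested coefficient extractions therefore read off each
  coefficient of \<open>p\<close> on the triangle.\<close>

lemma simplex_map_eq_0_iff: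
  assumes d: "x \<noteq> y" "x \<noteq> z" "y \<noteq> z" and p: "p \<in> polys V"
  shows "simplex_map x y z p = 0 \<longleftrightarrow> p \<in> sr_ideal V (Pow {x, y, z})"
proof -
  have p_eq: "simplex_map x y z p =
      (\<Sum>m\<in>keys p. simplex_map x y z (single m (lookup p m)))"
    unfolding simplex_map_def by (subst poly_mapping_sum_singles[of p]) (rule simplex.eval_Sum)
  show ?thesis
  proof
    assume "p \<in> sr_ideal V (Pow {x, y, z})"
    then show "simplex_map x y z p = 0"
      unfolding p_eq by (intro sum.neutral) (auto simp: simplex_map_single[OF d] sr_ideal_def)
  next
    assume 0: "simplex_map x y z p = 0"
    have "\<not> keys m \<subseteq> {x, y, z}" if m: "m \<in> keys p" for m
    proof
      assume sub: "keys m \<subseteq> {x, y, z}"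
      have eqI: "m' = m" if "keys m' \<subseteq> {x, y, z}"
        "lookup m' x = lookup m x" "lookup m' y = lookup m y"
        "lookup m' z = lookup m z" for m'
      proof (rule poly_mapping_eqI)
        fix v
        show "lookup m' v = lookup m v"
        proof (cases "v \<in> {x, y, z}")
          case False
          then show ?thesis
            using that(1) sub by (metis in_keys_iff subsetD)
        qed (use that in auto)
      qed
      let ?c = "\<lambda>P. coeff (coeff (coeff P (lookup m z)) (lookup m y)) (lookup m x)"
      have "0 = ?c (simplex_map x y z p)"
        using 0 by simp
      also have "\<dots> = (\<Sum>m'\<in>keys p. if m' = m then lookup p m' else 0)"
        unfolding p_eq coeff_sum
        by (intro sum.cong) (auto simp: simplex_map_single[OF d] sub dest: eqI)
      also have "\<dots> = lookup p m"
        using m by simp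
      finally show False
        using m by (simp add: in_keys_iff)
    qed
    then show "p \<in> sr_ideal V (Pow {x, y, z})"
      using p by (auto simp: sr_ideal_def)
  qed
qed

text \<open>The image is closed under sums and products and contains the constants and the three
  variables; the three inductions climb through \<open>K[x]\<close>, \<open>K[x][y]\<close> and
  \<open>K[x][y][z]\<close>.\<close>

lemma simplex_map_surj:
  fixes b :: "'k::comm_ring_1 poly poly poly"
  assumes d: "x \<noteq> y" "x \<noteq> z" "y \<noteq> z" and V: "{x, y, z} \<subseteq> V"
  shows "\<exists>p\<in>polys V. simplex_map x y z p = b"
proof -
  let ?R = "simplex_map x y z ` (polys V :: ('a, 'k) mpoly set)"
  have add: "a + b \<in> ?R" and mult: "a * b \<in> ?R" if "a \<in> ?R" "b \<in> ?R" for a b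
    using that by (auto simp: simplex_map_def simp flip: simplex_simps intro!: imageI)
  have const: "[:[:[:c:]:]:] \<in> ?R" for c
    using Const_mem_polys by (force simp: simplex_map_def simplex_simps intro: image_eqI[of _ _ "Const c"])
  have var: "simplex_var x y z v \<in> ?R" if "v \<in> {x, y, z}" for v
    using Var_mem_polys that V
    by (force simp: simplex_map_def simplex_simps intro: image_eqI[of _ _ "Var v"])
  note vars = var[of x] var[of y] var[of z]
  have 1: "[:[:a:]:] \<in> ?R" for a
  proof (induction a)
    case 0
    then show ?case
      using const[of 0] by simp
  next
    case (pCons a p)
    have "[:[:pCons a p:]:] = [:[:[:a:]:]:] + simplex_var x y z x * [:[:p:]:]"
      by (simp add: simplex_var_def)
    then show ?case
      using pCons(2) const vars by (simp only:) (intro add mult, auto)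
  qed
  have 2: "[:a:] \<in> ?R" for a
  proof (induction a)
    case 0
    then show ?case
      using const[of 0] by simp
  next
    case (pCons a p)
    have "[:pCons a p:] = [:[:a:]:] + simplex_var x y z y * [:p:]"
      using d by (simp add: simplex_var_def)
    then show ?case
      using pCons(2) 1 vars by (simp only:) (intro add mult, auto)
  qed
  have "b \<in> ?R"
  proof (induction b)
    case 0
    then show ?case
      using const[of 0] by simp
  next
    case (pCons a p)
    have "pCons a p = [:a:] + simplex_var x y z z * p"
      using d by (simp add: simplex_var_def)
    then show ?case
      using pCons(2) 2 vars by (simp only:) (intro add mult, auto)
  qed
  then show ?thesis
    by blast
qed

text \<open>Under a surjection with kernel \<open>I\<close> the cofactor of each new generator can
  be lifted, so the stages of \<open>adjoin\<close> correspond. Regularity modulo \<open>I\<close>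
  may thus be tested in the target ring.\<close>

lemma (in subring_on) mem_adjoin_iff_hom:
  assumes I: "\<And>s. s \<in> S \<Longrightarrow> s \<in> I \<longleftrightarrow> \<phi> s = 0" and sub: "I \<subseteq> S" and g: "\<And>i. i < n \<Longrightarrow> g i \<in> S"
    and diff: "\<And>a b. \<phi> (a - b) = \<phi> a - \<phi> b"
    and mult: "\<And>a b. \<phi> (a * b) = \<phi> a * \<phi> b" and surj: "\<And>b. \<exists>s\<in>S. \<phi> s = b"
    and "i \<le> n" "s \<in> S"
  shows "s \<in> adjoin S g I i \<longleftrightarrow> \<phi> s \<in> adjoin UNIV (\<lambda>i. \<phi> (g i)) {0} i"
  using assms(7,8)
proof (induction i arbitrary: s)
  case (Suc i)
  have gi: "g i \<in> S"
    using Suc.prems g by simp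
  show ?case
  proof
    assume "s \<in> adjoin S g I (Suc i)"
    then obtain a c where "s = a + g i * c" "a \<in> adjoin S g I i" "c \<in> S"
      by auto
    moreover from this have "a \<in> S"
      using Suc.prems gi by (metis add_diff_cancel_right' diff_mem mult_mem)
    moreover have "\<phi> (a + g i * c) = \<phi> a + \<phi> (g i) * \<phi> c"
      using diff[of "a + g i * c" "g i * c"] mult by simp
    ultimately show "\<phi> s \<in> adjoin UNIV (\<lambda>i. \<phi> (g i)) {0} (Suc i)"
      using Suc.IH[of a] Suc.prems by auto
  next
    assume "\<phi> s \<in> adjoin UNIV (\<lambda>i. \<phi> (g i)) {0} (Suc i)"
    then obtain a c where ac: "\<phi> s = a + \<phi> (g i) * c" "a \<in> adjoin UNIV (\<lambda>i. \<phi> (g i)) {0} i"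
      by auto
    obtain c' where c': "c' \<in> S" "\<phi> c' = c"
      using surj by blast
    then have "\<phi> (s - g i * c') = a"
      using ac(1) by (simp add: diff mult)
    then have "s - g i * c' \<in> adjoin S g I i"
      using Suc.IH[of "s - g i * c'"] Suc.prems gi c' ac by simp
    then show "s \<in> adjoin S g I (Suc i)"
      unfolding adjoin.simps using c'
      by (intro CollectI exI[of _ "s - g i * c'"] exI[of _ c']) simp
  qed
qed (use I in auto)

section \<open>Elementary symmetric polynomials on a single facet\<close>

definition esym :: "'x set \<Rightarrow> ('x \<Rightarrow> 'a::comm_ring_1) \<Rightarrow> nat \<Rightarrow> 'a" where
  "esym V u k = (\<Sum>T | T \<subseteq> V \<and> card T = k. \<Prod>v\<in>T. u v)"

lemma esym_supported:
  assumes V: "finite V" "F \<subseteq> V" and u: "\<And>v. v \<in> V \<Longrightarrow> v \<notin> F \<Longrightarrow> u v = 0"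
  shows "esym V u k = esym F u k"
  unfolding esym_def
proof (rule sum.mono_neutral_right)
  show "\<forall>T\<in>{T. T \<subseteq> V \<and> card T = k} - {T. T \<subseteq> F \<and> card T = k}. (\<Prod>v\<in>T. u v) = 0"
  proof
    fix T assume T: "T \<in> {T. T \<subseteq> V \<and> card T = k} - {T. T \<subseteq> F \<and> card T = k}"
    then obtain v where "v \<in> T" "v \<notin> F"
      by blast
    moreover have "finite T"
      using T V finite_subset by blast
    ultimately show "(\<Prod>v\<in>T. u v) = 0"
      using T u[of v] by (intro prod_zero) auto
  qed
qed (use V in auto)

lemma esym_3:
  assumes "x \<noteq> y" "x \<noteq> z" "y \<noteq> z"
  shows "esym {x, y, z} u 1 = u x + u y + u z"
    and "esym {x, y, z} u 2 = u x * u y + u y * u z + u z * u x"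
    and "esym {x, y, z} u 3 = u x * u y * u z"
proof -
  have "{T. T \<subseteq> {x, y, z} \<and> card T = 1} = {{x}, {y}, {z}}"
    by (auto simp: card_1_singleton_iff)
  then show "esym {x, y, z} u 1 = u x + u y + u z"
    using assms by (simp add: esym_def add_ac)
  have "{T. T \<subseteq> {x, y, z} \<and> card T = 2} = {{x, y}, {y, z}, {z, x}}"
    using assms by (auto simp: card_2_iff)
  moreover have "{x, y} \<noteq> {y, z}" "{x, y} \<noteq> {z, x}" "{y, z} \<noteq> {z, x}"
    using assms by auto
  ultimately show "esym {x, y, z} u 2 = u x * u y + u y * u z + u z * u x"
    using assms by (simp add: esym_def add_ac)
  have "card {x, y, z} = 3"
    using assms by simp
  then have "{T. T \<subseteq> {x, y, z} \<and> card T = 3} = {{x, y, z}}"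
    using card_subset_eq[of "{x, y, z}"] by auto
  then show "esym {x, y, z} u 3 = u x * u y * u z"
    using assms by (simp add: esym_def mult_ac)
qed

lemma hom_esym:
  fixes V :: "'x set"
  assumes "\<phi> 0 = 0" "\<And>a b. \<phi> (a + b) = \<phi> a + \<phi> b" "\<phi> 1 = 1" "\<And>a b. \<phi> (a * b) = \<phi> a * \<phi> b"
  shows "\<phi> (esym V u k) = esym V (\<lambda>v. \<phi> (u v)) k"
proof -
  have "\<phi> (\<Prod>v\<in>T. u v) = (\<Prod>v\<in>T. \<phi> (u v))" for T
    by (induction T rule: infinite_finite_induct) (auto simp: assms)
  moreover have "\<phi> (\<Sum>T\<in>A. f T) = (\<Sum>T\<in>A. \<phi> (f T))" for f and A :: "'x set set"
    by (induction A rule: infinite_finite_induct) (auto simp: assms)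
  ultimately show ?thesis
    by (simp add: esym_def)
qed

definition univ_eval :: "'k::comm_ring_1 poly \<Rightarrow> 'x \<Rightarrow> ('x, 'k) mpoly" where
  "univ_eval h v = (\<Sum>i\<le>degree h. Const (coeff h i) * Var v ^ i)"

lemma univ_eval_mem_polys [simp]: "v \<in> V \<Longrightarrow> univ_eval h v \<in> polys V"
  by (auto simp: univ_eval_def intro!: polys.sum_mem polys.mult_mem polys.power_mem)

lemma map_poly_conv_sum:
  assumes "f 0 = 0"
  shows "map_poly f h = (\<Sum>i\<le>degree h. [:f (coeff h i):] * [:0, 1:] ^ i)"
proof -
  have "map_poly f h = (\<Sum>i\<le>degree h. monom (f (coeff h i)) i)"
    using assms by (intro poly_eqI)
      (auto simp: coeff_map_poly coeff_sum if_distrib coeff_eq_0 cong: if_cong)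
  then show ?thesis
    by (simp add: monom_altdef)
qed

lemma simplex_map_univ_eval:
  assumes "x \<noteq> y" "x \<noteq> z" "y \<noteq> z" and h: "coeff h 0 = 0"
  shows "simplex_map x y z (univ_eval h x) = [:[:h:]:]"
    and "simplex_map x y z (univ_eval h y) = [:map_poly (\<lambda>c. [:c:]) h:]"
    and "simplex_map x y z (univ_eval h z) = map_poly (\<lambda>c. [:[:c:]:]) h"
    and "v \<notin> {x, y, z} \<Longrightarrow> simplex_map x y z (univ_eval h v) = 0"
proof -
  have *: "simplex_map x y z (univ_eval h v) =
      (\<Sum>i\<le>degree h. [:[:[:coeff h i:]:]:] * simplex_var x y z v ^ i)" for v
    by (simp add: simplex_map_def univ_eval_def simplex_simps)
  have sum_const: "(\<Sum>i\<in>A. [:f i:]) = [:\<Sum>i\<in>A. f i:]" for f :: "nat \<Rightarrow> 'c::comm_ring_1" and A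
    by (induction A rule: infinite_finite_induct) auto
  have id: "map_poly (\<lambda>c. c) h = h"
    using map_poly_id[of h] by (simp add: id_def)
  show "simplex_map x y z (univ_eval h x) = [:[:h:]:]"
    unfolding * using map_poly_conv_sum[of "\<lambda>c. c" h] id
    by (simp add: simplex_var_def poly_const_pow sum_const del: mult_pCons_left)
  show "simplex_map x y z (univ_eval h y) = [:map_poly (\<lambda>c. [:c:]) h:]"
    unfolding * using map_poly_conv_sum[of "\<lambda>c. [:c:]" h] assms(1)
    by (simp add: simplex_var_def poly_const_pow sum_const)
  show "simplex_map x y z (univ_eval h z) = map_poly (\<lambda>c. [:[:c:]:]) h"
    unfolding * using map_poly_conv_sum[of "\<lambda>c. [:[:c:]:]" h] assms(2,3)
    by (simp add: simplex_var_def)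
  show "simplex_map x y z (univ_eval h v) = 0" if "v \<notin> {x, y, z}"
    unfolding * using that h by (intro sum.neutral) (auto simp: simplex_var_def power_0_left)
qed

text \<open>Modulo the variables outside \<open>F\<close>, the condition
  \<open>coeff h 0 = 0\<close> makes every \<open>univ_eval h v\<close> with \<open>v\<close>
  outside \<open>F\<close> vanish, so only the three-variable symmetric polynomials survive. The
  shift \<open>Suc i\<close> skips the degree 0 polynomial, which is 1.\<close>

lemma weakly_regular_simplex:
  fixes h :: "'k::field poly"
  assumes V: "finite V" "F \<subseteq> V" "card F = 3" and h: "lead_coeff h = 1" "degree h > 0" "coeff h 0 = 0"
  shows "weakly_regular (polys V) (\<lambda>i. esym V (univ_eval h) (Suc i)) 3 (sr_ideal V (Pow F))"
proof -
  obtain x y z where F: "F = {x, y, z}" and d: "x \<noteq> y" "x \<noteq> z" "y \<noteq> z"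
    using V(3) by (auto simp: card_3_iff)
  let ?\<phi> = "simplex_map x y z :: ('a, 'k) mpoly \<Rightarrow> _"
  define g where "g = (\<lambda>i. esym V (univ_eval h :: _ \<Rightarrow> _ \<Rightarrow>\<^sub>0 'k) (Suc i))"
  have g_mem: "g i \<in> polys V" for i
    unfolding g_def esym_def by (intro polys.sum_mem polys.prod_mem) auto
  define u where "u = (\<lambda>v. ?\<phi> (univ_eval h v))"
  have "?\<phi> (g i) = esym F u (Suc i)" for i
  proof -
    have "?\<phi> (g i) = esym V u (Suc i)"
      unfolding g_def u_def by (rule hom_esym) (simp_all add: simplex_map_def simplex_simps)
    then show ?thesis
      using esym_supported[OF V(1,2), of u] simplex_map_univ_eval(4)[OF d h(3)] F
      by (simp add: u_def)
  qed
  then have \<phi>g: "?\<phi> (g 0) = u x + u y + u z" "?\<phi> (g (Suc 0)) = u x * u y + u y * u z + u z * u x"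
    "?\<phi> (g (Suc (Suc 0))) = u x * u y * u z"
    using esym_3[OF d, of u] F by (simp_all add: numeral_eq_Suc)
  have u_eq: "u x = [:[:h:]:]" "u y = [:map_poly (\<lambda>c. [:c:]) h:]" "u z = map_poly (\<lambda>c. [:[:c:]:]) h"
    using simplex_map_univ_eval(1-3)[OF d h(3)] by (simp_all add: u_def)
  note reg = elementary_symmetric_regular[OF h(1,2), folded u_eq]
  let ?A = "adjoin UNIV (\<lambda>i. ?\<phi> (g i)) {0}"
  have A1: "b \<in> ?A (Suc 0) \<longleftrightarrow> (\<exists>q. b = (u x + u y + u z) * q)" for b
    by (auto simp: \<phi>g)
  have A2: "b \<in> ?A (Suc (Suc 0)) \<longleftrightarrow>
      (\<exists>q r. b = (u x + u y + u z) * q + (u x * u y + u y * u z + u z * u x) * r)" for b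
    by (subst adjoin.simps(2), unfold A1) (auto simp: \<phi>g)
  have iff: "s \<in> adjoin (polys V) g (sr_ideal V (Pow F)) i \<longleftrightarrow>
      ?\<phi> s \<in> adjoin UNIV (\<lambda>i. ?\<phi> (g i)) {0} i" if "s \<in> polys V" "i \<le> 3" for s i
  proof (rule polys.mem_adjoin_iff_hom)
    show "s \<in> sr_ideal V (Pow F) \<longleftrightarrow> ?\<phi> s = 0" if "s \<in> polys V" for s
      unfolding F using simplex_map_eq_0_iff[OF d that] by simp
    show "\<exists>s\<in>polys V. ?\<phi> s = b" for b
      using simplex_map_surj[OF d] V(2) F by blast
  qed (use that g_mem in \<open>auto simp: simplex_map_def simplex_simps sr_ideal_def\<close>)
  show ?thesis
    unfolding weakly_regular_def g_def[symmetric]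
  proof (intro allI impI ballI)
    fix i s assume i: "i < 3" and s: "s \<in> polys V" "g i * s \<in> adjoin (polys V) g (sr_ideal V (Pow F)) i"
    have "?\<phi> (g i) * ?\<phi> s \<in> adjoin UNIV (\<lambda>i. ?\<phi> (g i)) {0} i"
      using s i iff[of "g i * s" i] g_mem by (simp add: simplex_map_def simplex_simps)
    moreover have "i = 0 \<or> i = Suc 0 \<or> i = 2"
      using i by auto
    ultimately have "?\<phi> s \<in> ?A i"
    proof (elim disjE)
      assume "?\<phi> (g i) * ?\<phi> s \<in> ?A i" "i = 0"
      then show ?thesis
        using reg(1) by (simp add: \<phi>g)
    next
      assume "?\<phi> (g i) * ?\<phi> s \<in> ?A i" "i = Suc 0"
      then show ?thesis
        using reg(2)[of "?\<phi> s"] by (simp only: A1 \<phi>g) blast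
    next
      assume "?\<phi> (g i) * ?\<phi> s \<in> ?A i" "i = 2"
      then show ?thesis
        using reg(3)[of "?\<phi> s"] by (simp only: A2 \<phi>g numeral_2_eq_2) blast
    qed
    then show "s \<in> adjoin (polys V) g (sr_ideal V (Pow F)) i"
      using iff s i by simp
  qed
qed

section \<open>Stanley--Reisner ideals of shellable complexes\<close>

lemma keys_single_mult:
  "keys (single e 1 * p) = (\<lambda>m. e + m) ` keys p"
  for p :: "('x, 'k::comm_ring_1) mpoly"
proof
  show "keys (single e 1 * p) \<subseteq> (\<lambda>m. e + m) ` keys p"
    by (auto elim!: keys_mult_subset split: if_splits)
  have eq: "single e 1 * p =
      (\<Sum>m\<in>keys p. single (e + m) (lookup p m))"
    by (subst poly_mapping_sum_singles[of p]) (simp add: sum_distrib_left mult_single)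
  have "lookup (single e 1 * p) (e + m) = lookup p m"
    if "m \<in> keys p" for m
    unfolding eq lookup_sum lookup_single when_def using that by simp
  then show "(\<lambda>m. e + m) ` keys p \<subseteq> keys (single e 1 * p)"
    by (auto simp: in_keys_iff)
qed

definition face_exponent :: "'x set \<Rightarrow> ('x \<Rightarrow>\<^sub>0 nat)" where
  "face_exponent F = (\<Sum>v\<in>F. single v 1)"

lemma lookup_face_exponent:
  "finite F \<Longrightarrow> lookup (face_exponent F) v = (if v \<in> F then 1 else 0)"
  by (simp add: face_exponent_def lookup_sum lookup_single when_def)

lemma keys_face_exponent: "finite F \<Longrightarrow> keys (face_exponent F) = F"
  by (rule Set.set_eqI) (simp add: in_keys_iff lookup_face_exponent)

lemma face_monomial_eq:
  "(face_monomial F :: ('x, 'k::comm_ring_1) mpoly) = single (face_exponent F) 1"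
proof (induction F rule: infinite_finite_induct)
  case (insert v F)
  then have "(face_monomial (insert v F) :: ('x, 'k) mpoly) = single (single v 1) 1 * face_monomial F"
    by (simp add: face_monomial_def)
  also have "\<dots> = single (single v 1 + face_exponent F) 1"
    unfolding insert.IH by (simp only: mult_single mult_1)
  finally show ?case
    using insert.hyps by (simp add: face_exponent_def)
qed (simp_all add: face_monomial_def face_exponent_def)

lemma face_exponent_dvd:
  assumes "finite F" "F \<subseteq> keys m"
  shows "face_exponent F + (m - face_exponent F) = m"
  using assms by (intro poly_mapping_eqI) (auto simp: lookup_add lookup_minus lookup_face_exponent in_keys_iff)

lemma face_monomial_multiple:
  fixes p :: "('x, 'k::comm_ring_1) mpoly"
  assumes "finite F" and p: "p \<in> polys V" and F: "\<And>m. m \<in> keys p \<Longrightarrow> F \<subseteq> keys m"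
  shows "\<exists>q\<in>polys V. p = face_monomial F * q"
proof
  let ?q = "\<Sum>m\<in>keys p. single (m - face_exponent F) (lookup p m)"
  have "keys (m - face_exponent F) \<subseteq> keys m" for m
    by (auto simp: in_keys_iff lookup_minus)
  then have "keys (m - face_exponent F) \<subseteq> V" if "m \<in> keys p" for m
    using p that by (fastforce simp: polys_def)
  then show "?q \<in> polys V"
    by (intro polys.sum_mem single_mem_polys)
  have "face_monomial F * ?q = (\<Sum>m\<in>keys p.
      single (face_exponent F + (m - face_exponent F)) (lookup p m))"
    by (simp add: face_monomial_eq sum_distrib_left mult_single)
  also have "\<dots> = (\<Sum>m\<in>keys p. single m (lookup p m))"
    by (intro sum.cong) (simp_all add: face_exponent_dvd assms(1) F)
  also have "\<dots> = p"
    by (rule poly_mapping_sum_singles[symmetric])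
  finally show "p = face_monomial F * ?q" ..
qed

text \<open>Multiplication can only enlarge supports, and a set containing a nonface is a
  nonface.\<close>

lemma ideal_on_sr_ideal:
  assumes "\<And>F G. F \<in> \<Delta> \<Longrightarrow> G \<subseteq> F \<Longrightarrow> G \<in> \<Delta>"
  shows "ideal_on (polys V) (sr_ideal V \<Delta> :: ('x, 'k::comm_ring_1) mpoly set)"
  unfolding ideal_on_def
proof (intro conjI ballI)
  fix a b :: "('x, 'k) mpoly" assume "a \<in> sr_ideal V \<Delta>" "b \<in> sr_ideal V \<Delta>"
  then show "a + b \<in> sr_ideal V \<Delta>"
    using keys_add[of a b] by (auto simp: sr_ideal_def)
next
  fix s a :: "('x, 'k) mpoly" assume "s \<in> polys V" "a \<in> sr_ideal V \<Delta>"
  then show "s * a \<in> sr_ideal V \<Delta>"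
    using assms by (auto simp: sr_ideal_def keys_add_nat elim!: keys_mult_subset)
qed (auto simp: sr_ideal_def)

text \<open>\<open>R\<close> is the unique minimal face of \<open>F\<close> that is not a face of the complex generated by \<open>\<F>\<close>.\<close>

inductive shellable :: "'x set set \<Rightarrow> bool" where
  empty: "shellable {}"
| insert: "shellable (insert F \<F>)"
  if "shellable \<F>" "R \<subseteq> F" "\<And>x. x \<in> R \<Longrightarrow> F - {x} \<in> generated_complex \<F>" "R \<notin> generated_complex \<F>"

lemma generated_complex_down: "F \<in> generated_complex \<F> \<Longrightarrow> G \<subseteq> F \<Longrightarrow> G \<in> generated_complex \<F>"
  by (auto simp: generated_complex_def)

text \<open>Attaching \<open>F\<close> with minimal new face \<open>R\<close> gives
  \<open>0 -> K[F] -> K[\<Delta>'] -> K[\<Delta>] -> 0\<close>, the first map being multiplication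
  by the monomial of \<open>R\<close>. In terms of ideals: the colon by that monomial is the ideal
  of \<open>F\<close>, and adding it gives the ideal of the old complex.\<close>

lemma weakly_regular_shellable:
  fixes h :: "'k::field poly"
  assumes "shellable \<F>" and V: "finite V" and h: "lead_coeff h = 1" "degree h > 0" "coeff h 0 = 0"
    and "\<And>F. F \<in> \<F> \<Longrightarrow> F \<subseteq> V \<and> card F = 3"
  shows "weakly_regular (polys V) (\<lambda>i. esym V (univ_eval h) (Suc i)) 3 (sr_ideal V (generated_complex \<F>))"
  using assms(1,6)
proof (induction \<F> rule: shellable.induct)
  case empty
  have "(sr_ideal V (generated_complex {}) :: (_ \<Rightarrow>\<^sub>0 'k) set) = polys V"
    by (auto simp: sr_ideal_def generated_complex_def)
  then show ?case
    by (auto simp: weakly_regular_def polys.adjoin_base)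
next
  case (insert \<F> R F)
  let ?x = "face_monomial R :: _ \<Rightarrow>\<^sub>0 'k"
  let ?\<Delta> = "generated_complex \<F>" and ?\<Delta>' = "generated_complex (insert F \<F>)"
  let ?g = "\<lambda>i. esym V (univ_eval h) (Suc i)"
  have F: "F \<subseteq> V" "card F = 3"
    using insert.prems by auto
  have R: "finite R"
    using finite_subset[OF subset_trans[OF insert.hyps(2) F(1)] V] .
  note F = F R
  have \<Delta>': "?\<Delta>' = ?\<Delta> \<union> Pow F"
    by (auto simp: generated_complex_def)
  have new: "G \<in> ?\<Delta> \<longleftrightarrow> \<not> R \<subseteq> G" if G: "G \<subseteq> F" for G
  proof
    assume "\<not> R \<subseteq> G"
    then obtain x where "x \<in> R" "G \<subseteq> F - {x}"
      using G by blast
    then show "G \<in> ?\<Delta>"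
      using generated_complex_down[OF insert.hyps(3)] by blast
  qed (use generated_complex_down[of G \<F> R] insert.hyps(4) in blast)
  have x_mem: "?x \<in> polys V"
    using F insert.hyps by (simp add: face_monomial_eq keys_face_exponent)
  have g_mem: "?g i \<in> polys V" for i
    unfolding esym_def by (intro polys.sum_mem polys.prod_mem) auto
  have keys_x: "keys (?x * s) = (\<lambda>m. face_exponent R + m) ` keys s" for s
    by (simp add: face_monomial_eq keys_single_mult)
  \<comment> \<open>Multiplying by the monomial of \<open>R\<close> turns a support \<open>M\<close>
    into \<open>R \<union> M\<close>. As \<open>R\<close> is not an old face, this is a face of the
    new complex only if it lies in \<open>F\<close>.\<close>
  have colon: "{s \<in> polys V. ?x * s \<in> sr_ideal V ?\<Delta>'} = sr_ideal V (Pow F)"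
  proof -
    have "R \<union> M \<in> ?\<Delta>' \<longleftrightarrow> M \<subseteq> F" for M
      using insert.hyps generated_complex_down[of "R \<union> M" \<F> R] by (auto simp: \<Delta>')
    then show ?thesis
      using x_mem F by (auto simp: sr_ideal_def keys_x keys_add_nat keys_face_exponent)
  qed
  have sum: "{a + ?x * s | a s. a \<in> sr_ideal V ?\<Delta>' \<and> s \<in> polys V} = sr_ideal V ?\<Delta>" (is "?L = _")
  proof (intro subset_antisym subsetI)
    fix p assume "p \<in> ?L"
    then obtain a s where p: "p = a + ?x * s" "a \<in> sr_ideal V ?\<Delta>'" "s \<in> polys V"
      by blast
    have "a \<in> sr_ideal V ?\<Delta>"
      using p(2) by (auto simp: sr_ideal_def \<Delta>')
    moreover have "?x * s \<in> sr_ideal V ?\<Delta>"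
      using p(3) x_mem F insert.hyps generated_complex_down[of _ \<F> R]
      by (auto simp: sr_ideal_def keys_x keys_add_nat keys_face_exponent)
    ultimately show "p \<in> sr_ideal V ?\<Delta>"
      unfolding p(1) by (intro ideal_on_add[OF ideal_on_sr_ideal[OF generated_complex_down]])
  next
    fix p :: "('a, 'k) mpoly" assume p: "p \<in> sr_ideal V ?\<Delta>"
    \<comment> \<open>The terms of \<open>p\<close> supported on \<open>F\<close>. Their supports
      are nonfaces of the old complex, hence contain \<open>R\<close>, so \<open>q\<close> is a
      multiple of the monomial; the other terms already avoid the new complex.\<close>
    define q where "q = (\<Sum>m\<in>{m \<in> keys p. keys m \<subseteq> F}.
      single m (lookup p m))"
    have lq: "lookup q m = (if keys m \<subseteq> F then lookup p m else 0)" for m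
      by (auto simp: q_def lookup_sum lookup_single when_def in_keys_iff)
    have keys_q: "keys q = {m \<in> keys p. keys m \<subseteq> F}"
      by (auto simp: in_keys_iff[of _ p] in_keys_iff[of _ q] lq split: if_splits)
    have "q \<in> polys V"
      using p keys_q by (auto simp: sr_ideal_def polys_def)
    moreover have "R \<subseteq> keys m" if "m \<in> keys q" for m
      using that p new[of "keys m"] unfolding keys_q sr_ideal_def by blast
    ultimately obtain s where s: "s \<in> polys V" "q = ?x * s"
      using face_monomial_multiple[OF F(3)] by metis
    have "p - q \<in> sr_ideal V ?\<Delta>'"
      using p by (auto simp: sr_ideal_def polys_def in_keys_iff lookup_minus lq \<Delta>' split: if_splits)
    then have "(p - q) + ?x * s \<in> ?L"
      using s(1) by blast
    then show "p \<in> ?L"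
      using s(2) by simp
  qed
  show ?case
  proof (rule polys.weakly_regular_extend[where x = ?x])
    show "ideal_on (polys V) (sr_ideal V ?\<Delta>' :: (_ \<Rightarrow>\<^sub>0 'k) set)"
      by (rule ideal_on_sr_ideal[OF generated_complex_down])
    show "weakly_regular (polys V) ?g 3 {s \<in> polys V. ?x * s \<in> sr_ideal V ?\<Delta>'}"
      unfolding colon by (rule weakly_regular_simplex[OF V F(1,2) h])
    show "weakly_regular (polys V) ?g 3 {a + ?x * s | a s. a \<in> sr_ideal V ?\<Delta>' \<and> s \<in> polys V}"
      unfolding sum using insert.prems by (intro insert.IH) simp
  qed (simp_all add: x_mem g_mem)
qed

text \<open>The boundary faces \<open>F - {x}\<close> are taken from \<open>\<F>\<close> alone and
  \<open>R\<close> avoids every other facet of both families. Neither condition sees the order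
  within \<open>\<G>\<close>, so its members may be attached one by one in any order.\<close>

lemma shellable_batch:
  assumes "finite \<G>" "shellable \<F>"
    and "\<And>F. F \<in> \<G> \<Longrightarrow> \<exists>R\<subseteq>F. (\<forall>x\<in>R. F - {x} \<in> generated_complex \<F>) \<and> (\<forall>G\<in>(\<F> \<union> \<G>) - {F}. \<not> R \<subseteq> G)"
  shows "shellable (\<F> \<union> \<G>)"
proof -
  have "shellable (\<F> \<union> \<H>)" if "finite \<H>" "\<H> \<subseteq> \<G>" "\<H> \<inter> \<F> = {}" for \<H>
    using that
  proof (induction \<H> rule: finite_induct)
    case (insert F \<H>)
    then have "F \<in> \<G>"
      by simp
    from assms(3)[OF this] obtain R where R: "R \<subseteq> F" "\<forall>x\<in>R. F - {x} \<in> generated_complex \<F>"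
      "\<forall>G\<in>(\<F> \<union> \<G>) - {F}. \<not> R \<subseteq> G"
      by (elim exE conjE) (rule that)
    have "shellable (insert F (\<F> \<union> \<H>))"
    proof (rule shellable.insert[of _ R])
      show "F - {x} \<in> generated_complex (\<F> \<union> \<H>)" if "x \<in> R" for x
        using R(2) that by (auto simp: generated_complex_def)
      show "R \<notin> generated_complex (\<F> \<union> \<H>)"
        using R(3) insert by (auto simp: generated_complex_def)
    qed (use R insert in auto)
    then show ?case
      by simp
  qed (use assms(2) in simp)
  from this[of "\<G> - \<F>"] show ?thesis
    using assms(1) by auto
qed

section \<open>Hilbert's basis theorem\<close>

text \<open>That \<open>B\<close> generates \<open>I\<close> is expressed by minimality: every ideal
  containing \<open>B\<close> contains \<open>I\<close>. This avoids a separate operator for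
  generated ideals.\<close>

definition noetherian_on :: "'a::comm_ring_1 set \<Rightarrow> bool" where
  "noetherian_on S \<longleftrightarrow> (\<forall>I. ideal_on S I \<longrightarrow>
     (\<exists>B. finite B \<and> B \<subseteq> I \<and> (\<forall>J. ideal_on S J \<longrightarrow> B \<subseteq> J \<longrightarrow> I \<subseteq> J)))"

lemma noetherian_onD:
  assumes "noetherian_on S" "ideal_on S I"
  shows "\<exists>B. finite B \<and> B \<subseteq> I \<and> (\<forall>J. ideal_on S J \<longrightarrow> B \<subseteq> J \<longrightarrow> I \<subseteq> J)"
  using assms by (simp add: noetherian_on_def)

text \<open>Filtration of \<open>A[z]\<close> by degree, with \<open>d\<close> as strict bound, so
  that stage 0 is \<open>{0}\<close>. It replaces univariate polynomials over a subring that is not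
  a type.\<close>

definition pspan :: "'a::comm_ring_1 set \<Rightarrow> 'a \<Rightarrow> nat \<Rightarrow> 'a set" where
  "pspan A z d = {\<Sum>i<d. c i * z ^ i | c. \<forall>i. c i \<in> A}"

context subring_on
begin

lemma pspan_0: "pspan S z 0 = {0}"
  by (auto simp: pspan_def intro: exI[of _ "\<lambda>_. 0"])

lemma pspan_Suc: "p \<in> pspan S z (Suc d) \<longleftrightarrow> (\<exists>a\<in>S. \<exists>r\<in>pspan S z d. p = a * z ^ d + r)"
proof
  assume "\<exists>a\<in>S. \<exists>r\<in>pspan S z d. p = a * z ^ d + r"
  then obtain a c where *: "a \<in> S" "\<forall>i. c i \<in> S" "p = a * z ^ d + (\<Sum>i<d. c i * z ^ i)"
    by (auto simp: pspan_def)
  then show "p \<in> pspan S z (Suc d)"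
    unfolding pspan_def by (intro CollectI exI[of _ "c(d := a)"]) (auto simp: add.commute)
next
  assume "p \<in> pspan S z (Suc d)"
  then obtain c where "\<forall>i. c i \<in> S" "p = c d * z ^ d + (\<Sum>i<d. c i * z ^ i)"
    by (auto simp: pspan_def add.commute)
  then show "\<exists>a\<in>S. \<exists>r\<in>pspan S z d. p = a * z ^ d + r"
    unfolding pspan_def by blast
qed

lemma pspan_add: "p \<in> pspan S z d \<Longrightarrow> q \<in> pspan S z d \<Longrightarrow> p + q \<in> pspan S z d"
proof -
  assume "p \<in> pspan S z d" "q \<in> pspan S z d"
  then obtain b c where "\<forall>i. b i \<in> S" "\<forall>i. c i \<in> S" "p = (\<Sum>i<d. b i * z ^ i)" "q = (\<Sum>i<d. c i * z ^ i)"
    by (auto simp: pspan_def)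
  then show ?thesis
    unfolding pspan_def
    by (intro CollectI exI[of _ "\<lambda>i. b i + c i"]) (auto simp: sum.distrib distrib_right)
qed

lemma pspan_mult: "a \<in> S \<Longrightarrow> p \<in> pspan S z d \<Longrightarrow> a * p \<in> pspan S z d"
proof -
  assume "a \<in> S" "p \<in> pspan S z d"
  then obtain c where "\<forall>i. c i \<in> S" "p = (\<Sum>i<d. c i * z ^ i)"
    by (auto simp: pspan_def)
  then show ?thesis
    unfolding pspan_def using \<open>a \<in> S\<close>
    by (intro CollectI exI[of _ "\<lambda>i. a * c i"]) (auto simp: sum_distrib_left mult_ac)
qed

lemma pspan_zero: "0 \<in> pspan S z d"
  unfolding pspan_def by (intro CollectI exI[of _ "\<lambda>_. 0"]) simp

lemma pspan_mono: "d \<le> e \<Longrightarrow> p \<in> pspan S z d \<Longrightarrow> p \<in> pspan S z e"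
proof (induction e rule: dec_induct)
  case (step e)
  then show ?case
    unfolding pspan_Suc by (intro bexI[of _ 0] bexI[of _ p]) auto
qed

lemma pspan_shift: "p \<in> pspan S z d \<Longrightarrow> z ^ k * p \<in> pspan S z (k + d)"
proof (induction d arbitrary: p)
  case (Suc d)
  then obtain a r where "a \<in> S" "r \<in> pspan S z d" "p = a * z ^ d + r"
    by (auto simp: pspan_Suc)
  then have "a \<in> S" "z ^ k * r \<in> pspan S z (k + d)" "z ^ k * p = a * z ^ (k + d) + z ^ k * r"
    using Suc.IH by (auto simp: algebra_simps power_add)
  then show ?case
    by (auto simp: pspan_Suc)
qed (simp add: pspan_0 pspan_zero)

end

definition lead :: "'a::comm_ring_1 set \<Rightarrow> 'a \<Rightarrow> 'a set \<Rightarrow> nat \<Rightarrow> 'a set" where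
  "lead A z I d = {a \<in> A. \<exists>r\<in>pspan A z d. a * z ^ d + r \<in> I}"

lemma ideal_on_lead:
  assumes "subring_on A" and S: "subring_on S" and sub: "A \<subseteq> S" and I: "ideal_on S I"
  shows "ideal_on A (lead A z I d)"
proof -
  interpret A: subring_on A by fact
  show ?thesis
    unfolding ideal_on_def
  proof (intro conjI ballI)
    show "0 \<in> lead A z I d"
      using A.pspan_zero[of z d] ideal_on_zero[OF I] by (auto simp: lead_def)
  next
    fix a b assume "a \<in> lead A z I d" "b \<in> lead A z I d"
    then obtain r s where *: "a \<in> A" "b \<in> A" "r \<in> pspan A z d" "s \<in> pspan A z d"
      "a * z ^ d + r \<in> I" "b * z ^ d + s \<in> I"
      by (auto simp: lead_def)
    then have "(a + b) * z ^ d + (r + s) \<in> I"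
      using ideal_on_add[OF I *(5,6)] by (simp add: algebra_simps)
    then show "a + b \<in> lead A z I d"
      using * A.pspan_add by (auto simp: lead_def)
  next
    fix c a assume "c \<in> A" "a \<in> lead A z I d"
    then obtain r where *: "c \<in> A" "a \<in> A" "r \<in> pspan A z d" "a * z ^ d + r \<in> I"
      by (auto simp: lead_def)
    then have "(c * a) * z ^ d + c * r \<in> I"
      using ideal_on_mult[OF I _ *(4), of c] sub by (auto simp: algebra_simps)
    then show "c * a \<in> lead A z I d"
      using * A.pspan_mult by (auto simp: lead_def)
  qed (auto simp: lead_def)
qed

text \<open>The ideals of leading coefficients increase with the degree, and their union is finitely
  generated, hence already reached in some degree \<open>D\<close>. Elements of \<open>I\<close>
  realizing generators of these ideals in degrees up to \<open>D\<close> then generate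
  \<open>I\<close>.\<close>

theorem hilbert_basis:
  assumes "subring_on A" and "subring_on S" and sub: "A \<subseteq> S" and z: "z \<in> S"
    and A: "noetherian_on A" and span: "\<And>s. s \<in> S \<Longrightarrow> \<exists>d. s \<in> pspan A z d"
  shows "noetherian_on S"
  unfolding noetherian_on_def
proof (intro allI impI)
  interpret A: subring_on A by fact
  interpret S: subring_on S by fact
  fix I assume I: "ideal_on S I"
  let ?L = "lead A z I"
  note ideal_L = ideal_on_lead[OF assms(1,2) sub]
  have step: "?L d \<subseteq> ?L (Suc d)" for d
  proof
    fix a assume "a \<in> ?L d"
    then obtain r where *: "a \<in> A" "r \<in> pspan A z d" "a * z ^ d + r \<in> I"
      by (auto simp: lead_def)
    then have "a * z ^ Suc d + z * r \<in> I"
      using ideal_on_mult[OF I z *(3)] by (simp add: algebra_simps)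
    then show "a \<in> ?L (Suc d)"
      using * A.pspan_shift[of r z d 1] by (auto simp: lead_def)
  qed
  have mono: "?L d \<subseteq> ?L e" if "d \<le> e" for d e
    using lift_Suc_mono_le[of ?L, OF step that] .
  have "ideal_on A (\<Union>d. ?L d)"
    unfolding ideal_on_def
  proof (intro conjI ballI)
    fix a b assume "a \<in> (\<Union>d. ?L d)" "b \<in> (\<Union>d. ?L d)"
    then obtain d e where "a \<in> ?L d" "b \<in> ?L e"
      by auto
    then have "a \<in> ?L (max d e)" "b \<in> ?L (max d e)"
      using mono[of d "max d e"] mono[of e "max d e"] by auto
    then show "a + b \<in> (\<Union>d. ?L d)"
      using ideal_on_add[OF ideal_L[OF I]] by blast
  next
    show "(\<Union>d. ?L d) \<subseteq> A" "0 \<in> (\<Union>d. ?L d)"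
      using ideal_onD(1,2)[OF ideal_L[OF I]] by blast+
  next
    fix c a assume "c \<in> A" "a \<in> (\<Union>d. ?L d)"
    then show "c * a \<in> (\<Union>d. ?L d)"
      using ideal_on_mult[OF ideal_L[OF I]] by blast
  qed
  from noetherian_onD[OF A this] obtain B where B: "finite B" "B \<subseteq> (\<Union>d. ?L d)"
    "\<And>J. ideal_on A J \<Longrightarrow> B \<subseteq> J \<Longrightarrow> (\<Union>d. ?L d) \<subseteq> J"
    by (elim exE conjE) simp
  obtain D where D: "B \<subseteq> ?L D"
  proof -
    have "\<exists>D. B' \<subseteq> ?L D" if "finite B'" "B' \<subseteq> (\<Union>d. ?L d)" for B'
      using that
    proof (induction B' rule: finite_induct)
      case (insert b B')
      then obtain D e where "B' \<subseteq> ?L D" "b \<in> ?L e"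
        by auto
      then have "insert b B' \<subseteq> ?L (max D e)"
        using mono[of D "max D e"] mono[of e "max D e"] by auto
      then show ?case
        by blast
    qed simp
    from this[OF B(1,2)] show ?thesis
      using that by blast
  qed
  have stable: "?L d \<subseteq> ?L D" for d
    using B(3)[OF ideal_L[OF I] D] by blast
  have "\<forall>d. \<exists>B. finite B \<and> B \<subseteq> ?L d \<and> (\<forall>J. ideal_on A J \<longrightarrow> B \<subseteq> J \<longrightarrow> ?L d \<subseteq> J)"
    by (intro allI noetherian_onD[OF A ideal_L[OF I]])
  then obtain gens where gens: "\<And>d. finite (gens d)" "\<And>d. gens d \<subseteq> ?L d"
    "\<And>d J. ideal_on A J \<Longrightarrow> gens d \<subseteq> J \<Longrightarrow> ?L d \<subseteq> J"
    by metis
  have "\<forall>d a. a \<in> ?L d \<longrightarrow> (\<exists>r. r \<in> pspan A z d \<and> a * z ^ d + r \<in> I)"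
    by (auto simp: lead_def)
  then obtain tail where tail: "\<And>d a. a \<in> ?L d \<Longrightarrow> tail d a \<in> pspan A z d \<and> a * z ^ d + tail d a \<in> I"
    by metis
  define G where "G = (\<Union>d\<le>D. (\<lambda>a. a * z ^ d + tail d a) ` gens d)"
  have "finite G"
    using gens by (auto simp: G_def)
  moreover have "G \<subseteq> I"
    using subsetD[OF gens(2)] tail by (auto simp: G_def)
  moreover have "I \<subseteq> J" if J: "ideal_on S J" "G \<subseteq> J" for J
  proof -
    \<comment> \<open>Working in \<open>I \<inter> J\<close> keeps both memberships together: the
      chosen elements show that \<open>I \<inter> J\<close> has the same leading coefficients as
      \<open>I\<close> up to degree \<open>D\<close>, so top terms can be cancelled without leaving
      \<open>I\<close>.\<close>
    have IJ: "ideal_on S (I \<inter> J)"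
      using I J by (auto simp: ideal_on_def)
    have lead: "?L d \<subseteq> lead A z (I \<inter> J) d" if "d \<le> D" for d
    proof (rule gens(3)[OF ideal_L[OF IJ]])
      show "gens d \<subseteq> lead A z (I \<inter> J) d"
      proof
        fix a assume a: "a \<in> gens d"
        then have "a * z ^ d + tail d a \<in> G"
          using that by (auto simp: G_def)
        then show "a \<in> lead A z (I \<inter> J) d"
          using tail[of a d] gens(2)[of d] a J by (auto simp: lead_def)
      qed
    qed
    have "p \<in> J" if "p \<in> I" "p \<in> pspan A z d" for p d
      using that
    proof (induction d arbitrary: p)
      case 0
      then show ?case
        using ideal_on_zero[OF J(1)] by (simp add: A.pspan_0)
    next
      case (Suc d)
      then obtain a r where p: "a \<in> A" "r \<in> pspan A z d" "p = a * z ^ d + r"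
        by (auto simp: A.pspan_Suc)
      then have "a \<in> ?L d"
        using Suc.prems by (auto simp: lead_def)
      then have "a \<in> ?L (min d D)"
        using stable by (auto simp: min_def)
      then obtain s where s: "s \<in> pspan A z (min d D)" "a * z ^ min d D + s \<in> I \<inter> J"
        using lead[of "min d D"] by (auto simp: lead_def)
      \<comment> \<open>Beyond degree \<open>D\<close> the leading coefficients are stationary, so
        the cancelling element is found in degree \<open>min d D\<close> and shifted up by a power
        of \<open>z\<close>.\<close>
      let ?q = "z ^ (d - min d D) * (a * z ^ min d D + s)"
      have q: "?q = a * z ^ d + z ^ (d - min d D) * s"
        by (simp add: distrib_left mult.left_commute flip: power_add)
      have qIJ: "?q \<in> I \<inter> J"
        using ideal_on_mult[OF IJ _ s(2)] z by simp
      have "z ^ (d - min d D) * s \<in> pspan A z d"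
        using A.pspan_shift[OF s(1), of "d - min d D"] by simp
      then have "p - ?q \<in> pspan A z d"
        using A.pspan_add[OF p(2) A.pspan_mult[of "-1"]] unfolding q p(3) by simp
      moreover have "p - ?q \<in> I"
        using S.ideal_on_diff[OF I Suc.prems(1)] qIJ by simp
      ultimately have "p - ?q \<in> J"
        using Suc.IH by blast
      then show ?case
        using ideal_on_add[OF J(1), of "p - ?q" ?q] qIJ by simp
    qed
    then show ?thesis
      using span ideal_on_mem[OF I] by blast
  qed
  ultimately show "\<exists>B. finite B \<and> B \<subseteq> I \<and> (\<forall>J. ideal_on S J \<longrightarrow> B \<subseteq> J \<longrightarrow> I \<subseteq> J)"
    by blast
qed

lemma polys_insert_pspan:
  fixes p :: "('x, 'k::comm_ring_1) mpoly"
  assumes "p \<in> polys (insert v V)"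
  shows "\<exists>d. p \<in> pspan (polys V) (Var v) d"
proof -
  have single: "single m c \<in> pspan (polys V) (Var v) (Suc (lookup m v))"
    if "keys m \<subseteq> insert v V" for m and c :: 'k
  proof -
    let ?e = "single v (lookup m v)"
    have "(m - ?e) + ?e = m"
      by (rule poly_mapping_eqI) (auto simp: lookup_add lookup_minus lookup_single when_def)
    then have "single m c = single (m - ?e) c * Var v ^ lookup m v + 0"
      by (simp add: single_Var_power mult_single)
    moreover have "x \<in> keys m \<and> x \<noteq> v" if "x \<in> keys (m - ?e)" for x
      using that by (cases "x = v") (auto simp: in_keys_iff lookup_minus lookup_single_not_eq)
    then have "keys (m - ?e) \<subseteq> V"
      using that by blast
    ultimately show ?thesis
      unfolding polys.pspan_Suc
      by (intro bexI[of _ "single (m - ?e) c"] bexI[of _ 0])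
        (auto intro: single_mem_polys polys.pspan_zero)
  qed
  have "\<exists>d. (\<Sum>m\<in>B. single m (lookup p m)) \<in> pspan (polys V) (Var v) d"
    if "finite B" "B \<subseteq> keys p" for B
    using that
  proof (induction B rule: finite_induct)
    case empty
    then show ?case
      using polys.pspan_zero by auto
  next
    case (insert m B)
    then obtain d where d: "(\<Sum>m\<in>B. single m (lookup p m)) \<in> pspan (polys V) (Var v) d"
      by auto
    have m: "single m (lookup p m) \<in> pspan (polys V) (Var v) (Suc (lookup m v))"
      using insert.prems assms by (intro single) (auto simp: polys_def)
    let ?e = "max d (Suc (lookup m v))"
    have "(\<Sum>m\<in>insert m B. single m (lookup p m)) \<in> pspan (polys V) (Var v) ?e"
      using insert.hyps polys.pspan_add[OF polys.pspan_mono[OF max.cobounded2 m] polys.pspan_mono[OF max.cobounded1 d]]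
      by simp
    then show ?case
      by blast
  qed
  from this[of "keys p"] show ?thesis
    using poly_mapping_sum_singles[of p] by simp
qed

lemma polys_empty_Const:
  fixes p :: "('x, 'k::comm_ring_1) mpoly"
  assumes "p \<in> polys {}"
  shows "\<exists>c. p = Const c"
proof
  show "p = Const (lookup p 0)"
  proof (rule poly_mapping_eqI)
    fix m
    have "m \<in> keys p \<Longrightarrow> m = 0"
      using assms by (auto simp: polys_def)
    then show "lookup p m = lookup (Const (lookup p 0)) m"
      by (cases "m = 0") (auto simp: Const_def lookup_single when_def in_keys_iff)
  qed
qed

lemma noetherian_polys:
  assumes "finite V"
  shows "noetherian_on (polys V :: ('x, 'k::field) mpoly set)"
  using assms
proof (induction V rule: finite_induct)
  case empty
  show ?case
    unfolding noetherian_on_def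
  proof (intro allI impI)
    fix I :: "('x, 'k) mpoly set" assume I: "ideal_on (polys {}) I"
    show "\<exists>B. finite B \<and> B \<subseteq> I \<and> (\<forall>J. ideal_on (polys {}) J \<longrightarrow> B \<subseteq> J \<longrightarrow> I \<subseteq> J)"
    proof (cases "I \<subseteq> {0}")
      case True
      then show ?thesis
        by (intro exI[of _ "{}"]) (auto simp: ideal_on_def)
    next
      case False
      then obtain a where a: "a \<in> I" "a \<noteq> 0"
        by blast
      then obtain c where c: "a = Const c"
        using polys_empty_Const ideal_on_mem[OF I] by blast
      then have "Const (inverse c) * a = 1"
        using a by (cases "c = 0") (auto simp flip: Const_mult)
      then have "I \<subseteq> J" if "ideal_on (polys {}) J" "a \<in> J" for J
        using ideal_on_mult[OF that(1) _ that(2), of "Const (inverse c)"] ideal_on_mult[OF that(1), of _ 1]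
          ideal_on_mem[OF I] by auto
      then show ?thesis
        using a by (intro exI[of _ "{a}"]) auto
    qed
  qed
next
  case (insert v V)
  show ?case
    by (rule hilbert_basis[OF polys.subring_on_axioms[of V] polys.subring_on_axioms _ _ insert.IH])
       (auto intro: polys_insert_pspan simp: polys_mono subset_insertI subsetD[OF polys_mono])
qed

section \<open>Regular sequences and chains of primes\<close>

lemma (in cring) add_principal:
  assumes Q: "ideal Q R" and a: "a \<in> carrier R"
  shows "ideal (Q <+>\<^bsub>R\<^esub> PIdl a) R" and "Q \<subseteq> Q <+>\<^bsub>R\<^esub> PIdl a" and "a \<in> Q <+>\<^bsub>R\<^esub> PIdl a"
    and "x \<in> Q <+>\<^bsub>R\<^esub> PIdl a \<Longrightarrow> \<exists>r\<in>carrier R. \<exists>q\<in>Q. x = q \<oplus> r \<otimes> a"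
proof -
  interpret Q: ideal Q R by fact
  have "\<zero> \<in> PIdl a" "a \<in> PIdl a"
    using cgenideal_ideal[OF a] cgenideal_self[OF a]
    by (auto simp: additive_subgroup.zero_closed ideal.axioms(1))
  moreover have "q = q \<oplus> \<zero>" "a = \<zero> \<oplus> a" if "q \<in> Q" for q
    using Q.Icarr[OF that] a by simp_all
  ultimately show "Q \<subseteq> Q <+>\<^bsub>R\<^esub> PIdl a" "a \<in> Q <+>\<^bsub>R\<^esub> PIdl a"
    unfolding set_add_def' using Q.zero_closed by blast+
  show "ideal (Q <+>\<^bsub>R\<^esub> PIdl a) R"
    by (rule add_ideals[OF Q cgenideal_ideal[OF a]])
  show "\<exists>r\<in>carrier R. \<exists>q\<in>Q. x = q \<oplus> r \<otimes> a" if "x \<in> Q <+>\<^bsub>R\<^esub> PIdl a"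
    using that unfolding set_add_def' cgenideal_def by blast
qed

text \<open>Krull's argument: take an ideal maximal among those that contain \<open>J\<close> and
  miss \<open>M\<close>. Adding to it either of two outside elements hits \<open>M\<close>, and if
  their product lay in the ideal, so would a product of two members of \<open>M\<close>.\<close>

lemma (in cring) exists_prime_avoiding:
  assumes "ideal J R" and one: "\<one> \<in> M" and M: "M \<subseteq> carrier R"
    and mult: "\<And>a b. a \<in> M \<Longrightarrow> b \<in> M \<Longrightarrow> a \<otimes> b \<in> M" and disj: "J \<inter> M = {}"
  shows "\<exists>Q. primeideal Q R \<and> J \<subseteq> Q \<and> Q \<inter> M = {}"
proof -
  define A where "A = {I. ideal I R \<and> J \<subseteq> I \<and> I \<inter> M = {}}"
  have "J \<in> A"
    using assms by (simp add: A_def)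
  have "\<exists>I\<in>A. \<forall>I'\<in>C. I' \<subseteq> I" if C: "subset.chain A C" for C
  proof (cases "C = {}")
    case False
    have "subset.chain {I. ideal I R} C"
      using C by (auto simp: pred_on.chain_def A_def)
    from chain_Union_is_ideal[OF this] False
    have "ideal (\<Union>C) R"
      by simp
    moreover have "J \<subseteq> I'" "I' \<inter> M = {}" if "I' \<in> C" for I'
      using C that by (auto simp: pred_on.chain_def A_def)
    then have "J \<subseteq> \<Union>C" "\<Union>C \<inter> M = {}"
      using False by blast+
    ultimately show ?thesis
      by (intro bexI[of _ "\<Union>C"]) (auto simp: A_def)
  qed (use \<open>J \<in> A\<close> in blast)
  from subset_Zorn[OF this] obtain Q
    where Q: "Q \<in> A" and max: "\<And>Z. Z \<in> A \<Longrightarrow> Q \<subseteq> Z \<Longrightarrow> Z = Q"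
    by blast
  then interpret Q: ideal Q R
    by (simp add: A_def)
  have hit: "\<exists>r\<in>carrier R. \<exists>q\<in>Q. q \<oplus> r \<otimes> a \<in> M" if a: "a \<in> carrier R" "a \<notin> Q" for a
  proof -
    note sub = add_principal[OF Q.is_ideal a(1)]
    have "(Q <+>\<^bsub>R\<^esub> PIdl a) \<inter> M \<noteq> {}"
      using max[of "Q <+>\<^bsub>R\<^esub> PIdl a"] sub(1-3) a(2) Q by (auto simp: A_def)
    then show ?thesis
      using sub(4) by blast
  qed
  have "primeideal Q R"
  proof (rule primeidealI[OF Q.is_ideal is_cring])
    show "carrier R \<noteq> Q"
      using Q one by (auto simp: A_def)
    fix a b assume ab: "a \<in> carrier R" "b \<in> carrier R" "a \<otimes> b \<in> Q"
    show "a \<in> Q \<or> b \<in> Q"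
    proof (rule ccontr)
      assume "\<not> (a \<in> Q \<or> b \<in> Q)"
      then obtain r q s p where *: "r \<in> carrier R" "q \<in> Q" "q \<oplus> r \<otimes> a \<in> M"
        "s \<in> carrier R" "p \<in> Q" "p \<oplus> s \<otimes> b \<in> M"
        using hit ab by meson
      note [simp] = *(1,4) Q.Icarr[OF *(2)] Q.Icarr[OF *(5)] ab(1,2)
      have "(q \<oplus> r \<otimes> a) \<otimes> (p \<oplus> s \<otimes> b)
          = ((q \<otimes> (p \<oplus> s \<otimes> b)) \<oplus> ((r \<otimes> a) \<otimes> p)) \<oplus> (r \<otimes> s) \<otimes> (a \<otimes> b)"
        by (simp add: l_distr r_distr m_ac a_ac)
      moreover have "\<dots> \<in> Q"
      proof (intro Q.a_closed)
        show "q \<otimes> (p \<oplus> s \<otimes> b) \<in> Q"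
          using * by (intro Q.I_r_closed) auto
        show "(r \<otimes> a) \<otimes> p \<in> Q" "(r \<otimes> s) \<otimes> (a \<otimes> b) \<in> Q"
          by (rule Q.I_l_closed; simp add: * ab(3))+
      qed
      ultimately show False
        using mult[OF *(3,6)] Q by (auto simp: A_def)
    qed
  qed
  then show ?thesis
    using Q by (auto simp: A_def)
qed

text \<open>Takes the place of localizing at \<open>P\<close> and inverting \<open>x\<close>. The
  products of powers of \<open>x\<close> with elements outside \<open>P\<close> form a
  multiplicative set, which misses \<open>J\<close> because \<open>x\<close> can be cancelled modulo
  \<open>J\<close>. A prime over \<open>J\<close> avoiding this set lies inside \<open>P\<close>
  (power 0) and omits \<open>x\<close> (power 1).\<close>

lemma (in cring) prime_drop:
  assumes J: "ideal J R" and P: "primeideal P R" "J \<subseteq> P" and x: "x \<in> P"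
    and nzd: "\<And>y. y \<in> carrier R \<Longrightarrow> x \<otimes> y \<in> J \<Longrightarrow> y \<in> J"
  shows "\<exists>Q. primeideal Q R \<and> J \<subseteq> Q \<and> Q \<subset> P"
proof -
  interpret P: primeideal P R by fact
  have xc: "x \<in> carrier R"
    using x P.Icarr by blast
  define M where "M = {x [^] k \<otimes> s | (k::nat) s. s \<in> carrier R \<and> s \<notin> P}"
  have nzd_pow: "y \<in> J" if "y \<in> carrier R" "x [^] k \<otimes> y \<in> J" for y and k :: nat
    using that(2)
  proof (induction k)
    case (Suc k)
    have "x [^] Suc k \<otimes> y = x \<otimes> (x [^] k \<otimes> y)"
      using xc that(1) by (simp add: m_assoc m_comm m_lcomm)
    then show ?case
      using Suc nzd[of "x [^] k \<otimes> y"] xc that(1) by simp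
  qed (use that(1) in simp)
  have one: "\<one> \<notin> P"
    using P.one_imp_carrier P.I_notcarr by blast
  have "\<exists>Q. primeideal Q R \<and> J \<subseteq> Q \<and> Q \<inter> M = {}"
  proof (rule exists_prime_avoiding[OF J])
    show "\<one> \<in> M"
      unfolding M_def using one by (intro CollectI exI[of _ 0] exI[of _ \<one>]) simp
    show "M \<subseteq> carrier R"
      using xc by (auto simp: M_def)
    show "a \<otimes> b \<in> M" if ab: "a \<in> M" "b \<in> M" for a b
    proof -
      obtain k l :: nat and s t where *: "a = x [^] k \<otimes> s" "b = x [^] l \<otimes> t" "s \<in> carrier R" "s \<notin> P"
        "t \<in> carrier R" "t \<notin> P"
        using ab unfolding M_def by blast
      have "a \<otimes> b = x [^] (k + l) \<otimes> (s \<otimes> t)"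
        using * xc by (simp add: nat_pow_mult[symmetric] m_ac)
      moreover have "s \<otimes> t \<notin> P"
        using P.I_prime * by blast
      ultimately show ?thesis
        unfolding M_def using * by blast
    qed
    show "J \<inter> M = {}"
      using nzd_pow P(2) by (auto simp: M_def)
  qed
  then obtain Q where Q: "primeideal Q R" "J \<subseteq> Q" "Q \<inter> M = {}"
    by blast
  have "Q \<subseteq> P"
  proof
    fix s assume s: "s \<in> Q"
    then have "s \<in> carrier R"
      by (rule ideal.Icarr[OF primeideal.axioms(1)[OF Q(1)]])
    then have "s \<notin> P \<Longrightarrow> s \<in> M"
      unfolding M_def by (intro CollectI exI[of _ 0] exI[of _ s]) simp
    then show "s \<in> P"
      using Q(3) s by blast
  qed
  moreover have "x \<in> M"
    unfolding M_def using xc one by (intro CollectI exI[of _ 1] exI[of _ \<one>]) simp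
  ultimately show ?thesis
    using Q x by blast
qed

text \<open>The sequence is consumed from its last element: \<open>xs ! k\<close> is regular modulo
  its predecessors, so \<open>prime_drop\<close> yields a strictly smaller prime that still contains
  those predecessors.\<close>

lemma (in cring) regular_sequence_chain:
  assumes "regular_sequence R xs" "primeideal P R" "k \<le> length xs" "set (take k xs) \<subseteq> P"
  shows "\<exists>C :: nat \<Rightarrow> 'a set. (\<forall>i\<le>k. primeideal (C i) R) \<and> (\<forall>i<k. C i \<subset> C (Suc i)) \<and> C k = P"
  using assms(2-)
proof (induction k arbitrary: P)
  case 0
  then show ?case
    by (intro exI[of _ "\<lambda>_. P"]) simp
next
  case (Suc k)
  have xs: "set xs \<subseteq> carrier R"
    using assms(1) by (simp add: regular_sequence_def)
  then have sub: "set (take k xs) \<subseteq> carrier R"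
    using set_take_subset by fastforce
  have "set (take k xs) \<subseteq> P" "xs ! k \<in> P"
    using Suc.prems by (auto simp: take_Suc_conv_app_nth)
  then have "\<exists>Q. primeideal Q R \<and> Idl (set (take k xs)) \<subseteq> Q \<and> Q \<subset> P"
    using assms(1) Suc.prems sub genideal_minimal[OF primeideal.axioms(1)[OF Suc.prems(1)]]
    by (intro prime_drop[where x = "xs ! k"] genideal_ideal) (auto simp: regular_sequence_def)
  then obtain Q where Q: "primeideal Q R" "Idl (set (take k xs)) \<subseteq> Q" "Q \<subset> P"
    by blast
  then obtain C where C: "\<forall>i\<le>k. primeideal (C i) R" "\<forall>i<k. C i \<subset> C (Suc i)" "C k = Q"
    using Suc.IH[OF Q(1) Suc_leD[OF Suc.prems(2)] subset_trans[OF genideal_self[OF sub] Q(2)]] by blast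
  have "\<forall>i\<le>Suc k. primeideal ((C(Suc k := P)) i) R"
    using C(1) Suc.prems(1) by simp
  moreover have "\<forall>i<Suc k. (C(Suc k := P)) i \<subset> (C(Suc k := P)) (Suc i)"
    using C(2,3) Q(3) by (auto simp: less_Suc_eq)
  ultimately show ?case
    by (intro exI[of _ "C(Suc k := P)"]) simp
qed

lemma (in cring) ideal_depth_le_prime_height:
  assumes "primeideal P R"
  shows "ideal_depth R P \<le> prime_height R P"
  unfolding ideal_depth_def
proof (rule Sup_least, elim CollectE exE conjE)
  fix e xs assume "e = enat (length xs)" "set xs \<subseteq> P" "regular_sequence R xs"
  then show "e \<le> prime_height R P"
    unfolding prime_height_def
    using regular_sequence_chain[OF _ assms, of xs "length xs"]
    by (intro Sup_upper) auto
qed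

section \<open>Dimension\<close>

text \<open>Gaussian elimination, one coordinate per induction step, with \<open>e0\<close> as the
  pivot row for the coordinate \<open>j\<close>.\<close>

lemma linear_dependence:
  fixes a :: "'e \<Rightarrow> 'j \<Rightarrow> 'k::field"
  assumes "finite J" "finite E" "card J < card E"
  shows "\<exists>c. (\<exists>e\<in>E. c e \<noteq> 0) \<and> (\<forall>j\<in>J. (\<Sum>e\<in>E. c e * a e j) = 0)"
  using assms
proof (induction J arbitrary: E a rule: finite_induct)
  case empty
  then show ?case
    by (intro exI[of _ "\<lambda>_. 1"]) (auto simp: card_gt_0_iff)
next
  case (insert j J)
  show ?case
  proof (cases "\<forall>e\<in>E. a e j = 0")
    case True
    have "card J < card E"
      using insert by simp
    then obtain c where c: "\<exists>e\<in>E. c e \<noteq> 0" "\<forall>i\<in>J. (\<Sum>e\<in>E. c e * a e i) = 0"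
      using insert.IH[OF insert.prems(1), of a] by blast
    have "(\<Sum>e\<in>E. c e * a e j) = 0"
      using True by (intro sum.neutral) auto
    with c show ?thesis
      by (intro exI[of _ c]) simp
  next
    case False
    then obtain e0 where e0: "e0 \<in> E" "a e0 j \<noteq> 0"
      by blast
    let ?E = "E - {e0}"
    define a' where "a' = (\<lambda>e i. a e i - a e j / a e0 j * a e0 i)"
    have "finite ?E" "card J < card ?E"
      using insert e0 by auto
    then obtain c where c: "\<exists>e\<in>?E. c e \<noteq> 0" "\<forall>i\<in>J. (\<Sum>e\<in>?E. c e * a' e i) = 0"
      using insert.IH[of ?E a'] by blast
    \<comment> \<open>The coefficient of the pivot row is forced by the requirement that the
      coordinate \<open>j\<close> of the combination vanish.\<close>
    define s where "s = - (\<Sum>e\<in>?E. c e * (a e j / a e0 j))"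
    define c' where "c' = c(e0 := s)"
    have split: "(\<Sum>e\<in>E. c' e * a e i) = s * a e0 i + (\<Sum>e\<in>?E. c e * a e i)" for i
      using sum.remove[OF insert.prems(1) e0(1), of "\<lambda>e. c' e * a e i"] by (simp add: c'_def)
    have "(\<Sum>e\<in>E. c' e * a e i) = 0" if "i \<in> insert j J" for i
    proof (cases "i = j")
      case True
      show ?thesis
        unfolding split True s_def using e0 by (simp add: sum_distrib_right)
    next
      case False
      then have "(\<Sum>e\<in>?E. c e * a' e i) = 0"
        using c(2) that by simp
      then show ?thesis
        unfolding split s_def a'_def by (simp add: right_diff_distrib sum_subtractf sum_distrib_right mult.assoc)
    qed
    moreover have "\<exists>e\<in>E. c' e \<noteq> 0"
      using c(1) by (auto simp: c'_def)
    ultimately show ?thesis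
      by (intro exI[of _ c']) auto
  qed
qed

definition prime_on :: "'a::comm_ring_1 set \<Rightarrow> 'a set \<Rightarrow> bool" where
  "prime_on S Q \<longleftrightarrow> ideal_on S Q \<and> 1 \<notin> Q \<and> (\<forall>a\<in>S. \<forall>b\<in>S. a * b \<in> Q \<longrightarrow> a \<in> Q \<or> b \<in> Q)"

lemma (in subring_on) prime_on_power:
  assumes "prime_on S Q" "a \<in> S" "a \<notin> Q"
  shows "a ^ n \<notin> Q"
  by (induction n) (use assms in \<open>auto simp: prime_on_def\<close>)

lemma lookup_Const_mult: "lookup (Const c * p) m = c * lookup p m"
  by (simp add: Const_def flip: mult_map_scale_conv_mult) (simp add: map.rep_eq when_def)

text \<open>In a relation of minimal order in \<open>y j\<close>, that power of \<open>y j\<close> can be cancelled modulo \<open>Q j\<close>,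
  and the remaining terms divisible by \<open>y j\<close> vanish modulo \<open>Q (Suc j)\<close>.\<close>

lemma prime_chain_independent:
  fixes y :: "nat \<Rightarrow> ('x, 'k::field) mpoly"
  assumes Q: "\<And>i. i \<le> n \<Longrightarrow> prime_on (polys V) (Q i)" and mono: "\<And>i. i < n \<Longrightarrow> Q i \<subseteq> Q (Suc i)"
    and y: "\<And>i. i < n \<Longrightarrow> y i \<in> Q (Suc i) - Q i"
    and "j \<le> n" "finite E" "\<And>e e'. e \<in> E \<Longrightarrow> e' \<in> E \<Longrightarrow> (\<And>i. i \<in> {j..<n} \<Longrightarrow> e i = e' i) \<Longrightarrow> e = e'"
    and "\<And>e. e \<in> E \<Longrightarrow> c e \<noteq> 0" "(\<Sum>e\<in>E. Const (c e) * (\<Prod>i\<in>{j..<n}. y i ^ e i)) \<in> Q j"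
  shows "E = {}"
  using assms(4-)
proof (induction j arbitrary: E rule: inc_induct)
  case base
  show ?case
  proof (rule ccontr)
    assume "E \<noteq> {}"
    then obtain e where "e \<in> E"
      by blast
    \<comment> \<open>On the empty range of indices all members of \<open>E\<close> agree, so the
      relation is a single nonzero constant in a proper ideal.\<close>
    then have E: "E = {e}"
      using base(2) by auto
    have Qn: "ideal_on (polys V) (Q n)" "1 \<notin> Q n"
      using Q[of n] by (auto simp: prime_on_def)
    have "Const (inverse (c e)) * Const (c e) \<in> Q n"
      using base(4) E by (intro ideal_on_mult[OF Qn(1)]) auto
    then show False
      using Qn(2) base(3) E by (simp flip: Const_mult)
  qed
next
  case (step j)
  show ?case
  proof (rule ccontr)
    assume "E \<noteq> {}"
    define m where "m = Min ((\<lambda>e. e j) ` E)"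
    have m: "m \<le> e j" if "e \<in> E" for e
      using that step.prems(1) by (simp add: m_def)
    have "m \<in> (\<lambda>e. e j) ` E"
      unfolding m_def using \<open>E \<noteq> {}\<close> step.prems(1) by (intro Min_in) auto
    define E' where "E' = {e \<in> E. e j = m}"
    have E': "finite E'" "E' \<noteq> {}" "E' \<subseteq> E"
      using step.prems(1) \<open>m \<in> _\<close> by (auto simp: E'_def)
    have yi: "y i \<in> polys V" if "i < n" for i
      using y[OF that] Q[of "Suc i"] that by (auto simp: prime_on_def dest: ideal_on_mem)
    have Qj: "prime_on (polys V) (Q j)" "ideal_on (polys V) (Q (Suc j))"
      using Q[of j] Q[of "Suc j"] step.hyps by (auto simp: prime_on_def)
    define r where "r e = Const (c e) * (\<Prod>i\<in>{Suc j..<n}. y i ^ e i)" for e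
    have r: "r e \<in> polys V" for e
      unfolding r_def using yi by (intro polys.mult_mem polys.prod_mem polys.power_mem) auto
    have "(\<Sum>e\<in>E. Const (c e) * (\<Prod>i\<in>{j..<n}. y i ^ e i)) = y j ^ m * (\<Sum>e\<in>E. y j ^ (e j - m) * r e)"
      unfolding sum_distrib_left
    proof (intro sum.cong refl)
      fix e assume "e \<in> E"
      then have "y j ^ e j = y j ^ m * y j ^ (e j - m)"
        using m by (simp flip: power_add)
      then show "Const (c e) * (\<Prod>i\<in>{j..<n}. y i ^ e i) = y j ^ m * (y j ^ (e j - m) * r e)"
        using step.hyps by (simp add: r_def prod.atLeast_Suc_lessThan mult_ac)
    qed
    then have "y j ^ m * (\<Sum>e\<in>E. y j ^ (e j - m) * r e) \<in> Q j"
      using step.prems(4) by simp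
    moreover have "y j ^ m \<in> polys V" "(\<Sum>e\<in>E. y j ^ (e j - m) * r e) \<in> polys V"
      using yi step.hyps r by (auto intro!: polys.sum_mem polys.mult_mem polys.power_mem)
    moreover have "y j ^ m \<notin> Q j"
      using polys.prime_on_power[OF Qj(1)] yi y step.hyps by auto
    ultimately have sum: "(\<Sum>e\<in>E. y j ^ (e j - m) * r e) \<in> Q (Suc j)"
      using Qj(1) mono step.hyps unfolding prime_on_def by blast
    have rest: "(\<Sum>e\<in>E - E'. y j ^ (e j - m) * r e) \<in> Q (Suc j)"
    proof (rule polys.ideal_on_sum[OF Qj(2)])
      fix e assume e: "e \<in> E - E'"
      then have "0 < e j - m"
        using m[of e] by (auto simp: E'_def)
      then obtain t where "e j - m = Suc t"
        using gr0_implies_Suc by blast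
      then have "y j ^ (e j - m) * r e = (y j ^ t * r e) * y j"
        by (simp add: mult_ac)
      then show "y j ^ (e j - m) * r e \<in> Q (Suc j)"
        using ideal_on_mult[OF Qj(2), of "y j ^ t * r e" "y j"] yi r y step.hyps by auto
    qed
    have "(\<Sum>e\<in>E'. r e) = (\<Sum>e\<in>E'. y j ^ (e j - m) * r e)"
      by (intro sum.cong) (auto simp: E'_def)
    also have "\<dots> = (\<Sum>e\<in>E. y j ^ (e j - m) * r e) - (\<Sum>e\<in>E - E'. y j ^ (e j - m) * r e)"
      using sum_diff[OF step.prems(1) E'(3), of "\<lambda>e. y j ^ (e j - m) * r e"] by simp
    also have "\<dots> \<in> Q (Suc j)"
      by (rule polys.ideal_on_diff[OF Qj(2) sum rest])
    finally have "(\<Sum>e\<in>E'. r e) \<in> Q (Suc j)" .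
    moreover have "e = e'" if "e \<in> E'" "e' \<in> E'" "\<And>i. i \<in> {Suc j..<n} \<Longrightarrow> e i = e' i" for e e'
    proof (rule step.prems(2))
      fix i assume "i \<in> {j..<n}"
      then show "e i = e' i"
        using that by (cases "i = j") (auto simp: E'_def)
    qed (use that E' in auto)
    ultimately have "E' = {}"
      using step.IH[OF E'(1)] E'(3) step.prems(3) unfolding r_def by blast
    then show False
      using E' by simp
  qed
qed

text \<open>Each exponent is bounded separately instead of the total degree: the monomials on a face
  then form a box with an explicit cardinality, and the bounds still add under
  multiplication.\<close>

definition exponents_le :: "('x, 'k::comm_ring_1) mpoly \<Rightarrow> nat \<Rightarrow> bool" where
  "exponents_le p d \<longleftrightarrow> (\<forall>m\<in>keys p. \<forall>v. lookup m v \<le> d)"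

lemma exponents_le_mult: "exponents_le p d \<Longrightarrow> exponents_le q e \<Longrightarrow> exponents_le (p * q) (d + e)"
  unfolding exponents_le_def by (auto elim!: keys_mult_subset simp: lookup_add add_mono)

lemma exponents_le_power: "exponents_le p d \<Longrightarrow> exponents_le (p ^ n) (n * d)"
proof (induction n)
  case (Suc n)
  then show ?case
    using exponents_le_mult[of p d "p ^ n" "n * d"] by simp
qed (simp add: exponents_le_def)

lemma exponents_le_prod:
  "(\<And>i. i \<in> B \<Longrightarrow> exponents_le (f i) d) \<Longrightarrow> exponents_le (prod f B) (card B * d)"
proof (induction B rule: infinite_finite_induct)
  case (insert i B)
  then show ?case
    using exponents_le_mult[of "f i" d "prod f B" "card B * d"] by simp
qed (simp_all add: exponents_le_def)

lemma exponents_le_mono: "exponents_le p d \<Longrightarrow> d \<le> e \<Longrightarrow> exponents_le p e"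
  unfolding exponents_le_def using le_trans by blast

lemma ex_exponents_le: "\<exists>d. exponents_le p d"
proof -
  define A where "A = (\<Union>m\<in>keys p. lookup m ` keys m)"
  have "finite A"
    by (simp add: A_def)
  have "lookup m v \<le> Max (insert 0 A)" if "m \<in> keys p" for m v
  proof (cases "v \<in> keys m")
    case True
    then have "lookup m v \<in> A"
      using that by (auto simp: A_def)
    then show ?thesis
      using \<open>finite A\<close> by (intro Max_ge) auto
  qed (simp add: in_keys_iff)
  then show ?thesis
    by (auto simp: exponents_le_def)
qed

lemma card_bounded_exponents:
  assumes "finite F"
  shows "finite {m :: 'x \<Rightarrow>\<^sub>0 nat. keys m \<subseteq> F \<and> (\<forall>v. lookup m v \<le> D)} \<and>
    card {m :: 'x \<Rightarrow>\<^sub>0 nat. keys m \<subseteq> F \<and> (\<forall>v. lookup m v \<le> D)} \<le> (D + 1) ^ card F"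
    (is "finite ?M \<and> card ?M \<le> _")
proof -
  let ?f = "\<lambda>m :: 'x \<Rightarrow>\<^sub>0 nat. restrict (lookup m) F"
  let ?P = "PiE F (\<lambda>_. {..D})"
  have inj: "inj_on ?f ?M"
  proof (rule inj_onI, rule poly_mapping_eqI)
    fix m m' v assume *: "m \<in> ?M" "m' \<in> ?M" "?f m = ?f m'"
    show "lookup m v = lookup m' v"
    proof (cases "v \<in> F")
      case True
      then show ?thesis
        using fun_cong[OF *(3), of v] by simp
    next
      case False
      then have "v \<notin> keys m" "v \<notin> keys m'"
        using * by auto
      then show ?thesis
        by (simp add: in_keys_iff)
    qed
  qed
  have sub: "?f ` ?M \<subseteq> ?P"
    by auto
  have P: "finite ?P" "card ?P = (D + 1) ^ card F"
    using assms by (auto simp: finite_PiE card_PiE)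
  show ?thesis
    using inj_on_finite[OF inj sub P(1)] card_inj_on_le[OF inj sub P(1)] P(2) by simp
qed

text \<open>Modulo the ideal, polynomials of exponents at most \<open>D\<close> have dimension \<open>O(D ^ r)\<close>, so any
  \<open>r + 1\<close> elements satisfy a polynomial relation.\<close>

theorem prime_chain_length_le:
  fixes Q :: "nat \<Rightarrow> ('x, 'k::field) mpoly set"
  assumes F: "finite \<F>" "\<And>F. F \<in> \<F> \<Longrightarrow> finite F \<and> card F \<le> r"
    and Q: "\<And>i. i \<le> k \<Longrightarrow> prime_on (polys V) (Q i)" "\<And>i. i < k \<Longrightarrow> Q i \<subset> Q (Suc i)"
    and I: "sr_ideal V (generated_complex \<F>) \<subseteq> Q 0"
  shows "k \<le> r"
proof (rule ccontr)
  assume "\<not> k \<le> r"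
  define n where "n = Suc r"
  have n: "n \<le> k"
    using \<open>\<not> k \<le> r\<close> by (simp add: n_def)
  have "\<forall>i. \<exists>y. i < n \<longrightarrow> y \<in> Q (Suc i) - Q i"
    using Q(2) n by (metis Diff_iff psubset_imp_ex_mem less_le_trans)
  then obtain y where y: "\<And>i. i < n \<Longrightarrow> y i \<in> Q (Suc i) - Q i"
    by metis
  have y_mem: "y i \<in> polys V" if "i < n" for i
    using y[OF that] Q(1)[of "Suc i"] that n by (auto simp: prime_on_def dest: ideal_on_mem)
  obtain d where d: "\<And>i. i < n \<Longrightarrow> exponents_le (y i) d"
  proof -
    have "\<exists>d'. \<forall>i. exponents_le (y i) (d' i)"
      by (intro choice allI ex_exponents_le)
    then obtain d' where d': "\<And>i. exponents_le (y i) (d' i)"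
      by blast
    have "exponents_le (y i) (\<Sum>i<n. d' i)" if "i < n" for i
    proof (rule exponents_le_mono[OF d'])
      show "d' i \<le> (\<Sum>i<n. d' i)"
        using that by (intro member_le_sum) auto
    qed
    then show ?thesis
      by (rule that)
  qed
  \<comment> \<open>Exponents up to \<open>N\<close> give \<open>(N + 1) ^ (r + 1)\<close> monomials
    in the \<open>y i\<close>, each with exponents at most \<open>D\<close>. At most
    \<open>card \<F> * (D + 1) ^ r\<close> monomials survive modulo the ideal in that range, and
    \<open>D + 1 \<le> (n * d + 1) * (N + 1)\<close> bounds this by \<open>N * (N + 1) ^ r\<close>;
    the choice of \<open>N\<close> makes exactly this factor appear.\<close>
  define N where "N = card \<F> * (n * d + 1) ^ r"
  define D where "D = n * (N * d)"
  define E where "E = PiE {..<n} (\<lambda>_. {..N})"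
  have E: "finite E" "card E = (N + 1) ^ n"
    by (auto simp: E_def finite_PiE card_PiE)
  define J where "J = (\<Union>F\<in>\<F>. {m :: 'x \<Rightarrow>\<^sub>0 nat. keys m \<subseteq> F \<and> (\<forall>v. lookup m v \<le> D)})"
  have "finite J"
    using F card_bounded_exponents by (auto simp: J_def)
  have "card J \<le> (\<Sum>F\<in>\<F>. card {m :: 'x \<Rightarrow>\<^sub>0 nat. keys m \<subseteq> F \<and> (\<forall>v. lookup m v \<le> D)})"
    unfolding J_def by (rule card_UN_le[OF F(1)])
  also have "\<dots> \<le> (\<Sum>F\<in>\<F>. (D + 1) ^ r)"
  proof (rule sum_mono)
    fix F assume "F \<in> \<F>"
    then have "card {m :: 'x \<Rightarrow>\<^sub>0 nat. keys m \<subseteq> F \<and> (\<forall>v. lookup m v \<le> D)} \<le> (D + 1) ^ card F"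
      "(D + 1) ^ card F \<le> (D + 1) ^ r"
      using F(2) card_bounded_exponents[of F D] by (auto intro: power_increasing)
    then show "card {m :: 'x \<Rightarrow>\<^sub>0 nat. keys m \<subseteq> F \<and> (\<forall>v. lookup m v \<le> D)} \<le> (D + 1) ^ r"
      by (rule le_trans)
  qed
  also have "\<dots> = card \<F> * (D + 1) ^ r"
    by simp
  also have "\<dots> \<le> card \<F> * ((n * d + 1) * (N + 1)) ^ r"
    by (intro mult_left_mono power_mono) (auto simp: D_def algebra_simps)
  also have "\<dots> = N * (N + 1) ^ r"
    by (simp only: N_def power_mult_distrib mult.assoc)
  also have "\<dots> < (N + 1) ^ n"
    by (simp add: n_def)
  finally have card: "card J < card E"
    using E by simp
  define mon where "mon e = (\<Prod>i<n. y i ^ e i)" for e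
  obtain c where c: "\<exists>e\<in>E. c e \<noteq> 0" "\<forall>m\<in>J. (\<Sum>e\<in>E. c e * lookup (mon e) m) = 0"
    using linear_dependence[OF \<open>finite J\<close> E(1) card, of "\<lambda>e. lookup (mon e)"] by blast
  have mon: "mon e \<in> polys V" "exponents_le (mon e) D" if "e \<in> E" for e
  proof -
    show "mon e \<in> polys V"
      unfolding mon_def using y_mem by (intro polys.prod_mem polys.power_mem) auto
    have "exponents_le (y i ^ e i) (N * d)" if "i < n" for i
      using exponents_le_power[OF d[OF that], of "e i"] that \<open>e \<in> E\<close>
      by (rule_tac exponents_le_mono[of _ "e i * d"]) (auto simp: E_def)
    then show "exponents_le (mon e) D"
      unfolding mon_def D_def using exponents_le_prod[of "{..<n}" "\<lambda>i. y i ^ e i" "N * d"] by simp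
  qed
  \<comment> \<open>The combination whose coefficients vanish at all exponents in \<open>J\<close>.
    Whatever is left has a nonface as support, so \<open>p\<close> lies in the Stanley--Reisner
    ideal and hence in \<open>Q 0\<close>.\<close>
  define p where "p = (\<Sum>e\<in>E. Const (c e) * mon e)"
  have lookup_p: "lookup p m = (\<Sum>e\<in>E. c e * lookup (mon e) m)" for m
    by (simp add: p_def lookup_sum lookup_Const_mult)
  have "p \<in> sr_ideal V (generated_complex \<F>)"
    unfolding sr_ideal_def
  proof (intro CollectI conjI ballI notI)
    show "p \<in> polys V"
      unfolding p_def using mon by (intro polys.sum_mem polys.mult_mem) auto
    fix m assume m: "m \<in> keys p" "keys m \<in> generated_complex \<F>"
    have "lookup p m = 0"
    proof (cases "\<forall>v. lookup m v \<le> D")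
      case True
      then have "m \<in> J"
        using m(2) by (auto simp: J_def generated_complex_def)
      then show ?thesis
        using c(2) lookup_p by simp
    next
      case False
      then have "lookup (mon e) m = 0" if "e \<in> E" for e
        using mon(2)[OF that] by (auto simp: exponents_le_def in_keys_iff)
      then show ?thesis
        by (simp add: lookup_p)
    qed
    then show False
      using m(1) by (simp add: in_keys_iff)
  qed
  then have "p \<in> Q 0"
    using I by blast
  \<comment> \<open>Only nonzero coefficients are kept, since \<open>prime_chain_independent\<close>
    concludes by emptiness of the index set.\<close>
  moreover have "p = (\<Sum>e\<in>{e \<in> E. c e \<noteq> 0}. Const (c e) * mon e)"
    unfolding p_def using E(1) by (intro sum.mono_neutral_right) auto
  ultimately have *: "(\<Sum>e\<in>{e \<in> E. c e \<noteq> 0}. Const (c e) * (\<Prod>i\<in>{0..<n}. y i ^ e i)) \<in> Q 0"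
    by (simp add: mon_def atLeast0LessThan)
  have "{e \<in> E. c e \<noteq> 0} = {}"
  proof (rule prime_chain_independent[of n V Q y 0 _ c])
    show "Q i \<subseteq> Q (Suc i)" if "i < n" for i
      using Q(2)[of i] that n by auto
    show "e = e'" if "e \<in> {e \<in> E. c e \<noteq> 0}" "e' \<in> {e \<in> E. c e \<noteq> 0}" "\<And>i. i \<in> {0..<n} \<Longrightarrow> e i = e' i" for e e'
      using that by (intro PiE_ext[of e "{..<n}" _ e']) (auto simp: E_def)
  qed (use Q y n E * in auto)
  then show False
    using c(1) by blast
qed

section \<open>Zariski's lemma\<close>

text \<open>Finiteness of the quotient by \<open>P\<close> over \<open>A\<close> is stated upstairs
  as membership in \<open>P\<close> plus a span, without forming the quotient.\<close>

definition mod_span :: "'a::comm_ring_1 set \<Rightarrow> 'a set \<Rightarrow> 'a set \<Rightarrow> 'a set" where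
  "mod_span A P M = {p + (\<Sum>m\<in>M. c m * m) | p c. p \<in> P \<and> (\<forall>m. c m \<in> A)}"

text \<open>In the application \<open>P\<close> is an ideal of a ring larger than \<open>A\<close>,
  so only its \<open>A\<close>-module structure is recorded.\<close>

locale submodule_on = subring_on A for A :: "'a::comm_ring_1 set" +
  fixes P :: "'a set"
  assumes P_0: "0 \<in> P" and P_add: "a \<in> P \<Longrightarrow> b \<in> P \<Longrightarrow> a + b \<in> P"
    and P_mult: "c \<in> A \<Longrightarrow> a \<in> P \<Longrightarrow> c * a \<in> P"
begin

lemma mod_span_add: "x \<in> mod_span A P M \<Longrightarrow> y \<in> mod_span A P M \<Longrightarrow> x + y \<in> mod_span A P M"
proof -
  assume "x \<in> mod_span A P M" "y \<in> mod_span A P M"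
  then obtain p q b c where *: "p \<in> P" "q \<in> P" "\<forall>m. b m \<in> A" "\<forall>m. c m \<in> A"
    "x = p + (\<Sum>m\<in>M. b m * m)" "y = q + (\<Sum>m\<in>M. c m * m)"
    by (auto simp: mod_span_def)
  then have "x + y = (p + q) + (\<Sum>m\<in>M. (b m + c m) * m)"
    by (simp add: sum.distrib distrib_right)
  then show ?thesis
    unfolding mod_span_def using * P_add by (intro CollectI exI[of _ "p + q"] exI[of _ "\<lambda>m. b m + c m"]) auto
qed

lemma mod_span_mult: "a \<in> A \<Longrightarrow> x \<in> mod_span A P M \<Longrightarrow> a * x \<in> mod_span A P M"
proof -
  assume a: "a \<in> A" "x \<in> mod_span A P M"
  then obtain p c where *: "p \<in> P" "\<forall>m. c m \<in> A" "x = p + (\<Sum>m\<in>M. c m * m)"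
    by (auto simp: mod_span_def)
  then have "a * x = a * p + (\<Sum>m\<in>M. (a * c m) * m)"
    by (simp add: sum_distrib_left distrib_left mult.assoc)
  then show ?thesis
    unfolding mod_span_def using * P_mult a by (intro CollectI exI[of _ "a * p"] exI[of _ "\<lambda>m. a * c m"]) auto
qed

lemma mod_span_base: "p \<in> P \<Longrightarrow> p \<in> mod_span A P M"
  unfolding mod_span_def by (intro CollectI exI[of _ p] exI[of _ "\<lambda>_. 0"]) auto

lemma mod_span_gen:
  assumes "finite M" "m \<in> M"
  shows "m \<in> mod_span A P M"
proof -
  have "(\<Sum>x\<in>M. (if x = m then 1 else 0) * x) = (\<Sum>x\<in>M. if x = m then x else 0)"
    by (intro sum.cong) auto
  then have "m = 0 + (\<Sum>x\<in>M. (if x = m then 1 else 0) * x)"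
    using assms by simp
  then show ?thesis
    unfolding mod_span_def using P_0
    by (intro CollectI exI[of _ 0] exI[of _ "\<lambda>x. if x = m then 1 else 0"]) auto
qed

lemma mod_span_sum: "(\<And>i. i \<in> B \<Longrightarrow> f i \<in> mod_span A P M) \<Longrightarrow> sum f B \<in> mod_span A P M"
  by (induction B rule: infinite_finite_induct) (auto simp: mod_span_add mod_span_base P_0)

lemma mod_span_lincomb:
  assumes "finite N" "\<And>i. i \<in> B \<Longrightarrow> c i \<in> A \<and> m i \<in> N"
  shows "(\<Sum>i\<in>B. c i * m i) \<in> mod_span A P N"
  using assms by (intro mod_span_sum) (blast intro: mod_span_mult mod_span_gen)

lemma mod_span_map:
  assumes "x \<in> mod_span A P M" and "\<And>p. p \<in> P \<Longrightarrow> y * p \<in> P" and "\<And>m. m \<in> M \<Longrightarrow> y * m \<in> mod_span A P N"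
  shows "y * x \<in> mod_span A P N"
proof -
  obtain p c where *: "p \<in> P" "\<forall>m. c m \<in> A" "x = p + (\<Sum>m\<in>M. c m * m)"
    using assms(1) by (auto simp: mod_span_def)
  have "y * x = y * p + (\<Sum>m\<in>M. c m * (y * m))"
    unfolding *(3) by (simp add: sum_distrib_left distrib_left mult_ac)
  also have "\<dots> \<in> mod_span A P N"
    by (intro mod_span_add mod_span_sum) (use * assms in \<open>auto intro: mod_span_base mod_span_mult\<close>)
  finally show ?thesis .
qed

lemma mod_span_mono:
  assumes "x \<in> mod_span A P M" "M \<subseteq> N" "finite N"
  shows "x \<in> mod_span A P N"
  using mod_span_map[OF assms(1), of 1 N] mod_span_gen[OF assms(3)] assms(2) by auto

lemma mod_span_prod:
  assumes x: "x \<in> mod_span A P M" and y: "y \<in> mod_span A P N" and fin: "finite M" "finite N"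
    and Px: "\<And>p. p \<in> P \<Longrightarrow> x * p \<in> P" and PN: "\<And>p n. p \<in> P \<Longrightarrow> n \<in> N \<Longrightarrow> n * p \<in> P"
  shows "x * y \<in> mod_span A P ((\<lambda>(m, n). m * n) ` (M \<times> N))"
proof (rule mod_span_map[OF y Px])
  fix n assume n: "n \<in> N"
  have "n * x \<in> mod_span A P ((\<lambda>(m, n). m * n) ` (M \<times> N))"
  proof (rule mod_span_map[OF x PN[OF _ n]])
    fix m assume m: "m \<in> M"
    show "n * m \<in> mod_span A P ((\<lambda>(m, n). m * n) ` (M \<times> N))"
      by (rule mod_span_gen) (use fin m n in \<open>auto simp: mult.commute\<close>)
  qed
  then show "x * n \<in> mod_span A P ((\<lambda>(m, n). m * n) ` (M \<times> N))"
    by (simp add: mult.commute)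
qed

text \<open>Multiplying a combination of lower powers by \<open>w\<close> creates at most one term
  in \<open>w ^ n\<close>, and rewriting that term costs one factor \<open>f\<close>.\<close>

lemma localized_span_power:
  assumes "f \<in> A" and P: "\<And>p. p \<in> P \<Longrightarrow> w * p \<in> P"
    and rel: "f * w ^ n \<in> mod_span A P ((\<lambda>i. w ^ i) ` {..<n})"
  shows "\<exists>k. f ^ k * w ^ j \<in> mod_span A P ((\<lambda>i. w ^ i) ` {..<n})"
proof (induction j)
  case 0
  show ?case
  \<comment> \<open>For \<open>n = 0\<close> there are no lower powers: the relation puts
    \<open>f\<close> itself into the span of the empty set, so one factor \<open>f\<close>
    suffices.\<close>
  proof (cases n)
    case 0
    then show ?thesis
      using rel by (intro exI[of _ 1]) simp
  next
    case (Suc n')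
    then have "f ^ 0 * w ^ 0 \<in> mod_span A P ((\<lambda>i. w ^ i) ` {..<n})"
      by (intro mod_span_gen) force+
    then show ?thesis
      by blast
  qed
next
  case (Suc j)
  then obtain k where k: "f ^ k * w ^ j \<in> mod_span A P ((\<lambda>i. w ^ i) ` {..<n})"
    by blast
  have "(f * w) * (f ^ k * w ^ j) \<in> mod_span A P ((\<lambda>i. w ^ i) ` {..<n})"
  proof (rule mod_span_map[OF k])
    show "f * w * p \<in> P" if "p \<in> P" for p
      using P_mult[OF assms(1) P[OF that]] by (simp add: mult.assoc)
    fix m assume "m \<in> (\<lambda>i. w ^ i) ` {..<n}"
    then obtain i where i: "i < n" "m = w ^ i"
      by blast
    have "f * w ^ Suc i \<in> mod_span A P ((\<lambda>i. w ^ i) ` {..<n})"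
    proof (cases "Suc i = n")
      case False
      then show ?thesis
        using i assms(1) by (intro mod_span_mult mod_span_gen imageI) auto
    qed (use rel in simp)
    then show "f * w * m \<in> mod_span A P ((\<lambda>i. w ^ i) ` {..<n})"
      by (simp add: i mult_ac)
  qed
  then show ?case
    by (intro exI[of _ "Suc k"]) (simp add: mult_ac)
qed

end

text \<open>Serves twice in Zariski's lemma: for variables algebraically independent modulo
  \<open>P\<close>, and for module generators linearly independent modulo \<open>P\<close>.\<close>

lemma ex_maximal_subset:
  assumes "finite V" "U \<subseteq> V" "Q U"
  obtains Y where "U \<subseteq> Y" "Y \<subseteq> V" "Q Y" "\<And>w. w \<in> V - Y \<Longrightarrow> \<not> Q (insert w Y)"
proof -
  have "finite {Y. U \<subseteq> Y \<and> Y \<subseteq> V \<and> Q Y}"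
    using assms(1) by (rule_tac finite_subset[of _ "Pow V"]) auto
  moreover have "{Y. U \<subseteq> Y \<and> Y \<subseteq> V \<and> Q Y} \<noteq> {}"
    using assms by blast
  ultimately obtain Y where Y: "Y \<in> {Y. U \<subseteq> Y \<and> Y \<subseteq> V \<and> Q Y}"
    "\<forall>Z\<in>{Y. U \<subseteq> Y \<and> Y \<subseteq> V \<and> Q Y}. Y \<subseteq> Z \<longrightarrow> Y = Z"
    by (rule finite_has_maximal[THEN bexE])
  have "\<not> Q (insert w Y)" if "w \<in> V - Y" for w
  proof
    assume "Q (insert w Y)"
    then have "insert w Y \<in> {Y. U \<subseteq> Y \<and> Y \<subseteq> V \<and> Q Y}"
      using Y(1) that by auto
    then have "Y = insert w Y"
      using Y(2) by blast
    then show False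
      using that by blast
  qed
  then show ?thesis
    using that Y(1) by blast
qed

lemma keys_Var: "keys (Var v :: ('x, 'k::comm_ring_1) mpoly) = {single v 1}"
  by (simp add: Var_def)

text \<open>Put \<open>t = Var v * (f * g)\<close>. If \<open>1 + t\<close> divided
  \<open>g * f ^ k\<close>, it would divide \<open>(- t) ^ (k + 1)\<close>, and by the geometric sum
  it divides \<open>1 - (- t) ^ (k + 1)\<close>. It would then be a unit and so constant, but
  \<open>t\<close> is nonzero without constant term.\<close>

lemma one_plus_not_dvd_power:
  fixes f g a :: "('x, 'k::field) mpoly"
  assumes Y: "finite Y" "v \<in> Y" and f: "f \<in> polys Y" "f \<noteq> 0" and g: "g \<in> polys Y" "g \<noteq> 0"
    and a: "a \<in> polys Y"
  shows "(1 + Var v * (f * g)) * a \<noteq> g * f ^ k"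
proof
  define t where "t = Var v * (f * g)"
  assume "(1 + Var v * (f * g)) * a = g * f ^ k"
  then have eq: "(1 + t) * a = g * f ^ k"
    by (simp add: t_def)
  have t: "t \<in> polys Y"
    using assms by (simp add: t_def)
  \<comment> \<open>The inverse of \<open>1 + t\<close> assembled from the two
    divisibilities.\<close>
  define b where "b = (-1) ^ Suc k * Var v ^ Suc k * f * g ^ k * a + (\<Sum>i<Suc k. (- t) ^ i)"
  have b: "b \<in> polys Y"
    unfolding b_def using assms t by (intro polys.add_mem polys.mult_mem polys.sum_mem polys.power_mem polys.uminus_mem) auto
  have "(- t) ^ Suc k = (-1) ^ Suc k * Var v ^ Suc k * f * g ^ k * (g * f ^ k)"
    unfolding power_minus[of t] unfolding t_def power_mult_distrib by (simp add: mult_ac)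
  also have "\<dots> = (1 + t) * ((-1) ^ Suc k * Var v ^ Suc k * f * g ^ k * a)"
    unfolding eq[symmetric] by (simp only: mult_ac)
  finally have "(1 + t) * b = (- t) ^ Suc k + (1 - - t) * (\<Sum>i<Suc k. (- t) ^ i)"
    unfolding b_def distrib_left by simp
  then have "(1 + t) * b = 1"
    unfolding one_diff_power_eq[of "- t" "Suc k", symmetric] by simp
  then have keys: "keys (1 + t) = {0}"
    using polys_unit_const[OF Y(1), of "1 + t" b] t b by simp
  have "m \<noteq> 0" if "m \<in> keys t" for m
    using that keys_mult[of "Var v" "f * g"]
    by (auto simp: t_def Var_def lookup_add poly_mapping_eq_iff fun_eq_iff lookup_single when_def split: if_splits
        intro!: exI[of _ v])
  moreover have "m = 0" if "m \<in> keys t" for m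
  proof (rule ccontr)
    assume "m \<noteq> 0"
    then have "m \<in> keys (1 + t)"
      using that by (simp add: in_keys_iff lookup_add lookup_one)
    then show False
      using keys \<open>m \<noteq> 0\<close> by simp
  qed
  ultimately have "t = 0"
    by (metis keys_eq_empty equals0I)
  moreover have "f * g \<noteq> 0"
    using polys_no_zero_divisors[OF Y(1)] f g by blast
  moreover have "Var v \<in> polys Y" "(Var v :: ('x, 'k) mpoly) \<noteq> 0"
    using Y(2) keys_Var[of v, where 'k = 'k] by auto
  ultimately show False
    unfolding t_def using polys_no_zero_divisors[OF Y(1), of "Var v" "f * g"] f g by simp
qed

lemma polys_singleton_univ_eval:
  fixes p :: "('x, 'k::comm_ring_1) mpoly"
  assumes "p \<in> polys {v}"
  shows "\<exists>h. p = univ_eval h v"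
proof -
  obtain d c where c: "\<And>i. c i \<in> polys {}" "p = (\<Sum>i<d. c i * Var v ^ i)"
    using polys_insert_pspan[OF assms] by (auto simp: pspan_def)
  have "\<exists>b. \<forall>i. c i = Const (b i)"
    by (intro choice allI polys_empty_Const c(1))
  then obtain b where b: "\<And>i. c i = Const (b i)"
    by blast
  define h where "h = (\<Sum>i<d. monom (b i) i)"
  have coeff: "coeff h i = (if i < d then b i else 0)" for i
    by (simp add: h_def coeff_sum)
  have "univ_eval h v = (\<Sum>i\<le>degree h. Const (coeff h i) * Var v ^ i)"
    by (simp add: univ_eval_def)
  also have "\<dots> = (\<Sum>i<max d (Suc (degree h)). Const (coeff h i) * Var v ^ i)"
    by (intro sum.mono_neutral_left) (auto simp: coeff_eq_0)
  also have "\<dots> = (\<Sum>i<d. Const (coeff h i) * Var v ^ i)"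
    by (intro sum.mono_neutral_right) (auto simp: coeff)
  also have "\<dots> = p"
    unfolding c(2) b by (intro sum.cong) (auto simp: coeff)
  finally show ?thesis
    by metis
qed

text \<open>One variable of \<open>W\<close> is adjoined at a time: products of the old generators
  with powers of the new variable generate. The factor \<open>f ^ k\<close>, chosen for each
  element, plays the part of inverting \<open>f\<close>.\<close>

lemma polys_localized_finite:
  fixes P :: "('x, 'k::field) mpoly set"
  assumes V: "finite V" "Y \<subseteq> V" and P: "ideal_on (polys V) P" and f: "f \<in> polys Y"
    and rel: "\<And>w. w \<in> V - Y \<Longrightarrow> \<exists>n. f * Var w ^ n \<in> mod_span (polys Y) P ((\<lambda>i. Var w ^ i) ` {..<n})"
    and "finite W" "W \<subseteq> V - Y"
  shows "\<exists>M. finite M \<and> M \<subseteq> polys V \<and>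
    (\<forall>s\<in>polys (Y \<union> W). \<exists>k. f ^ k * s \<in> mod_span (polys Y) P M)"
  using assms(6,7)
proof (induction W rule: finite_induct)
  case empty
  interpret submodule_on "polys Y" P
    using ideal_onD[OF P] polys_mono[OF V(2)] by unfold_locales auto
  have "f ^ 0 * s \<in> mod_span (polys Y) P {1}" if "s \<in> polys Y" for s
    using mod_span_mult[OF that mod_span_gen[of "{1}" 1]] by simp
  then show ?case
    by (intro exI[of _ "{1}"] conjI ballI exI[of _ 0]) auto
next
  case (insert w W)
  interpret submodule_on "polys Y" P
    using ideal_onD[OF P] polys_mono[OF V(2)] by unfold_locales auto
  obtain M where M: "finite M" "M \<subseteq> polys V"
    "\<And>s. s \<in> polys (Y \<union> W) \<Longrightarrow> \<exists>k. f ^ k * s \<in> mod_span (polys Y) P M"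
    using insert by auto
  have w: "w \<in> V - Y" and W: "Y \<union> W \<subseteq> V"
    using insert.prems V by auto
  obtain n where n: "f * Var w ^ n \<in> mod_span (polys Y) P ((\<lambda>i. Var w ^ i) ` {..<n})"
    using rel[OF w] by blast
  let ?N = "(\<lambda>i. Var w ^ i :: ('x, 'k) mpoly) ` {..<n}"
  let ?M = "(\<lambda>(a, b). a * b) ` (M \<times> ?N)"
  have f_V: "f \<in> polys V"
    using f polys_mono[OF V(2)] by blast
  have N: "?N \<subseteq> polys V"
    using w by (auto intro: polys.power_mem)
  have summand: "\<exists>k. f ^ k * (b * Var w ^ j) \<in> mod_span (polys Y) P ?M" if b: "b \<in> polys (Y \<union> W)" for b j
  proof -
    obtain k where k: "f ^ k * b \<in> mod_span (polys Y) P M"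
      using M(3)[OF b] by blast
    have "\<exists>l. f ^ l * Var w ^ j \<in> mod_span (polys Y) P ?N"
      by (rule localized_span_power[OF f _ n]) (use ideal_on_mult[OF P] w in auto)
    then obtain l where l: "f ^ l * Var w ^ j \<in> mod_span (polys Y) P ?N" ..
    have "f ^ k * b \<in> polys V"
      using f_V b polys_mono[OF W] by auto
    then have "(f ^ k * b) * (f ^ l * Var w ^ j) \<in> mod_span (polys Y) P ?M"
      using M(1) N ideal_on_mult[OF P] by (intro mod_span_prod[OF k l]) auto
    then show ?thesis
      by (intro exI[of _ "k + l"]) (simp add: power_add mult_ac)
  qed
  have add: "\<exists>k. f ^ k * (x + y) \<in> mod_span (polys Y) P ?M"
    if "f ^ k * x \<in> mod_span (polys Y) P ?M" "f ^ l * y \<in> mod_span (polys Y) P ?M" for x y k l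
  proof -
    have "f ^ l * (f ^ k * x) + f ^ k * (f ^ l * y) \<in> mod_span (polys Y) P ?M"
      using mod_span_add[OF mod_span_mult[OF _ that(1), of "f ^ l"] mod_span_mult[OF _ that(2), of "f ^ k"]] f
      by simp
    then show ?thesis
      by (intro exI[of _ "k + l"]) (simp add: power_add algebra_simps)
  qed
  have "\<exists>k. f ^ k * s \<in> mod_span (polys Y) P ?M" if "s \<in> pspan (polys (Y \<union> W)) (Var w) d" for s d
    using that
  proof (induction d arbitrary: s)
    case 0
    then show ?case
      using mod_span_base[OF P_0] by (simp add: polys.pspan_0)
  next
    case (Suc d)
    then obtain b r where "b \<in> polys (Y \<union> W)" "r \<in> pspan (polys (Y \<union> W)) (Var w) d" "s = b * Var w ^ d + r"
      by (auto simp: polys.pspan_Suc)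
    then show ?case
      using summand[of b d] Suc.IH[of r] add by metis
  qed
  then have "\<forall>s\<in>polys (Y \<union> insert w W). \<exists>k. f ^ k * s \<in> mod_span (polys Y) P ?M"
    using polys_insert_pspan[of _ w "Y \<union> W"] unfolding Un_insert_right by blast
  moreover have "finite ?M" "?M \<subseteq> polys V"
    using M N by (auto intro!: polys.mult_mem)
  ultimately show ?case
    by blast
qed

text \<open>Let \<open>Y\<close> be a maximal set of variables containing \<open>v\<close> that is algebraically independent modulo \<open>P\<close>.
  The quotient becomes finite over \<open>K[Y]\<close> after inverting some \<open>f\<close>, hence the inverse of
  \<open>p \<in> K[Y]\<close> gives a divisibility \<open>p dvd g * f ^ k\<close> in \<open>K[Y]\<close>, which fails for
  \<open>p = 1 + x\<^sub>v f g\<close>.\<close>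

theorem zariski_lemma:
  fixes P :: "('x, 'k::field) mpoly set"
  assumes V: "finite V" and P: "ideal_on (polys V) P"
    and max: "\<And>p. p \<in> polys V \<Longrightarrow> p \<notin> P \<Longrightarrow> \<exists>s\<in>polys V. p * s - 1 \<in> P"
    and v: "v \<in> V"
  shows "\<exists>h. h \<noteq> 0 \<and> univ_eval h v \<in> P"
proof (rule ccontr)
  assume no: "\<not> (\<exists>h. h \<noteq> 0 \<and> univ_eval h v \<in> P)"
  have "P \<inter> polys {v} \<subseteq> {0}"
  proof
    fix p assume p: "p \<in> P \<inter> polys {v}"
    then obtain h where "p = univ_eval h v"
      using polys_singleton_univ_eval[of p v] by auto
    then show "p \<in> {0}"
      using no p by (cases "h = 0") (auto simp: univ_eval_def)
  qed
  then obtain Y where Y: "{v} \<subseteq> Y" "Y \<subseteq> V" "P \<inter> polys Y \<subseteq> {0}"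
    "\<And>w. w \<in> V - Y \<Longrightarrow> \<not> P \<inter> polys (insert w Y) \<subseteq> {0}"
    using ex_maximal_subset[OF V, of "{v}" "\<lambda>Y. P \<inter> polys Y \<subseteq> {0}"] v by auto
  let ?A = "polys Y :: ('x, 'k) mpoly set"
  interpret submodule_on ?A P
    using ideal_onD[OF P] polys_mono[OF Y(2)] by unfold_locales auto
  have fin: "finite Y" "finite (V - Y)"
    using V Y finite_subset by auto
  have A_V: "?A \<subseteq> polys V"
    using polys_mono[OF Y(2)] .
  have prod_A: "prod a B \<in> ?A \<and> prod a B \<noteq> 0" if "finite B" "\<And>b. b \<in> B \<Longrightarrow> a b \<in> ?A \<and> a b \<noteq> 0" for a :: "'c \<Rightarrow> _" and B
    using that
  proof (induction B rule: finite_induct)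
    case (insert b B)
    then show ?case
      using polys_no_zero_divisors[OF fin(1), of "a b" "prod a B"] by auto
  qed simp
  have "\<exists>a n. a \<in> ?A \<and> a \<noteq> 0 \<and> a * Var w ^ n \<in> mod_span ?A P ((\<lambda>i. Var w ^ i) ` {..<n})"
    if w: "w \<in> V - Y" for w
  proof -
    obtain q where q: "q \<in> P" "q \<in> polys (insert w Y)" "q \<noteq> 0"
      using Y(4)[OF w] by blast
    \<comment> \<open>The least degree bound in \<open>Var w\<close>, so that the leading
      coefficient \<open>a\<close> cannot vanish; otherwise \<open>q\<close> would already lie one
      stage lower.\<close>
    define d where "d = (LEAST d. q \<in> pspan ?A (Var w) d)"
    have d: "q \<in> pspan ?A (Var w) d"
      unfolding d_def using polys_insert_pspan[OF q(2)] by (metis LeastI)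
    have least: "q \<notin> pspan ?A (Var w) e" if "e < d" for e
      using that unfolding d_def by (rule not_less_Least)
    obtain n where n: "d = Suc n"
      using d q(3) by (cases d) (auto simp: polys.pspan_0)
    then obtain a r where ar: "a \<in> ?A" "r \<in> pspan ?A (Var w) n" "q = a * Var w ^ n + r"
      using d by (auto simp: polys.pspan_Suc)
    have "a \<noteq> 0"
      using least[of n] ar n by auto
    obtain c where "\<forall>i. c i \<in> ?A" "r = (\<Sum>i<n. c i * Var w ^ i)"
      using ar(2) by (auto simp: pspan_def)
    then have "r \<in> mod_span ?A P ((\<lambda>i. Var w ^ i) ` {..<n})"
      by (auto intro!: mod_span_lincomb)
    then have "q + (- 1) * r \<in> mod_span ?A P ((\<lambda>i. Var w ^ i) ` {..<n})"
      by (intro mod_span_add[OF mod_span_base[OF q(1)]] mod_span_mult) auto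
    then show ?thesis
      using ar \<open>a \<noteq> 0\<close> by (intro exI[of _ a] exI[of _ n]) simp
  qed
  then obtain a n where an: "\<And>w. w \<in> V - Y \<Longrightarrow> a w \<in> ?A \<and> a w \<noteq> 0 \<and>
      a w * Var w ^ n w \<in> mod_span ?A P ((\<lambda>i. Var w ^ i) ` {..<n w})"
    by metis
  \<comment> \<open>A common multiple of the leading coefficients, so that one element works for all
    variables outside \<open>Y\<close>.\<close>
  define f where "f = (\<Prod>w\<in>V - Y. a w)"
  have f: "f \<in> ?A" "f \<noteq> 0"
    unfolding f_def using an prod_A[OF fin(2), of a] by auto
  have rel: "\<exists>n. f * Var w ^ n \<in> mod_span ?A P ((\<lambda>i. Var w ^ i) ` {..<n})" if w: "w \<in> V - Y" for w
  proof -
    have "f = (\<Prod>w\<in>V - Y - {w}. a w) * a w"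
      unfolding f_def using prod.remove[OF fin(2) w, of a] by (simp add: mult.commute)
    then have "f * Var w ^ n w = (\<Prod>w\<in>V - Y - {w}. a w) * (a w * Var w ^ n w)"
      by (simp add: mult.assoc)
    moreover have "(\<Prod>w\<in>V - Y - {w}. a w) \<in> ?A"
      using an by (intro polys.prod_mem) auto
    ultimately show ?thesis
      using mod_span_mult an[OF w] by (intro exI[of _ "n w"]) simp
  qed
  have "Y \<union> (V - Y) = V"
    using Y(2) by blast
  then obtain M' where M': "finite M'" "M' \<subseteq> polys V" "\<And>s. s \<in> polys V \<Longrightarrow> \<exists>k. f ^ k * s \<in> mod_span ?A P M'"
    using polys_localized_finite[OF V Y(2) P f(1) rel fin(2) subset_refl] by auto
  \<comment> \<open>The element 1 is included so that it can belong to the independent family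
    \<open>N\<close>, where its coefficient is compared at the end.\<close>
  define M where "M = insert 1 M'"
  have M: "finite M" "\<And>s. s \<in> polys V \<Longrightarrow> \<exists>k. f ^ k * s \<in> mod_span ?A P M"
    unfolding M_def using M' mod_span_mono[of _ M' "insert 1 M'"] by (auto, meson subset_insertI)
  \<comment> \<open>Linear independence over \<open>K[Y]\<close> modulo \<open>P\<close>. The set
    \<open>{1}\<close> qualifies because \<open>P\<close> meets \<open>K[Y]\<close> only in
    0.\<close>
  define indep where "indep N \<longleftrightarrow> (\<forall>c. (\<forall>m. c m \<in> ?A) \<longrightarrow> (\<Sum>m\<in>N. c m * m) \<in> P \<longrightarrow> (\<forall>m\<in>N. c m = 0))"
    for N :: "('x, 'k) mpoly set"
  have "indep {1}"
    using Y(3) by (auto simp: indep_def)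
  then obtain N where N: "{1} \<subseteq> N" "N \<subseteq> M" "indep N" "\<And>m. m \<in> M - N \<Longrightarrow> \<not> indep (insert m N)"
    using ex_maximal_subset[OF M(1), of "{1}" indep] by (auto simp: M_def)
  have finN: "finite N"
    using N(2) M(1) finite_subset by blast
  have "\<exists>b. b \<in> ?A \<and> b \<noteq> 0 \<and> b * m \<in> mod_span ?A P N" if m: "m \<in> M - N" for m
  proof -
    obtain c where c: "\<forall>x. c x \<in> ?A" "(\<Sum>x\<in>insert m N. c x * x) \<in> P" "\<exists>x\<in>insert m N. c x \<noteq> 0"
      using N(4)[OF m] by (auto simp: indep_def)
    then have sum: "c m * m + (\<Sum>x\<in>N. c x * x) \<in> P"
      using m finN by simp
    have "c m \<noteq> 0"
    proof
      assume "c m = 0"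
      then have "\<forall>x\<in>N. c x = 0"
        using N(3) sum c(1) by (auto simp: indep_def)
      then show False
        using c(3) \<open>c m = 0\<close> by auto
    qed
    moreover have "(c m * m + (\<Sum>x\<in>N. c x * x)) + (- 1) * (\<Sum>x\<in>N. c x * x) \<in> mod_span ?A P N"
      using c(1) finN by (intro mod_span_add[OF mod_span_base[OF sum]] mod_span_mult[of "- 1"] mod_span_lincomb) auto
    ultimately show ?thesis
      using c(1) by (intro exI[of _ "c m"]) simp
  qed
  then obtain b where b: "\<And>m. m \<in> M - N \<Longrightarrow> b m \<in> ?A \<and> b m \<noteq> 0 \<and> b m * m \<in> mod_span ?A P N"
    by metis
  \<comment> \<open>Clears denominators: by maximality of \<open>N\<close> each other generator has
    a nonzero multiple in the span of \<open>N\<close>, and \<open>g\<close> achieves this for all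
    of them.\<close>
  define g where "g = (\<Prod>m\<in>M - N. b m)"
  have g: "g \<in> ?A" "g \<noteq> 0"
    unfolding g_def using b prod_A[of "M - N" b] M(1) by auto
  have gm: "g * m \<in> mod_span ?A P N" if m: "m \<in> M" for m
  proof (cases "m \<in> N")
    case True
    then show ?thesis
      using g finN by (intro mod_span_mult mod_span_gen)
  next
    case False
    then have m: "m \<in> M - N"
      using m by blast
    have "g = (\<Prod>m\<in>M - N - {m}. b m) * b m"
      unfolding g_def using prod.remove[OF _ m, of b] M(1) by (simp add: mult.commute)
    then have "g * m = (\<Prod>m\<in>M - N - {m}. b m) * (b m * m)"
      by (simp add: mult.assoc)
    moreover have "(\<Prod>m\<in>M - N - {m}. b m) \<in> ?A"
      using b by (intro polys.prod_mem) auto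
    ultimately show ?thesis
      using mod_span_mult b[OF m] by simp
  qed
  define p where "p = 1 + Var v * (f * g)"
  have p: "p \<in> ?A"
    unfolding p_def using f g Y(1) by auto
  have "p \<noteq> 0"
  proof
    assume "p = 0"
    then have "Var v * (- (f * g)) = 1"
      by (simp add: p_def add_eq_0_iff2)
    then have "keys (Var v :: ('x, 'k) mpoly) = {0}"
      using polys_unit_const[OF fin(1), of "Var v" "- (f * g)"] f g Y(1) by auto
    then show False
      using single_zero by (simp add: keys_Var poly_mapping_eq_iff fun_eq_iff lookup_single when_def split: if_splits)
  qed
  then have "p \<notin> P"
    using Y(3) p by blast
  then obtain s where s: "s \<in> polys V" "p * s - 1 \<in> P"
    using max p A_V by blast
  obtain k where k: "f ^ k * s \<in> mod_span ?A P M"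
    using M(2)[OF s(1)] by blast
  have "g * (f ^ k * s) \<in> mod_span ?A P N"
    using g gm P_mult by (intro mod_span_map[OF k]) auto
  then obtain r c where rc: "r \<in> P" "\<forall>m. c m \<in> ?A" "g * (f ^ k * s) = r + (\<Sum>m\<in>N. c m * m)"
    by (auto simp: mod_span_def)
  \<comment> \<open>Multiplying the expansion of \<open>g * (f ^ k * s)\<close> by \<open>p\<close>
    and using that \<open>p * s\<close> is 1 modulo \<open>P\<close> gives a relation among the
    members of \<open>N\<close>. Its coefficient at 1 is \<open>p * c 1 - g * f ^ k\<close>, which
    independence forces to be 0.\<close>
  define c' where "c' m = p * c m - (if m = 1 then g * f ^ k else 0)" for m
  have c': "\<forall>m. c' m \<in> ?A"
    using rc(2) p f g by (auto simp: c'_def)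
  have "(\<Sum>m\<in>N. c' m * m) = p * (\<Sum>m\<in>N. c m * m) - g * f ^ k"
  proof -
    have "(\<Sum>m\<in>N. (if m = 1 then g * f ^ k else 0) * m) = (\<Sum>m\<in>N. if m = 1 then g * f ^ k else 0)"
      by (intro sum.cong) auto
    then show ?thesis
      using N(1) finN by (simp add: c'_def sum_subtractf left_diff_distrib sum_distrib_left mult.assoc)
  qed
  also have "\<dots> = (g * f ^ k) * (p * s - 1) + (- p) * r"
  proof -
    have "(\<Sum>m\<in>N. c m * m) = g * (f ^ k * s) - r"
      by (simp add: rc(3))
    then show ?thesis
      unfolding \<open>_ = _ - r\<close> by (simp add: algebra_simps)
  qed
  also have "\<dots> \<in> P"
    using s rc p f g by (intro P_add P_mult) auto
  finally have "c' 1 = 0"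
    using N(1,3) c' by (auto simp: indep_def)
  then have "p * c 1 = g * f ^ k"
    by (simp add: c'_def)
  then show False
    using one_plus_not_dvd_power[OF fin(1) _ f g, of v "c 1" k] rc(2) Y(1) by (auto simp: p_def)
qed

section \<open>Shellable complexes are Cohen--Macaulay\<close>

lemma carrier_poly_ring_on [simp]: "carrier (poly_ring_on V) = polys V"
  and mult_poly_ring_on [simp]: "x \<otimes>\<^bsub>poly_ring_on V\<^esub> y = x * y"
  and add_poly_ring_on [simp]: "x \<oplus>\<^bsub>poly_ring_on V\<^esub> y = x + y"
  and one_poly_ring_on [simp]: "\<one>\<^bsub>poly_ring_on V\<^esub> = 1"
  and zero_poly_ring_on [simp]: "\<zero>\<^bsub>poly_ring_on V\<^esub> = 0"
  by (simp_all add: poly_ring_on_def polys_def)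

lemma cring_poly_ring_on: "cring (poly_ring_on V :: ('x, 'k::comm_ring_1) mpoly ring)"
proof (intro cringI abelian_groupI comm_monoidI)
  fix x :: "('x, 'k) mpoly" assume "x \<in> carrier (poly_ring_on V)"
  then show "\<exists>y\<in>carrier (poly_ring_on V). y \<oplus>\<^bsub>poly_ring_on V\<^esub> x = \<zero>\<^bsub>poly_ring_on V\<^esub>"
    by (intro bexI[of _ "- x"]) auto
qed (auto simp: algebra_simps)

lemma a_inv_poly_ring_on: "x \<in> polys V \<Longrightarrow> \<ominus>\<^bsub>poly_ring_on V\<^esub> x = - x"
  for x :: "('x, 'k::comm_ring_1) mpoly"
proof -
  interpret cring "poly_ring_on V :: ('x, 'k) mpoly ring"
    by (rule cring_poly_ring_on)
  show "x \<in> polys V \<Longrightarrow> ?thesis"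
    by (rule minus_equality) auto
qed

lemma ideal_poly_ring_on:
  "ideal I (poly_ring_on V) \<longleftrightarrow> ideal_on (polys V) I"
  for I :: "('x, 'k::comm_ring_1) mpoly set"
proof
  interpret cring "poly_ring_on V :: ('x, 'k) mpoly ring"
    by (rule cring_poly_ring_on)
  show "ideal_on (polys V) I" if "ideal I (poly_ring_on V)"
  proof -
    interpret I: ideal I "poly_ring_on V"
      by (fact that)
    show ?thesis
      using I.a_subset I.zero_closed I.a_closed I.I_l_closed by (auto simp: ideal_on_def)
  qed
  assume I: "ideal_on (polys V) I"
  show "ideal I (poly_ring_on V)"
  proof (rule idealI[OF ring_axioms])
    show "subgroup I (add_monoid (poly_ring_on V))"
    proof (rule add.subgroupI)
      fix a assume "a \<in> I"
      then show "\<ominus>\<^bsub>poly_ring_on V\<^esub> a \<in> I"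
        using ideal_on_mem[OF I] polys.ideal_on_uminus[OF I] by (simp add: a_inv_poly_ring_on)
    qed (use ideal_onD[OF I] in auto)
  qed (use ideal_onD[OF I] in auto)
qed

text \<open>A monomial whose support is a nonface is a multiple of the squarefree monomial on that
  support, which is one of the generators.\<close>

lemma stanley_reisner_ideal_eq:
  assumes V: "finite V" and down: "\<And>F G. F \<in> \<Delta> \<Longrightarrow> G \<subseteq> F \<Longrightarrow> G \<in> \<Delta>"
  shows "stanley_reisner_ideal V \<Delta> = (sr_ideal V \<Delta> :: ('x, 'k::comm_ring_1) mpoly set)"
proof -
  interpret cring "poly_ring_on V :: ('x, 'k) mpoly ring"
    by (rule cring_poly_ring_on)
  let ?G = "{face_monomial F | F. F \<subseteq> V \<and> F \<notin> \<Delta>} :: ('x, 'k) mpoly set"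
  have fin: "finite F" if "F \<subseteq> V" for F
    using that V finite_subset by blast
  have sr: "ideal (sr_ideal V \<Delta>) (poly_ring_on V :: ('x, 'k) mpoly ring)"
    unfolding ideal_poly_ring_on using ideal_on_sr_ideal down by blast
  have G: "?G \<subseteq> polys V"
    using fin by (auto simp: face_monomial_eq keys_face_exponent)
  then have J: "ideal_on (polys V) (Idl\<^bsub>poly_ring_on V\<^esub> ?G)"
    using genideal_ideal[of ?G] by (simp add: ideal_poly_ring_on)
  have gen: "?G \<subseteq> Idl\<^bsub>poly_ring_on V\<^esub> ?G"
    using genideal_self[of ?G] G by simp
  have "?G \<subseteq> sr_ideal V \<Delta>"
    using fin by (auto simp: sr_ideal_def face_monomial_eq keys_face_exponent)
  then have "Idl\<^bsub>poly_ring_on V\<^esub> ?G \<subseteq> sr_ideal V \<Delta>"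
    by (rule genideal_minimal[OF sr])
  moreover have "p \<in> Idl\<^bsub>poly_ring_on V\<^esub> ?G" if p: "p \<in> sr_ideal V \<Delta>" for p
  proof -
    have "single m (lookup p m) \<in> Idl\<^bsub>poly_ring_on V\<^esub> ?G"
      if m: "m \<in> keys p" for m
    proof -
      have *: "keys m \<subseteq> V" "keys m \<notin> \<Delta>"
        using p m by (auto simp: sr_ideal_def polys_def)
      have "\<exists>q\<in>polys V. single m (lookup p m) = face_monomial (keys m) * q"
        using * by (intro face_monomial_multiple) (auto split: if_splits)
      moreover have "face_monomial (keys m) \<in> Idl\<^bsub>poly_ring_on V\<^esub> ?G"
        using gen * by blast
      ultimately show ?thesis
        using ideal_on_mult2[OF J] by auto
    qed
    then show ?thesis
      by (subst poly_mapping_sum_singles) (rule polys.ideal_on_sum[OF J])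
  qed
  ultimately show ?thesis
    unfolding stanley_reisner_ideal_def by blast
qed

section \<open>A common univariate polynomial for all variables\<close>

lemma univ_eval_bound:
  assumes "degree h < n"
  shows "univ_eval h v = (\<Sum>i<n. Const (coeff h i) * Var v ^ i)"
  unfolding univ_eval_def using assms by (intro sum.mono_neutral_left) (auto simp: coeff_eq_0)

lemma univ_eval_add: "univ_eval (p + q) v = univ_eval p v + univ_eval q v"
proof -
  let ?n = "Suc (max (degree p) (degree q))"
  have "degree (p + q) < ?n"
    by (rule le_imp_less_Suc[OF degree_add_le_max])
  then show ?thesis
    using univ_eval_bound[of p ?n v] univ_eval_bound[of q ?n v]
    by (simp only: univ_eval_bound[of "p + q" ?n v]) (simp add: Const_add distrib_right sum.distrib)
qed

lemma univ_eval_smult: "univ_eval (Polynomial.smult a p) v = Const a * univ_eval p v"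
proof -
  have "degree (Polynomial.smult a p) < Suc (degree p)"
    using degree_smult_le[of a p] by simp
  then show ?thesis
    using univ_eval_bound[of p "Suc (degree p)" v]
    by (simp only: univ_eval_bound[of _ "Suc (degree p)" v])
       (simp add: Const_mult sum_distrib_left distrib_left mult.assoc)
qed

lemma univ_eval_pCons_0: "univ_eval (pCons 0 p) v = Var v * univ_eval p v"
proof -
  have "degree (pCons 0 p) < Suc (Suc (degree p))"
    using degree_pCons_le[of 0 p] by simp
  then have "univ_eval (pCons 0 p) v = (\<Sum>i<Suc (Suc (degree p)). Const (coeff (pCons 0 p) i) * Var v ^ i)"
    by (rule univ_eval_bound)
  also have "\<dots> = (\<Sum>i<Suc (degree p). Const (coeff p i) * Var v ^ Suc i)"
    by (subst sum.lessThan_Suc_shift) simp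
  also have "\<dots> = Var v * univ_eval p v"
    by (simp only: univ_eval_bound[OF lessI] sum_distrib_left) (simp add: mult_ac)
  finally show ?thesis .
qed

lemma univ_eval_mult: "univ_eval (p * q) v = univ_eval p v * univ_eval q v"
proof (induction p)
  case 0
  then show ?case
    by (simp add: univ_eval_def)
next
  case (pCons a p)
  have "pCons a p = [:a:] + pCons 0 p"
    by simp
  moreover have "univ_eval [:a:] v = Const a"
    by (simp add: univ_eval_def)
  ultimately have "univ_eval (pCons a p) v = Const a + Var v * univ_eval p v"
    by (metis univ_eval_add univ_eval_pCons_0)
  moreover have "univ_eval (pCons a p * q) v = Const a * univ_eval q v + Var v * univ_eval (p * q) v"
    by (simp add: univ_eval_add univ_eval_smult univ_eval_pCons_0)
  ultimately show ?case
    by (simp add: pCons.IH algebra_simps)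
qed

text \<open>The factor \<open>t\<close> in \<open>h\<close> makes \<open>h(x\<^sub>v)\<close> vanish on every face that does not contain \<open>v\<close>.\<close>

lemma ex_common_univ_eval:
  fixes P :: "('x, 'k::field) mpoly set"
  assumes V: "finite V" and P: "ideal_on (polys V) P"
    and alg: "\<And>v. v \<in> V \<Longrightarrow> \<exists>h. h \<noteq> 0 \<and> univ_eval h v \<in> P"
  shows "\<exists>h. lead_coeff h = 1 \<and> degree h > 0 \<and> coeff h 0 = 0 \<and> (\<forall>v\<in>V. univ_eval h v \<in> P)"
proof -
  obtain f where f: "\<And>v. v \<in> V \<Longrightarrow> f v \<noteq> 0 \<and> univ_eval (f v) v \<in> P"
    using alg by metis
  \<comment> \<open>The product is a multiple of every \<open>f v\<close>, so its value at each
    variable lies in \<open>P\<close>; it is then made monic and multiplied by the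
    indeterminate.\<close>
  define q where "q = (\<Prod>v\<in>V. f v)"
  define h where "h = pCons 0 (Polynomial.smult (inverse (lead_coeff q)) q)"
  have q: "q \<noteq> 0"
    unfolding q_def using f V by simp
  then have "lead_coeff h = 1" "degree h > 0" "coeff h 0 = 0"
    by (auto simp: h_def)
  moreover have "univ_eval h v \<in> P" if v: "v \<in> V" for v
  proof -
    have "q = f v * (\<Prod>v\<in>V - {v}. f v)"
      unfolding q_def by (rule prod.remove[OF V v])
    then have "univ_eval q v = univ_eval (f v) v * univ_eval (\<Prod>v\<in>V - {v}. f v) v"
      by (simp add: univ_eval_mult)
    then have "univ_eval q v \<in> P"
      using ideal_on_mult2[OF P] f v by simp
    then show ?thesis
      unfolding h_def univ_eval_pCons_0 univ_eval_smult using v by (intro ideal_on_mult[OF P]) auto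
  qed
  ultimately show ?thesis
    by blast
qed

section \<open>Transfer between the polynomial ring and its quotients\<close>

locale poly_quotient =
  fixes V :: "'x set" and I :: "('x, 'k::field) mpoly set"
  assumes V: "finite V" and I: "ideal_on (polys V) I"
begin

abbreviation "R \<equiv> poly_ring_on V Quot I"

definition proj :: "('x, 'k) mpoly \<Rightarrow> ('x, 'k) mpoly set" where
  "proj s = I +>\<^bsub>poly_ring_on V\<^esub> s"

lemma I_ideal: "ideal I (poly_ring_on V)"
  using I by (simp add: ideal_poly_ring_on)

sublocale R: cring R
  by (rule ideal.quotient_is_cring[OF I_ideal cring_poly_ring_on])

lemma proj_hom: "proj \<in> ring_hom (poly_ring_on V) R"
  using ideal.rcos_ring_hom[OF I_ideal] by (simp add: proj_def[abs_def])

lemma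
  assumes "s \<in> polys V"
  shows proj_mem [simp]: "proj s \<in> carrier R"
    and proj_add: "t \<in> polys V \<Longrightarrow> proj (s + t) = proj s \<oplus>\<^bsub>R\<^esub> proj t"
    and proj_mult: "t \<in> polys V \<Longrightarrow> proj (s * t) = proj s \<otimes>\<^bsub>R\<^esub> proj t"
  using ring_hom_closed[OF proj_hom, of s] ring_hom_add[OF proj_hom, of s t]
    ring_hom_mult[OF proj_hom, of s t] assms by simp_all

lemma proj_1: "proj 1 = \<one>\<^bsub>R\<^esub>"
  using ring_hom_one[OF proj_hom] by simp

lemma proj_0: "proj 0 = \<zero>\<^bsub>R\<^esub>"
proof -
  have "proj (0 + 0) = proj 0 \<oplus>\<^bsub>R\<^esub> proj 0"
    by (rule proj_add) auto
  then show ?thesis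
    by simp
qed

lemma proj_surj: "x \<in> carrier R \<Longrightarrow> \<exists>s\<in>polys V. x = proj s"
  by (auto simp: FactRing_def A_RCOSETS_def' proj_def)

lemma proj_eq_iff:
  assumes "s \<in> polys V" "t \<in> polys V"
  shows "proj s = proj t \<longleftrightarrow> s - t \<in> I"
proof -
  interpret S: cring "poly_ring_on V :: ('x, 'k) mpoly ring"
    by (rule cring_poly_ring_on)
  show ?thesis
    using S.quotient_eq_iff_same_a_r_cos[OF I_ideal, of s t] assms
    by (simp add: proj_def a_minus_def a_inv_poly_ring_on)
qed

text \<open>Contraction of ideals along the quotient map. Since the map is surjective, no
  information about an ideal of \<open>R\<close> is lost.\<close>

definition pull :: "('x, 'k) mpoly set set \<Rightarrow> ('x, 'k) mpoly set" where
  "pull J = {s \<in> polys V. proj s \<in> J}"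

lemma ideal_on_pull:
  assumes "ideal J R"
  shows "ideal_on (polys V) (pull J)" "I \<subseteq> pull J"
proof -
  interpret J: ideal J R by fact
  show "ideal_on (polys V) (pull J)"
    using J.zero_closed J.a_closed J.I_l_closed
    by (auto simp: ideal_on_def pull_def proj_0 proj_add proj_mult)
  have "proj s = \<zero>\<^bsub>R\<^esub>" if "s \<in> I" for s
    using proj_eq_iff[of s 0] ideal_on_mem[OF I that] that by (simp add: proj_0)
  then show "I \<subseteq> pull J"
    using J.zero_closed ideal_on_mem[OF I] by (auto simp: pull_def)
qed

lemma prime_on_pull:
  assumes "primeideal J R"
  shows "prime_on (polys V) (pull J)"
proof -
  interpret J: primeideal J R by fact
  have "1 \<notin> pull J"
    using J.one_imp_carrier J.I_notcarr by (auto simp: pull_def proj_1)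
  then show ?thesis
    using ideal_on_pull(1)[OF J.is_ideal] J.I_prime by (auto simp: prime_on_def pull_def proj_mult)
qed

lemma pull_mono:
  assumes "ideal J R" "ideal K R"
  shows "pull J \<subseteq> pull K \<longleftrightarrow> J \<subseteq> K"
proof
  assume "pull J \<subseteq> pull K"
  then show "J \<subseteq> K"
    using proj_surj ideal.Icarr[OF assms(1)] unfolding pull_def by blast
qed (auto simp: pull_def)

lemma proj_ideal:
  assumes T: "ideal_on (polys V) T"
  shows "ideal (proj ` T) R"
proof (rule idealI[OF R.ring_axioms])
  have T': "T \<subseteq> polys V"
    using ideal_on_mem[OF T] by blast
  show "subgroup (proj ` T) (add_monoid R)"
  proof (rule R.add.subgroupI)
    fix a assume "a \<in> proj ` T"
    then obtain t where t: "t \<in> T" "a = proj t"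
      by blast
    then have "proj (- t) \<oplus>\<^bsub>R\<^esub> proj t = \<zero>\<^bsub>R\<^esub>"
      using T' proj_add[of "- t" t] by (auto simp: proj_0)
    then have "\<ominus>\<^bsub>R\<^esub> a = proj (- t)"
      using t T' by (intro R.minus_equality) auto
    then show "\<ominus>\<^bsub>R\<^esub> a \<in> proj ` T"
      using polys.ideal_on_uminus[OF T] t by blast
  next
    fix a b assume "a \<in> proj ` T" "b \<in> proj ` T"
    then obtain s t where *: "s \<in> T" "t \<in> T" "a = proj s" "b = proj t"
      by blast
    then have "a \<oplus>\<^bsub>R\<^esub> b = proj (s + t)"
      using T' proj_add[of s t] by auto
    then show "a \<oplus>\<^bsub>R\<^esub> b \<in> proj ` T"
      using ideal_on_add[OF T *(1,2)] by simp
  qed (use T' ideal_on_zero[OF T] in auto)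
  fix a x assume "a \<in> proj ` T" "x \<in> carrier R"
  then obtain s t where *: "s \<in> T" "t \<in> polys V" "a = proj s" "x = proj t"
    using proj_surj by blast
  then have "x \<otimes>\<^bsub>R\<^esub> a = proj (t * s)" "a \<otimes>\<^bsub>R\<^esub> x = proj (s * t)"
    using T' proj_mult[of s t] proj_mult[of t s] by auto
  then show "x \<otimes>\<^bsub>R\<^esub> a \<in> proj ` T" "a \<otimes>\<^bsub>R\<^esub> x \<in> proj ` T"
    using ideal_on_mult[OF T *(2,1)] ideal_on_mult2[OF T *(2,1)] by simp_all
qed

lemma noetherian: "noetherian_ring R"
proof (rule R.noetherian_ringI)
  fix J assume J: "ideal J R"
  obtain B where B: "finite B" "B \<subseteq> pull J" "\<And>K. ideal_on (polys V) K \<Longrightarrow> B \<subseteq> K \<Longrightarrow> pull J \<subseteq> K"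
    using noetherian_onD[OF noetherian_polys[OF V] ideal_on_pull(1)[OF J]] by (elim exE conjE) simp
  have sub: "proj ` B \<subseteq> carrier R" "proj ` B \<subseteq> J"
    using B(2) by (auto simp: pull_def)
  note K = R.genideal_ideal[OF sub(1)]
  have "B \<subseteq> pull (Idl\<^bsub>R\<^esub> (proj ` B))"
    using R.genideal_self[OF sub(1)] B(2) by (auto simp: pull_def)
  then have "J \<subseteq> Idl\<^bsub>R\<^esub> (proj ` B)"
    using B(3) ideal_on_pull(1)[OF K] pull_mono[OF J K] by blast
  moreover have "Idl\<^bsub>R\<^esub> (proj ` B) \<subseteq> J"
    by (rule R.genideal_minimal[OF J sub(2)])
  ultimately show "\<exists>A\<subseteq>carrier R. finite A \<and> J = Idl\<^bsub>R\<^esub> A"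
    using sub(1) B(1) by blast
qed

text \<open>Inverses in the residue field, lifted to polynomials; this is the form of maximality
  that \<open>zariski_lemma\<close> consumes.\<close>

lemma pull_maximal:
  assumes "maximalideal P R" "p \<in> polys V" "p \<notin> pull P"
  shows "\<exists>s\<in>polys V. p * s - 1 \<in> pull P"
proof -
  interpret P: maximalideal P R by fact
  note add = R.add_principal[OF P.is_ideal proj_mem[OF assms(2)]]
  have "P <+>\<^bsub>R\<^esub> PIdl\<^bsub>R\<^esub> proj p \<subseteq> carrier R"
    using ideal.Icarr[OF add(1)] by blast
  then have "P <+>\<^bsub>R\<^esub> PIdl\<^bsub>R\<^esub> proj p = carrier R"
    using P.I_maximal[OF add(1,2)] add(3) assms(2,3) by (auto simp: pull_def)
  then obtain r q where rq: "r \<in> carrier R" "q \<in> P" "\<one>\<^bsub>R\<^esub> = q \<oplus>\<^bsub>R\<^esub> r \<otimes>\<^bsub>R\<^esub> proj p"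
    using add(4)[of "\<one>\<^bsub>R\<^esub>"] by auto
  then obtain s t where st: "s \<in> polys V" "r = proj s" "t \<in> polys V" "q = proj t"
    using proj_surj P.Icarr by meson
  then have "proj 1 = proj (t + s * p)"
    using rq(3) assms(2) by (simp add: proj_1 proj_add proj_mult)
  then have "1 - (t + s * p) \<in> I"
    using proj_eq_iff[of 1 "t + s * p"] st assms(2) by simp
  then have "1 - (t + s * p) \<in> pull P"
    using ideal_on_pull(2)[OF P.is_ideal] by blast
  moreover have "t \<in> pull P"
    using st rq by (simp add: pull_def)
  ultimately have "- (1 - (t + s * p) + t) \<in> pull P"
    using ideal_on_add polys.ideal_on_uminus ideal_on_pull(1)[OF P.is_ideal] by blast
  then show ?thesis
    using st by (intro bexI[of _ s]) (simp_all add: algebra_simps)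
qed

text \<open>Both directions use minimality: the contraction of the generated ideal absorbs every
  stage of \<open>adjoin\<close>, while the image of stage \<open>i\<close> is an ideal of
  \<open>R\<close> containing the generators.\<close>

lemma proj_mem_genideal_iff:
  assumes g: "\<And>i. i < n \<Longrightarrow> g i \<in> polys V" and "i \<le> n" "s \<in> polys V"
  shows "proj s \<in> Idl\<^bsub>R\<^esub> ((\<lambda>j. proj (g j)) ` {..<i}) \<longleftrightarrow> s \<in> adjoin (polys V) g I i"
proof
  let ?G = "(\<lambda>j. proj (g j)) ` {..<i}"
  have sub: "?G \<subseteq> carrier R"
    using g assms(2) by auto
  note K = R.genideal_ideal[OF sub]
  note pK = ideal_on_pull[OF K]
  have "adjoin (polys V) g I j \<subseteq> pull (Idl\<^bsub>R\<^esub> ?G)" if "j \<le> i" for j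
    using that
  proof (induction j)
    case 0
    then show ?case
      using pK(2) by simp
  next
    case (Suc j)
    then have "g j \<in> pull (Idl\<^bsub>R\<^esub> ?G)"
      using R.genideal_self[OF sub] g assms(2) by (auto simp: pull_def)
    then show ?case
      using Suc ideal_on_add[OF pK(1)] ideal_on_mult2[OF pK(1)] by auto
  qed
  then show "proj s \<in> Idl\<^bsub>R\<^esub> ?G" if "s \<in> adjoin (polys V) g I i"
    using that by (auto simp: pull_def)
  assume s: "proj s \<in> Idl\<^bsub>R\<^esub> ?G"
  let ?T = "adjoin (polys V) g I i"
  have T: "ideal_on (polys V) ?T"
    using polys.ideal_on_adjoin[OF I] g assms(2) by simp
  have "g j \<in> ?T" if "j < i" for j
  proof -
    have "g j \<in> adjoin (polys V) g I (Suc j)"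
      unfolding adjoin.simps using ideal_on_zero[OF polys.ideal_on_adjoin[OF I, of j g]] g that assms(2)
      by (intro CollectI exI[of _ 0] exI[of _ 1]) auto
    moreover have "adjoin (polys V) g I (Suc j) \<subseteq> ?T"
    proof (rule lift_Suc_mono_le[of "adjoin (polys V) g I"])
      show "adjoin (polys V) g I k \<subseteq> adjoin (polys V) g I (Suc k)" for k
        by (rule subsetI, rule polys.adjoin_sub)
    qed (use that in simp)
    ultimately show ?thesis
      by blast
  qed
  then have "?G \<subseteq> proj ` ?T"
    by auto
  then have "Idl\<^bsub>R\<^esub> ?G \<subseteq> proj ` ?T"
    by (rule R.genideal_minimal[OF proj_ideal[OF T]])
  then obtain t where t: "t \<in> ?T" "proj s = proj t"
    using s by blast
  then have "s - t \<in> ?T"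
    using proj_eq_iff[of s t] assms(3) ideal_on_mem[OF T] polys.adjoin_base by blast
  then show "s \<in> ?T"
    using ideal_on_add[OF T, of "s - t" t] t by simp
qed

text \<open>The nonzerodivisor conditions come from \<open>reg\<close>; the properness clause holds
  because the sequence generates an ideal inside the proper ideal \<open>P\<close>.\<close>

lemma regular_sequence_proj:
  assumes g: "\<And>i. i < n \<Longrightarrow> g i \<in> polys V" and reg: "weakly_regular (polys V) g n I"
    and P: "ideal P R" "P \<noteq> carrier R" "\<And>i. i < n \<Longrightarrow> g i \<in> pull P"
  shows "regular_sequence R (map (\<lambda>i. proj (g i)) [0..<n])"
  unfolding regular_sequence_def
proof (intro conjI allI impI ballI)
  let ?xs = "map (\<lambda>i. proj (g i)) [0..<n]"
  show xs: "set ?xs \<subseteq> carrier R"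
    using g by auto
  have "Idl\<^bsub>R\<^esub> (set ?xs) \<subseteq> P"
    using P(3) by (intro R.genideal_minimal[OF P(1)]) (auto simp: pull_def)
  then show "Idl\<^bsub>R\<^esub> (set ?xs) \<noteq> carrier R"
    using P(2) ideal.Icarr[OF P(1)] by auto
  fix i y assume i: "i < length ?xs" and y: "y \<in> carrier R"
    "?xs ! i \<otimes>\<^bsub>R\<^esub> y \<in> Idl\<^bsub>R\<^esub> (set (take i ?xs))"
  have take: "set (take i ?xs) = (\<lambda>j. proj (g j)) ` {..<i}"
    using i by (auto simp: take_map)
  obtain s where s: "s \<in> polys V" "y = proj s"
    using proj_surj y(1) by blast
  have "proj (g i * s) \<in> Idl\<^bsub>R\<^esub> ((\<lambda>j. proj (g j)) ` {..<i})"
    using y(2) s i g unfolding take by (simp add: proj_mult)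
  then have "g i * s \<in> adjoin (polys V) g I i"
    using proj_mem_genideal_iff[of n g i "g i * s"] g i s by simp
  then have "s \<in> adjoin (polys V) g I i"
    using reg i s by (simp add: weakly_regular_def)
  then show "y \<in> Idl\<^bsub>R\<^esub> (set (take i ?xs))"
    using proj_mem_genideal_iff[of n g i s] g i s unfolding take by simp
qed

end

theorem shellable_cohen_macaulay:
  assumes V: "finite V" and shell: "shellable \<F>" and F: "\<And>F. F \<in> \<F> \<Longrightarrow> F \<subseteq> V \<and> card F = 3"
  shows "cohen_macaulay_over TYPE('k::field) V (generated_complex \<F>)"
proof -
  let ?I = "sr_ideal V (generated_complex \<F>) :: ((_ \<Rightarrow>\<^sub>0 nat) \<Rightarrow>\<^sub>0 'k) set"
  interpret poly_quotient V ?I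
    by unfold_locales (rule V, rule ideal_on_sr_ideal[OF generated_complex_down])
  have R_eq: "(stanley_reisner_ring V (generated_complex \<F>) :: ((_ \<Rightarrow>\<^sub>0 nat) \<Rightarrow>\<^sub>0 'k) set ring) = R"
    unfolding stanley_reisner_ring_def
    by (subst stanley_reisner_ideal_eq[OF V]) (auto intro: generated_complex_down)
  have finF: "finite \<F>"
    using F V finite_subset[of \<F> "Pow V"] by auto
  have "ideal_depth R P = prime_height R P" if P: "maximalideal P R" for P
  proof (rule antisym)
    interpret P: maximalideal P R by fact
    have prime: "primeideal P R"
      by (rule R.maximalideal_prime[OF P])
    show "ideal_depth R P \<le> prime_height R P"
      by (rule R.ideal_depth_le_prime_height[OF prime])
    note pull = ideal_on_pull(1)[OF P.is_ideal]
    obtain h where h: "lead_coeff h = 1" "degree h > 0" "coeff h 0 = 0" "\<forall>v\<in>V. univ_eval h v \<in> pull P"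
      using ex_common_univ_eval[OF V pull zariski_lemma[OF V pull pull_maximal[OF P]]] by blast
    \<comment> \<open>Starting at degree 1 matters: each summand is then a product over a nonempty
      set, and a single factor in \<open>pull P\<close> suffices.\<close>
    define g where "g i = (esym V (univ_eval h) (Suc i) :: (_ \<Rightarrow>\<^sub>0 nat) \<Rightarrow>\<^sub>0 'k)" for i
    have g_pull: "g i \<in> pull P" for i
      unfolding g_def esym_def
    proof (rule polys.ideal_on_sum[OF pull])
      fix T assume T: "T \<in> {T. T \<subseteq> V \<and> card T = Suc i}"
      then have "finite T" "T \<noteq> {}"
        using V finite_subset by auto
      then obtain v where v: "v \<in> T"
        by blast
      have "(\<Prod>v\<in>T. univ_eval h v) = univ_eval h v * (\<Prod>v\<in>T - {v}. univ_eval h v :: (_ \<Rightarrow>\<^sub>0 nat) \<Rightarrow>\<^sub>0 'k)"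
        by (rule prod.remove[OF \<open>finite T\<close> v])
      also have "\<dots> \<in> pull P"
        using h(4) T v by (intro ideal_on_mult2[OF pull] polys.prod_mem) auto
      finally show "(\<Prod>v\<in>T. univ_eval h v) \<in> pull P" .
    qed
    have g_mem: "g i \<in> polys V" for i
      using g_pull ideal_on_mem[OF pull] by blast
    have "weakly_regular (polys V) g 3 ?I"
      using weakly_regular_shellable[OF shell V h(1-3) F] by (simp add: g_def[abs_def])
    then have "regular_sequence R (map (\<lambda>i. proj (g i)) [0..<3])"
      using regular_sequence_proj[OF _ _ P.is_ideal] g_mem g_pull P.I_notcarr by blast
    moreover have "set (map (\<lambda>i. proj (g i)) [0..<3]) \<subseteq> P"
      using g_pull by (auto simp: pull_def)
    ultimately have "enat (length (map (\<lambda>i. proj (g i)) [0..<3])) \<le> ideal_depth R P"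
      unfolding ideal_depth_def by (intro Sup_upper) blast
    then have depth: "enat 3 \<le> ideal_depth R P"
      by simp
    have "prime_height R P \<le> enat 3"
      unfolding prime_height_def
    proof (rule Sup_least, elim CollectE exE conjE)
      fix e k C assume e: "e = enat k" and C: "\<forall>i\<le>k. primeideal (C i) R" "\<forall>i<k. C i \<subset> C (Suc i)"
      have ideal: "ideal (C i) R" if "i \<le> k" for i
        using C(1) that primeideal.axioms(1) by blast
      \<comment> \<open>Strict inclusions survive contraction because \<open>pull_mono\<close> is an
        equivalence, and every contracted prime contains the Stanley--Reisner ideal.\<close>
      have "k \<le> 3"
      proof (rule prime_chain_length_le[of \<F> 3 k V "\<lambda>i. pull (C i)"])
        show "finite F \<and> card F \<le> 3" if "F \<in> \<F>" for F
          using F[OF that] V finite_subset by auto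
        show "pull (C i) \<subset> pull (C (Suc i))" if "i < k" for i
          using pull_mono[of "C i" "C (Suc i)"] pull_mono[of "C (Suc i)" "C i"] ideal[of i] ideal[of "Suc i"] C(2) that
          by (metis Suc_leI less_imp_le psubset_eq subset_antisym)
      qed (use finF C(1) prime_on_pull ideal_on_pull(2)[OF ideal[of 0]] in auto)
      then show "e \<le> enat 3"
        by (simp add: e)
    qed
    then show "prime_height R P \<le> ideal_depth R P"
      using depth by (rule order_trans)
  qed
  then show ?thesis
    unfolding cohen_macaulay_over_def cohen_macaulay_ring_def R_eq
    using R.cring_axioms noetherian by blast
qed

section \<open>The friendship complex is shellable\<close>

text \<open>The facets are added in the order: cone from \<open>c\<close> over the edges at \<open>w0\<close>, the rest of the cone over
  the complete graph on \<open>W\<close>, then for every \<open>C i\<close> a connected spanning subgraph of its link. After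
  that all edges of the complex are present, so the remaining triangles may come in any order.\<close>

lemma shellable_star_pattern:
  fixes c :: 'a and W H :: "'a set" and I :: "'i set" and C q0 p :: "'i \<Rightarrow> 'a" and Q :: "'i \<Rightarrow> 'a set"
  assumes fin: "finite \<F>" and card3: "\<And>F. F \<in> \<F> \<Longrightarrow> card F = 3"
    and W: "c \<notin> W" "w0 \<in> W" "w1 \<in> W" "w0 \<noteq> w1"
    and C: "inj_on C I" "\<And>i. i \<in> I \<Longrightarrow> C i \<notin> insert c W"
    and Q: "\<And>i. i \<in> I \<Longrightarrow> Q i \<subseteq> W" "\<And>i. i \<in> I \<Longrightarrow> q0 i \<in> Q i" "\<And>i. i \<in> I \<Longrightarrow> p i \<in> Q i" and H: "H \<subseteq> W"
    and cone: "\<And>u w. u \<in> W \<Longrightarrow> w \<in> W \<Longrightarrow> u \<noteq> w \<Longrightarrow> {c, u, w} \<in> \<F>"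
    and star: "\<And>i q. i \<in> I \<Longrightarrow> q \<in> Q i \<Longrightarrow> {C i, c, q} \<in> \<F>"
    and hub: "\<And>i w. i \<in> I \<Longrightarrow> w \<in> H - Q i \<Longrightarrow> {C i, p i, w} \<in> \<F>"
    and sub: "\<And>F. F \<in> \<F> \<Longrightarrow> F \<subseteq> insert c W \<union> C ` I"
    and link: "\<And>F i. F \<in> \<F> \<Longrightarrow> i \<in> I \<Longrightarrow> C i \<in> F \<Longrightarrow> F - {C i} \<subseteq> insert c (Q i \<union> H)"
  shows "shellable \<F>"
proof -
  note gen = generated_complex_def
  define F1 where "F1 = {{c, w0, w1}} \<union> {{c, w0, u} | u. u \<in> W - {w0, w1}}"
  define G2 where "G2 = {{c, u, w} | u w. u \<in> W - {w0} \<and> w \<in> W - {w0} \<and> u \<noteq> w}"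
  define G3 where "G3 = {{C i, c, q0 i} | i. i \<in> I}"
  define G4 where "G4 = {{C i, c, q} | i q. i \<in> I \<and> q \<in> Q i - {q0 i}}"
  define G5 where "G5 = {{C i, p i, w} | i w. i \<in> I \<and> w \<in> H - Q i}"
  have cW: "w \<noteq> c" if "w \<in> W" for w
    using W(1) that by blast
  have CW: "C i \<noteq> w" "C i \<noteq> c" if "i \<in> I" "w \<in> W" for i w
    using C(2)[OF that(1)] that(2) by auto
  have CC: "C i = C j \<longleftrightarrow> i = j" if "i \<in> I" "j \<in> I" for i j
    using inj_on_eq_iff[OF C(1) that] .
  have QW: "q \<in> W" if "i \<in> I" "q \<in> Q i" for i q
    using Q(1) that by blast
  have F1_sub: "F1 \<subseteq> \<F>" and G2_sub: "G2 \<subseteq> \<F>" and G3_sub: "G3 \<subseteq> \<F>" and G4_sub: "G4 \<subseteq> \<F>"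
    and G5_sub: "G5 \<subseteq> \<F>"
    using cone star hub W Q by (auto simp: F1_def G2_def G3_def G4_def G5_def)
  \<comment> \<open>The empty family generates no face at all, not even the empty one, so the empty
    set is the new minimal face of the first triangle.\<close>
  have "shellable {{c, w0, w1}}"
    using shellable.insert[OF shellable.empty, of "{}" "{c, w0, w1}"] by (simp add: gen)
  then have "shellable F1"
    unfolding F1_def
  proof (rule shellable_batch[rotated])
    show "finite {{c, w0, u} | u. u \<in> W - {w0, w1}}"
      by (rule finite_subset[OF _ fin]) (use F1_sub in \<open>auto simp: F1_def\<close>)
    fix F assume "F \<in> {{c, w0, u} | u. u \<in> W - {w0, w1}}"
    then obtain u where u: "F = {c, w0, u}" "u \<in> W - {w0, w1}"
      by blast
    \<comment> \<open>The triangle is glued along the edge \<open>{c, w0}\<close>; its new minimal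
      face is the vertex \<open>u\<close>.\<close>
    have "\<forall>x\<in>{u}. F - {x} \<in> generated_complex {{c, w0, w1}}"
      using u cW by (auto simp: gen)
    moreover have "\<forall>G\<in>{{c, w0, w1}} \<union> {{c, w0, u} | u. u \<in> W - {w0, w1}} - {F}. \<not> {u} \<subseteq> G"
      using u cW by auto
    ultimately show "\<exists>R\<subseteq>F. (\<forall>x\<in>R. F - {x} \<in> generated_complex {{c, w0, w1}}) \<and>
        (\<forall>G\<in>{{c, w0, w1}} \<union> {{c, w0, u} | u. u \<in> W - {w0, w1}} - {F}. \<not> R \<subseteq> G)"
      using u by (intro exI[of _ "{u}"]) auto
  qed
  have F1_edge: "{c, w} \<in> generated_complex F1" if "w \<in> W" for w
    using that by (cases "w = w0 \<or> w = w1") (auto simp: gen F1_def)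
  have F1_form: "\<exists>u\<in>W. G = {c, w0, u} \<and> u \<noteq> w0" if "G \<in> F1" for G
    using that W by (auto simp: F1_def)
  have "shellable (F1 \<union> G2)"
  proof (rule shellable_batch[OF _ \<open>shellable F1\<close>])
    show "finite G2"
      by (rule finite_subset[OF G2_sub fin])
    fix F assume "F \<in> G2"
    then obtain u w where F: "F = {c, u, w}" "u \<in> W - {w0}" "w \<in> W - {w0}" "u \<noteq> w"
      by (auto simp: G2_def)
    \<comment> \<open>Two edges at \<open>c\<close> are present. The opposite edge
      \<open>{u, w}\<close> is new: earlier triangles have the form \<open>{c, w0, x}\<close>, and
      \<open>F\<close> is the only one of this batch containing both ends.\<close>
    have "F - {u} = {c, w}" "F - {w} = {c, u}"
      using F cW by auto
    then have "\<forall>x\<in>{u, w}. F - {x} \<in> generated_complex F1"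
      using F1_edge F by auto
    moreover have "\<not> {u, w} \<subseteq> G" if "G \<in> F1 \<union> G2 - {F}" for G
    proof
      assume uw: "{u, w} \<subseteq> G"
      from that consider "G \<in> F1" | "G \<in> G2" "G \<noteq> F"
        by blast
      then show False
      proof cases
        case 1
        then show ?thesis
          using F1_form uw F cW by blast
      next
        case 2
        then obtain u' w' where "G = {c, u', w'}" "u' \<in> W" "w' \<in> W"
          by (auto simp: G2_def)
        then show ?thesis
          using uw F cW[of u] cW[of w] \<open>G \<noteq> F\<close> by auto
      qed
    qed
    ultimately show "\<exists>R\<subseteq>F. (\<forall>x\<in>R. F - {x} \<in> generated_complex F1) \<and> (\<forall>G\<in>F1 \<union> G2 - {F}. \<not> R \<subseteq> G)"
      using F(1) by (intro exI[of _ "{u, w}"]) auto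
  qed
  define F2 where "F2 = F1 \<union> G2"
  have F2: "shellable F2" "F2 \<subseteq> \<F>"
    using \<open>shellable (F1 \<union> G2)\<close> F1_sub G2_sub by (auto simp: F2_def)
  have F2_face: "{c, u, w} \<in> F2" if "u \<in> W" "w \<in> W" "u \<noteq> w" for u w
  proof -
    have c1: "{c, w0, x} \<in> F1" if "x \<in> W" "x \<noteq> w0" for x
      using that by (cases "x = w1") (auto simp: F1_def)
    consider "u = w0" | "w = w0" | "u \<noteq> w0" "w \<noteq> w0"
      by blast
    then show ?thesis
    proof cases
      case 1
      then show ?thesis
        using c1[of w] that by (simp add: F2_def)
    next
      case 2
      then show ?thesis
        using c1[of u] that by (simp add: F2_def insert_commute)
    next
      case 3
      then show ?thesis
        using that by (auto simp: F2_def G2_def)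
    qed
  qed
  have F2_W: "G \<subseteq> insert c W" if "G \<in> F2" for G
    using that W by (auto simp: F2_def F1_def G2_def)
  have ex_other: "\<exists>w'\<in>W. w' \<noteq> w" for w
    using W(2-4) by (cases "w = w0") auto
  have F2_C: "C i \<notin> G" if "G \<in> F2" "i \<in> I" for G i
    using F2_W[OF that(1)] C(2)[OF that(2)] by blast
  have G3_form: "G = {C i, c, q0 i}" if "G \<in> G3" "C i \<in> G" "i \<in> I" for G i
  proof -
    from that(1) obtain j where G: "G = {C j, c, q0 j}" "j \<in> I"
      by (auto simp: G3_def)
    have "C i = C j"
      using that(2) G(1) CW[OF that(3) QW[OF G(2) Q(2)[OF G(2)]]] by auto
    then show ?thesis
      using G CC[OF that(3) G(2)] by simp
  qed
  have F2_edge: "{u, w} \<in> generated_complex F2" if "u \<in> insert c W" "w \<in> insert c W" "u \<noteq> w" for u w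
  proof -
    have edge_c: "{c, x} \<in> generated_complex F2" if "x \<in> W" for x
    proof -
      obtain y where "y \<in> W" "y \<noteq> x"
        using ex_other by blast
      then have "{c, x, y} \<in> F2"
        using F2_face that by auto
      then show ?thesis
        unfolding gen by (intro CollectI bexI[of _ "{c, x, y}"]) auto
    qed
    from that consider "u = c" | "w = c" | "u \<in> W" "w \<in> W"
      by blast
    then show ?thesis
    proof cases
      case 1
      then show ?thesis
        using edge_c[of w] that by auto
    next
      case 2
      then show ?thesis
        using edge_c[of u] that by (auto simp: insert_commute)
    next
      case 3
      then have "{c, u, w} \<in> F2"
        using F2_face that(3) by blast
      then show ?thesis
        unfolding gen by (intro CollectI bexI[of _ "{c, u, w}"]) auto
    qed
  qed
  have mono: "F \<in> generated_complex \<G> \<Longrightarrow> \<G> \<subseteq> \<H> \<Longrightarrow> F \<in> generated_complex \<H>" for F :: "'a set" and \<G> \<H>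
    by (auto simp: gen)
  have "shellable (F2 \<union> G3)"
  proof (rule shellable_batch[OF _ F2(1)])
    show "finite G3"
      by (rule finite_subset[OF G3_sub fin])
    fix F assume "F \<in> G3"
    then obtain i where F: "F = {C i, c, q0 i}" "i \<in> I"
      by (auto simp: G3_def)
    have q0: "q0 i \<in> W"
      using QW[OF F(2) Q(2)[OF F(2)]] .
    \<comment> \<open>The first triangle at \<open>C i\<close>: the vertex itself is the new minimal
      face, glued along an edge of the cone.\<close>
    have "F - {C i} = {c, q0 i}"
      using F CW[OF F(2) q0] by auto
    then have "\<forall>x\<in>{C i}. F - {x} \<in> generated_complex F2"
      using F2_edge[of c "q0 i"] q0 cW by auto
    moreover have "\<not> {C i} \<subseteq> G" if "G \<in> F2 \<union> G3 - {F}" for G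
      using that F2_C[OF _ F(2)] G3_form[OF _ _ F(2)] F(1) by blast
    ultimately show "\<exists>R\<subseteq>F. (\<forall>x\<in>R. F - {x} \<in> generated_complex F2) \<and> (\<forall>G\<in>F2 \<union> G3 - {F}. \<not> R \<subseteq> G)"
      using F(1) by (intro exI[of _ "{C i}"]) auto
  qed
  define F3 where "F3 = F2 \<union> G3"
  have F3: "shellable F3" "F3 \<subseteq> \<F>"
    using \<open>shellable (F2 \<union> G3)\<close> F2(2) G3_sub by (auto simp: F3_def)
  have F3_link: "G \<subseteq> {C i, c, q0 i}" if "G \<in> F3" "C i \<in> G" "i \<in> I" for G i
    using that F2_C[OF _ that(3), of G] G3_form[of G i] by (auto simp: F3_def)
  have F3_edge: "{C i, c} \<in> generated_complex F3" "{C i, q0 i} \<in> generated_complex F3" if "i \<in> I" for i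
    using that unfolding gen by (auto simp: F3_def G3_def intro!: bexI[of _ "{C i, c, q0 i}"])
  have "shellable (F3 \<union> G4)"
  proof (rule shellable_batch[OF _ F3(1)])
    show "finite G4"
      by (rule finite_subset[OF G4_sub fin])
    fix F assume "F \<in> G4"
    then obtain i q where F: "F = {C i, c, q}" "i \<in> I" "q \<in> Q i" "q \<noteq> q0 i"
      by (auto simp: G4_def)
    have q: "q \<in> W"
      using QW[OF F(2,3)] .
    \<comment> \<open>Glued along a cone edge and along \<open>{C i, c}\<close> from the previous
      batch; the new minimal face is the edge \<open>{C i, q}\<close>.\<close>
    have "F - {C i} = {c, q}" "F - {q} = {C i, c}"
      using F CW[OF F(2) q] cW[OF q] by auto
    then have "\<forall>x\<in>{C i, q}. F - {x} \<in> generated_complex F3"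
      using mono[OF F2_edge[of c q], of F3] F3_edge(1)[OF F(2)] q cW by (auto simp: F3_def)
    moreover have "\<not> {C i, q} \<subseteq> G" if "G \<in> F3 \<union> G4 - {F}" for G
    proof
      assume Cq: "{C i, q} \<subseteq> G"
      from that consider "G \<in> F3" | j q' where "G = {C j, c, q'}" "j \<in> I" "q' \<in> Q j" "G \<noteq> F"
        by (auto simp: G4_def)
      then show False
      proof cases
        case 1
        then show ?thesis
          using F3_link[OF 1 _ F(2)] Cq F(4) CW[OF F(2) q] cW[OF q] by auto
      next
        case 2
        have q': "q' \<in> W"
          using QW[OF 2(2,3)] .
        have "C i = C j"
          using Cq 2(1) CW[OF F(2) q'] by auto
        then have "q = q'"
          using Cq 2(1) CW[OF 2(2) q] cW[OF q] by auto
        then show ?thesis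
          using 2(1,4) F(1) \<open>C i = C j\<close> by simp
      qed
    qed
    ultimately show "\<exists>R\<subseteq>F. (\<forall>x\<in>R. F - {x} \<in> generated_complex F3) \<and> (\<forall>G\<in>F3 \<union> G4 - {F}. \<not> R \<subseteq> G)"
      using F(1) by (intro exI[of _ "{C i, q}"]) auto
  qed
  define F4 where "F4 = F3 \<union> G4"
  have F4: "shellable F4" "F4 \<subseteq> \<F>"
    using \<open>shellable (F3 \<union> G4)\<close> F3(2) G4_sub by (auto simp: F4_def)
  have F4_link: "G \<subseteq> insert (C i) (insert c (Q i))" if "G \<in> F4" "C i \<in> G" "i \<in> I" for G i
  proof (cases "G \<in> F3")
    case True
    then show ?thesis
      using F3_link[OF True that(2,3)] Q(2)[OF that(3)] by blast
  next
    case False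
    with that(1) obtain j q where G: "G = {C j, c, q}" "j \<in> I" "q \<in> Q j"
      by (auto simp: F4_def G4_def)
    then have "C i = C j"
      using that CW[OF that(3) QW[OF G(2,3)]] by auto
    then show ?thesis
      using G CC[OF that(3) G(2)] by auto
  qed
  have F4_edge: "{C i, q} \<in> generated_complex F4" if "i \<in> I" "q \<in> Q i" for i q
  proof (cases "q = q0 i")
    case True
    then show ?thesis
      using mono[OF F3_edge(2)[OF that(1)], of F4] by (simp add: F4_def)
  next
    case False
    then have "{C i, c, q} \<in> F4"
      using that by (auto simp: F4_def G4_def)
    then show ?thesis
      unfolding gen by (intro CollectI bexI[of _ "{C i, c, q}"]) auto
  qed
  have "shellable (F4 \<union> G5)"
  proof (rule shellable_batch[OF _ F4(1)])
    show "finite G5"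
      by (rule finite_subset[OF G5_sub fin])
    fix F assume "F \<in> G5"
    then obtain i w where F: "F = {C i, p i, w}" "i \<in> I" "w \<in> H" "w \<notin> Q i"
      by (auto simp: G5_def)
    have p: "p i \<in> Q i" "p i \<in> W" "p i \<noteq> w" "w \<in> W"
      using Q(3)[OF F(2)] QW[OF F(2)] F H by auto
    \<comment> \<open>Vertices of \<open>H\<close> outside \<open>Q i\<close> are reached through
      \<open>p i\<close>: the edges \<open>{p i, w}\<close> and \<open>{C i, p i}\<close> are
      present, and \<open>{C i, w}\<close> is new.\<close>
    have "F - {C i} = {p i, w}" "F - {w} = {C i, p i}"
      using F p CW[OF F(2) p(2)] CW[OF F(2) p(4)] by auto
    then have "\<forall>x\<in>{C i, w}. F - {x} \<in> generated_complex F4"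
      using mono[OF F2_edge[of "p i" w], of F4] F4_edge[OF F(2) p(1)] p by (auto simp: F4_def F3_def)
    moreover have "\<not> {C i, w} \<subseteq> G" if "G \<in> F4 \<union> G5 - {F}" for G
    proof
      assume Cw: "{C i, w} \<subseteq> G"
      from that consider "G \<in> F4" | j w' where "G = {C j, p j, w'}" "j \<in> I" "w' \<in> H" "G \<noteq> F"
        by (auto simp: G5_def)
      then show False
      proof cases
        case 1
        then show ?thesis
          using F4_link[OF 1 _ F(2)] Cw F(4) CW[OF F(2) p(4)] cW[OF p(4)] by auto
      next
        case 2
        have w': "w' \<in> W" "p j \<in> W"
          using 2 H QW[OF 2(2) Q(3)[OF 2(2)]] by auto
        have "C i = C j"
          using Cw 2(1) CW[OF F(2) w'(1)] CW[OF F(2) w'(2)] by auto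
        then have "i = j"
          using CC[OF F(2) 2(2)] by simp
        then have "w = w'"
          using Cw 2(1) CW[OF F(2) p(4)] p by auto
        then show ?thesis
          using 2(1,4) F(1) \<open>i = j\<close> by simp
      qed
    qed
    ultimately show "\<exists>R\<subseteq>F. (\<forall>x\<in>R. F - {x} \<in> generated_complex F4) \<and> (\<forall>G\<in>F4 \<union> G5 - {F}. \<not> R \<subseteq> G)"
      using F(1) by (intro exI[of _ "{C i, w}"]) auto
  qed
  define F5 where "F5 = F4 \<union> G5"
  have F5: "shellable F5" "F5 \<subseteq> \<F>"
    using \<open>shellable (F4 \<union> G5)\<close> F4(2) G5_sub by (auto simp: F5_def)
  have F2_F5: "F2 \<subseteq> F5" and F3_F5: "F3 \<subseteq> F5" and F4_F5: "F4 \<subseteq> F5"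
    by (auto simp: F3_def F4_def F5_def)
  have F5_edge: "{C i, w} \<in> generated_complex F5" if "i \<in> I" "w \<in> insert c (Q i \<union> H)" for i w
  proof -
    from that(2) consider "w = c" | "w \<in> Q i" | "w \<in> H - Q i"
      by blast
    then show ?thesis
    proof cases
      case 1
      then show ?thesis
        using mono[OF F3_edge(1)[OF that(1)] F3_F5] by simp
    next
      case 2
      then show ?thesis
        using mono[OF F4_edge[OF that(1) 2] F4_F5] by simp
    next
      case 3
      then have "{C i, p i, w} \<in> F5"
        using that(1) by (auto simp: F5_def G5_def)
      then show ?thesis
        unfolding gen by (intro CollectI bexI[of _ "{C i, p i, w}"]) auto
    qed
  qed
  have "shellable (F5 \<union> (\<F> - F5))"
  proof (rule shellable_batch[OF _ F5(1)])
    show "finite (\<F> - F5)"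
      using fin by simp
    fix F assume F: "F \<in> \<F> - F5"
    \<comment> \<open>By \<open>link\<close> an edge at some \<open>C i\<close> ends in
      \<open>insert c (Q i \<union> H)\<close>, to which \<open>F5\<close> already joins
      \<open>C i\<close>; every other edge lies in the cone. The whole boundary of \<open>F\<close>
      is thus present, and \<open>F\<close> is its own minimal new face.\<close>
    have edge: "{u, w} \<in> generated_complex F5" if uw: "{u, w} \<subseteq> F" "u \<noteq> w" for u w
    proof -
      have CI: "{C i, x} \<in> generated_complex F5" if "i \<in> I" "C i \<in> F" "x \<in> F" "x \<noteq> C i" for i x
        using link[of F i] F that by (intro F5_edge) auto
      show ?thesis
      proof (cases "u \<in> C ` I \<or> w \<in> C ` I")
        case True
        then show ?thesis
          using CI uw by (auto simp: insert_commute)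
      next
        case False
        then show ?thesis
          using sub[of F] F uw by (intro mono[OF F2_edge F2_F5]) auto
      qed
    qed
    obtain x y z where xyz: "F = {x, y, z}" "x \<noteq> y" "x \<noteq> z" "y \<noteq> z"
      using card3[of F] F by (auto simp: card_3_iff)
    have "F - {x} = {y, z}" "F - {y} = {x, z}" "F - {z} = {x, y}"
      using xyz by auto
    then have "\<forall>v\<in>F. F - {v} \<in> generated_complex F5"
      using edge[of y z] edge[of x z] edge[of x y] xyz by auto
    moreover have "\<not> F \<subseteq> G" if "G \<in> F5 \<union> (\<F> - F5) - {F}" for G
    proof
      assume "F \<subseteq> G"
      moreover have "card G = 3" "card F = 3"
        using that F F5(2) card3 by auto
      moreover from this have "finite G"
        by (intro card_ge_0_finite) simp
      ultimately have "F = G"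
        using card_subset_eq[of G F] by simp
      then show False
        using that by blast
    qed
    ultimately show "\<exists>R\<subseteq>F. (\<forall>x\<in>R. F - {x} \<in> generated_complex F5) \<and> (\<forall>G\<in>F5 \<union> (\<F> - F5) - {F}. \<not> R \<subseteq> G)"
      by (intro exI[of _ F]) blast
  qed
  moreover have "F5 \<union> (\<F> - F5) = \<F>"
    using F5(2) by blast
  ultimately show ?thesis
    by simp
qed

section \<open>Spokes, rim edges and adjacency in the friendship graph\<close>

lemma friendship_edges_iff:
  "e \<in> friendship_edges n \<longleftrightarrow> (\<exists>i\<in>{1..n}. e = {1, 2 * i} \<or> e = {1, 2 * i + 1} \<or> e = {2 * i, 2 * i + 1})"
proof -
  have "(e \<subseteq> {a, b, c} \<and> card e = 2) \<longleftrightarrow> e = {a, b} \<or> e = {a, c} \<or> e = {b, c}"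
    if "a \<noteq> b" "a \<noteq> c" "b \<noteq> c" for a b c :: nat
    using that by (auto simp: card_2_iff)
  then have "(e \<subseteq> friendship_triangle i \<and> card e = 2) \<longleftrightarrow>
      e = {1, 2 * i} \<or> e = {1, 2 * i + 1} \<or> e = {2 * i, 2 * i + 1}" if "i \<in> {1..n}" for i
    using that unfolding friendship_triangle_def by simp
  then show ?thesis
    unfolding friendship_edges_def by blast
qed

lemma spoke_in_friendship_edges: "{1, v} \<in> friendship_edges n \<longleftrightarrow> v \<in> {2..2 * n + 1}"
proof
  assume "{1, v} \<in> friendship_edges n"
  then show "v \<in> {2..2 * n + 1}"
    by (auto simp: friendship_edges_iff doubleton_eq_iff)
next
  assume v: "v \<in> {2..2 * n + 1}"
  then have "v div 2 \<in> {1..n}" "v = 2 * (v div 2) \<or> v = 2 * (v div 2) + 1"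
    by auto
  then show "{1, v} \<in> friendship_edges n"
    unfolding friendship_edges_iff by metis
qed

text \<open>Rim edges of different triangles are disjoint, and a spoke meets a rim edge only at its
  outer end.\<close>

lemma adjacent_rim_edge:
  assumes i: "i \<in> {1..n}" and "adj_edges (friendship_edges n) e f" "e = {2 * i, 2 * i + 1}"
  shows "f = {1, 2 * i} \<or> f = {1, 2 * i + 1}"
proof -
  obtain j where j: "j \<in> {1..n}" "f = {1, 2 * j} \<or> f = {1, 2 * j + 1} \<or> f = {2 * j, 2 * j + 1}"
    using assms(2) unfolding adj_edges_def friendship_edges_iff by blast
  have "{2 * i, 2 * i + 1} \<inter> f \<noteq> {}" "f \<noteq> {2 * i, 2 * i + 1}"
    using assms by (auto simp: adj_edges_def)
  then have "i = j"
    using i j by auto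
  then show ?thesis
    using j \<open>f \<noteq> _\<close> by blast
qed

lemma adj_edges_sym: "adj_edges E e f \<Longrightarrow> adj_edges E f e"
  by (auto simp: adj_edges_def)

lemma friendship_edge_cases:
  assumes "e \<in> friendship_edges n"
  obtains v where "v \<in> {2..2 * n + 1}" "e = {1, v}" | i where "i \<in> {1..n}" "e = {2 * i, 2 * i + 1}"
proof -
  from assms obtain i where "i \<in> {1..n}" "e = {1, 2 * i} \<or> e = {1, 2 * i + 1} \<or> e = {2 * i, 2 * i + 1}"
    unfolding friendship_edges_iff by blast
  moreover from this have "2 * i \<in> {2..2 * n + 1}" "2 * i + 1 \<in> {2..2 * n + 1}"
    by auto
  ultimately show thesis
    using that(1)[of "2 * i"] that(1)[of "2 * i + 1"] that(2)[of i] by blast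
qed

text \<open>Halving recovers the number of the triangle from an outer vertex, and every edge stays
  inside one triangle.\<close>

lemma friendship_rim_neighbour:
  assumes "{p, q} \<in> friendship_edges n" "i \<in> {1..n}" "p \<in> {2 * i, 2 * i + 1}"
  shows "q \<in> {1, 2 * i, 2 * i + 1}"
proof -
  from assms(1) obtain j where j: "j \<in> {1..n}"
    "{p, q} = {1, 2 * j} \<or> {p, q} = {1, 2 * j + 1} \<or> {p, q} = {2 * j, 2 * j + 1}"
    unfolding friendship_edges_iff by blast
  have "1 \<le> i" "p = 2 * i \<or> p = 2 * i + 1"
    using assms(2,3) by simp_all
  then have "p \<noteq> 1" "p div 2 = i"
    by presburger+
  moreover from j(2) have "p = 1 \<or> q = 1 \<or> p = 2 * j \<and> q = 2 * j + 1 \<or> p = 2 * j + 1 \<and> q = 2 * j"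
    unfolding doubleton_eq_iff by blast
  ultimately show ?thesis
    by (elim disjE) auto
qed

declare One_nat_def [simp del]

text \<open>The centre of the pattern is the common vertex \<open>1\<close>, which is adjacent in the total graph to
  everything except the rim edges \<open>{2i, 2i + 1}\<close>; these play the role of the \<open>C i\<close>, and the spokes
  \<open>{1, v}\<close> form the clique \<open>H\<close>.\<close>

lemma shellable_friendship:
  assumes n: "n \<ge> 1"
  shows "shellable (total_indices (friendship_vertices n) (friendship_edges n)) \<and>
    (\<forall>F\<in>total_indices (friendship_vertices n) (friendship_edges n).
       F \<subseteq> total_vertices (friendship_vertices n) (friendship_edges n) \<and> card F = 3)"
proof -
  let ?V = "friendship_vertices n" and ?E = "friendship_edges n"
  let ?T = "total_indices ?V ?E"
  let ?L = "{2..2 * n + 1}"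
  define spoke :: "nat \<Rightarrow> nat + nat set" where "spoke v = Inr {1, v}" for v
  define rim :: "nat \<Rightarrow> nat + nat set" where "rim i = Inr {2 * i, 2 * i + 1}" for i
  define W where "W = Inl ` ?L \<union> spoke ` ?L"
  \<comment> \<open>The neighbours of the rim edge \<open>rim i\<close> in the total graph: its two
    ends and the two spokes meeting it.\<close>
  define Q where "Q i = {Inl (2 * i), Inl (2 * i + 1), spoke (2 * i), spoke (2 * i + 1)}" for i
  have V: "?V = {1..2 * n + 1}"
    by (rule friendship_vertices_eq[OF n])
  have E_V: "e \<subseteq> ?V" "card e = 2" if "e \<in> ?E" for e
    using simple_graph_friendship[of n] that by (auto simp: simple_graph_def)
  have tri1: "{Inl p, Inl q, Inl r} \<in> ?T" if "{p, q} \<in> ?E" "{q, r} \<in> ?E" "p \<noteq> r" for p q r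
    unfolding total_indices_def
    by (rule UnI1, rule UnI1, rule UnI1, rule UnI1, intro CollectI exI conjI, rule refl) (rule that)+
  have tri2: "{Inr p, Inr q, Inr r} \<in> ?T" if "adj_edges ?E p q" "adj_edges ?E q r" "p \<noteq> r" for p q r
    unfolding total_indices_def
    by (rule UnI1, rule UnI1, rule UnI1, rule UnI2, intro CollectI exI conjI, rule refl) (rule that)+
  have tri3: "{Inl p, Inl q, Inr r} \<in> ?T" if "{p, q} \<in> ?E" "r \<in> ?E" "p \<in> r \<or> q \<in> r" for p q r
    unfolding total_indices_def
    by (rule UnI1, rule UnI1, rule UnI2, intro CollectI exI conjI, rule refl) (rule that)+
  have tri4: "{Inr p, Inr q, Inl r} \<in> ?T" if "adj_edges ?E p q" "r \<in> ?V" "r \<in> p \<or> r \<in> q" for p q r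
    unfolding total_indices_def
    by (rule UnI1, rule UnI2, intro CollectI exI conjI, rule refl) (rule that)+
  \<comment> \<open>Excludes the singleton generators, so every member of \<open>?T\<close> has
    three elements.\<close>
  have no_isolated: "\<exists>q\<in>?V. {p, q} \<in> ?E" if "p \<in> ?V" for p
  proof (cases "p = 1")
    case True
    then show ?thesis
      using n by (intro bexI[of _ 2]) (auto simp: V spoke_in_friendship_edges)
  next
    case False
    then have "{1, p} \<in> ?E"
      using that by (auto simp: V spoke_in_friendship_edges)
    then show ?thesis
      by (intro bexI[of _ 1]) (auto simp: V insert_commute)
  qed
  have T_cases: thesis if "F \<in> ?T"
    "\<And>p q r. F = {Inl p, Inl q, Inl r} \<Longrightarrow> {p, q} \<in> ?E \<Longrightarrow> {q, r} \<in> ?E \<Longrightarrow> p \<noteq> r \<Longrightarrow> thesis"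
    "\<And>p q r. F = {Inr p, Inr q, Inr r} \<Longrightarrow> adj_edges ?E p q \<Longrightarrow> adj_edges ?E q r \<Longrightarrow> p \<noteq> r \<Longrightarrow> thesis"
    "\<And>p q r. F = {Inl p, Inl q, Inr r} \<Longrightarrow> {p, q} \<in> ?E \<Longrightarrow> r \<in> ?E \<Longrightarrow> p \<in> r \<or> q \<in> r \<Longrightarrow> thesis"
    "\<And>p q r. F = {Inr p, Inr q, Inl r} \<Longrightarrow> adj_edges ?E p q \<Longrightarrow> r \<in> ?V \<Longrightarrow> r \<in> p \<or> r \<in> q \<Longrightarrow> thesis"
    for F thesis
    using that(1) unfolding total_indices_def
    by (elim UnE CollectE exE conjE)
      ((rule that(2); assumption) | (rule that(3); assumption) | (rule that(4); assumption)
        | (rule that(5); assumption) | (use no_isolated in blast))+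
  have adj_V: "p \<in> ?V \<and> q \<in> ?V \<and> p \<noteq> q" if "{p, q} \<in> ?E" for p q
    using E_V[OF that] by (auto simp: card_2_iff doubleton_eq_iff)
  have TV: "F \<subseteq> total_vertices ?V ?E" "card F = 3" if "F \<in> ?T" for F
    by (rule T_cases[OF that]; use adj_V in \<open>force simp: total_vertices_def adj_edges_def\<close>)+
  have spoke_E: "{1, v} \<in> ?E" "{v, 1} \<in> ?E" if "v \<in> ?L" for v
  proof -
    show "{1, v} \<in> ?E"
      using that spoke_in_friendship_edges by blast
    then show "{v, 1} \<in> ?E"
      by (simp add: insert_commute)
  qed
  have rim_E: "{2 * i, 2 * i + 1} \<in> ?E" if "i \<in> {1..n}" for i
    using that unfolding friendship_edges_iff by blast
  have TV_eq: "total_vertices ?V ?E = insert (Inl 1) W \<union> rim ` {1..n}"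
  proof -
    have "(Inr ` ?E :: (nat + nat set) set) = spoke ` ?L \<union> rim ` {1..n}"
    proof (intro subset_antisym subsetI)
      fix x :: "nat + nat set" assume "x \<in> Inr ` ?E"
      then obtain e where e: "x = Inr e" "e \<in> ?E"
        by blast
      from e(2) show "x \<in> spoke ` ?L \<union> rim ` {1..n}"
        by (rule friendship_edge_cases) (auto simp: e(1) spoke_def rim_def)
    next
      fix x assume "x \<in> spoke ` ?L \<union> rim ` {1..n}"
      then show "x \<in> Inr ` ?E"
        unfolding spoke_def rim_def using spoke_E(1) rim_E by blast
    qed
    moreover have "?V = insert 1 ?L"
      by (auto simp: V)
    ultimately show ?thesis
      unfolding total_vertices_def W_def by (simp only: image_insert) blast
  qed
  have adj_spokes: "adj_edges ?E {1, u} {1, v}" if "u \<in> ?L" "v \<in> ?L" "u \<noteq> v" for u v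
    using that spoke_E by (auto simp: adj_edges_def doubleton_eq_iff)
  have adj_rim: "adj_edges ?E {2 * i, 2 * i + 1} {1, v}" if "i \<in> {1..n}" "v \<in> {2 * i, 2 * i + 1}" for i v
    using that spoke_E[of v] rim_E[of i] by (auto simp: adj_edges_def doubleton_eq_iff)
  have i_L: "2 * i \<in> ?L" "2 * i + 1 \<in> ?L" if "i \<in> {1..n}" for i
    using that by auto
  have spoke_neq: "Inl u \<noteq> spoke v" for u v
    by (simp add: spoke_def)
  have "shellable ?T"
  \<comment> \<open>The vertices 2 and 3 of the first triangle serve as the two distinct members of
    \<open>W\<close>. A rim edge reaches the spokes of other triangles through its own spoke
    \<open>spoke (2 * i)\<close>, which is why that is \<open>p i\<close>.\<close>
  proof (rule shellable_star_pattern[where c = "Inl 1" and W = W and ?w0.0 = "Inl 2" and ?w1.0 = "Inl 3"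
        and C = rim and I = "{1..n}" and Q = Q and ?q0.0 = "\<lambda>i. Inl (2 * i)" and p = "\<lambda>i. spoke (2 * i)"
        and H = "spoke ` ?L"])
    have "finite (total_vertices ?V ?E)"
      by (auto simp: TV_eq W_def)
    then show "finite ?T"
      using TV(1) finite_subset[of ?T "Pow (total_vertices ?V ?E)"] by blast
    show "inj_on rim {1..n}"
      by (auto simp: inj_on_def rim_def doubleton_eq_iff)
    show "rim i \<notin> insert (Inl 1) W" if "i \<in> {1..n}" for i
      using that by (auto simp: rim_def W_def spoke_def doubleton_eq_iff)
    show "{Inl 1, u, w} \<in> ?T" if "u \<in> W" "w \<in> W" "u \<noteq> w" for u w
    proof -
      have LL: "{Inl 1, Inl u, Inl w} \<in> ?T" if "u \<in> ?L" "w \<in> ?L" "u \<noteq> w" for u w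
        using tri1[OF spoke_E(2)[OF that(1)] spoke_E(1)[OF that(2)] that(3)]
        by (simp only: insert_commute[of "Inl u"])
      have LR: "{Inl 1, Inl u, spoke w} \<in> ?T" if "u \<in> ?L" "w \<in> ?L" for u w
        using tri3[OF spoke_E(1)[OF that(1)] spoke_E(1)[OF that(2)]] by (simp add: spoke_def)
      have RR: "{Inl 1, spoke u, spoke w} \<in> ?T" if "u \<in> ?L" "w \<in> ?L" "u \<noteq> w" for u w
      proof -
        have "{spoke u, spoke w, Inl 1} \<in> ?T"
          using tri4[OF adj_spokes[OF that], of 1] by (simp add: spoke_def V)
        moreover have "{spoke u, spoke w, Inl 1} = {Inl 1, spoke u, spoke w}"
          by blast
        ultimately show ?thesis
          by simp
      qed
      consider u' w' where "u = Inl u'" "w = Inl w'" "u' \<in> ?L" "w' \<in> ?L" "u' \<noteq> w'"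
        | u' w' where "u = Inl u'" "w = spoke w'" "u' \<in> ?L" "w' \<in> ?L"
        | u' w' where "u = spoke u'" "w = Inl w'" "u' \<in> ?L" "w' \<in> ?L"
        | u' w' where "u = spoke u'" "w = spoke w'" "u' \<in> ?L" "w' \<in> ?L" "u' \<noteq> w'"
        using \<open>u \<in> W\<close> \<open>w \<in> W\<close> \<open>u \<noteq> w\<close> unfolding W_def by blast
      then show ?thesis
      proof cases
        case 3
        then show ?thesis
          using LR[of w' u'] by (simp add: insert_commute)
      qed (use LL LR RR in auto)
    qed
    show "{rim i, Inl 1, q} \<in> ?T" if "i \<in> {1..n}" "q \<in> Q i" for i q
    proof -
      have "{rim i, Inl 1, Inl v} \<in> ?T" "{rim i, Inl 1, spoke v} \<in> ?T" if v: "v \<in> {2 * i, 2 * i + 1}" for v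
      proof -
        have L: "v \<in> ?L"
          using v \<open>i \<in> {1..n}\<close> by auto
        have "{Inl 1, Inl v, rim i} \<in> ?T"
          unfolding rim_def using tri3[OF spoke_E(1)[OF L] rim_E[OF \<open>i \<in> {1..n}\<close>]] v by blast
        moreover have "{Inl 1, Inl v, rim i} = {rim i, Inl 1, Inl v}"
          by blast
        ultimately show "{rim i, Inl 1, Inl v} \<in> ?T"
          by simp
        have "{rim i, spoke v, Inl 1} \<in> ?T"
          using tri4[OF adj_rim[OF \<open>i \<in> {1..n}\<close> v], of 1] by (simp add: V rim_def spoke_def)
        then show "{rim i, Inl 1, spoke v} \<in> ?T"
          by (simp only: insert_commute[of "Inl 1" "spoke v"])
      qed
      then show ?thesis
        using \<open>q \<in> Q i\<close> by (auto simp: Q_def)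
    qed
    show "{rim i, spoke (2 * i), w} \<in> ?T" if "i \<in> {1..n}" "w \<in> spoke ` ?L - Q i" for i w
    proof -
      obtain v where v: "w = spoke v" "v \<in> ?L"
        using \<open>w \<in> spoke ` ?L - Q i\<close> by blast
      have v_ne: "2 * i \<noteq> v"
        using \<open>w \<in> spoke ` ?L - Q i\<close> v(1) by (auto simp: Q_def)
      have "{2 * i, 2 * i + 1} \<noteq> {1, v}"
        using that(1) by (auto simp: doubleton_eq_iff)
      then show ?thesis
        using tri2[OF adj_rim[OF that(1)] adj_spokes[OF i_L(1)[OF that(1)] v(2) v_ne]]
        by (simp add: rim_def spoke_def v(1))
    qed
    show "F \<subseteq> insert (Inl 1) W \<union> rim ` {1..n}" if "F \<in> ?T" for F
      using TV(1)[OF that] TV_eq by simp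
    \<comment> \<open>A connected triple through \<open>rim i\<close> contains a neighbour of it,
      and its third member is at distance at most two. What has to be excluded is a vertex or rim
      edge of another triangle; only foreign spokes can occur.\<close>
    show "F - {rim i} \<subseteq> insert (Inl 1) (Q i \<union> spoke ` ?L)" if F: "F \<in> ?T" "i \<in> {1..n}" "rim i \<in> F" for F i
    proof (rule T_cases[OF F(1)])
      fix p q r assume "F = {Inl p, Inl q, Inl r}"
      then show ?thesis
        using F(3) by (simp add: rim_def)
    next
      fix p q r assume pqr: "F = {Inr p, Inr q, Inr r}" "adj_edges ?E p q" "adj_edges ?E q r" "p \<noteq> r"
      have nb: "Inr f \<in> Q i" if "adj_edges ?E {2 * i, 2 * i + 1} f" for f
        using adjacent_rim_edge[OF F(2) that] by (auto simp: Q_def spoke_def)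
      \<comment> \<open>Two adjacency steps from a rim edge cannot end at another rim edge, since
        the middle edge would be a spoke of both triangles.\<close>
      have far: "Inr g \<in> spoke ` ?L" if "adj_edges ?E {2 * i, 2 * i + 1} f" "adj_edges ?E f g"
        "g \<noteq> {2 * i, 2 * i + 1}" for f g
      proof -
        have "g \<in> ?E"
          using that(2) by (simp add: adj_edges_def)
        then show ?thesis
        proof (rule friendship_edge_cases)
          fix j assume j: "j \<in> {1..n}" "g = {2 * j, 2 * j + 1}"
          then have "i = j"
            using adjacent_rim_edge[OF F(2) that(1)] adjacent_rim_edge[OF j(1) adj_edges_sym[OF that(2)]] F(2)
            by (auto simp: doubleton_eq_iff)
          then show ?thesis
            using j that(3) by simp
        qed (simp add: spoke_def)
      qed
      from F(3) pqr(1) consider "p = {2 * i, 2 * i + 1}" | "q = {2 * i, 2 * i + 1}" | "r = {2 * i, 2 * i + 1}"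
        by (auto simp: rim_def)
      then show ?thesis
      proof cases
        case 1
        then have "Inr q \<in> Q i" "Inr r \<in> spoke ` ?L"
          using nb[of q] far[of q r] pqr by auto
        then show ?thesis
          unfolding pqr(1) rim_def 1 by blast
      next
        case 2
        then have "Inr p \<in> Q i" "Inr r \<in> Q i"
          using nb[of p] nb[of r] pqr adj_edges_sym by auto
        then show ?thesis
          unfolding pqr(1) rim_def 2 by blast
      next
        case 3
        then have "Inr q \<in> Q i" "Inr p \<in> spoke ` ?L"
          using nb[of q] far[of q p] pqr adj_edges_sym by auto
        then show ?thesis
          unfolding pqr(1) rim_def 3 by blast
      qed
    next
      fix p q r assume pqr: "F = {Inl p, Inl q, Inr r}" "{p, q} \<in> ?E" "r \<in> ?E" "p \<in> r \<or> q \<in> r"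
      then have r: "r = {2 * i, 2 * i + 1}"
        using F(3) by (auto simp: rim_def)
      have "{q, p} \<in> ?E"
        using pqr(2) by (simp add: insert_commute)
      then have "p \<in> {1, 2 * i, 2 * i + 1} \<and> q \<in> {1, 2 * i, 2 * i + 1}"
        using friendship_rim_neighbour[OF pqr(2) F(2)] friendship_rim_neighbour[of q p n i] F(2) pqr(4)
        unfolding r by blast
      then show ?thesis
        using pqr(1) r by (auto simp: rim_def Q_def)
    next
      fix p q r assume pqr: "F = {Inr p, Inr q, Inl r}" "adj_edges ?E p q" "r \<in> ?V" "r \<in> p \<or> r \<in> q"
      have *: "Inr f \<in> Q i \<and> (r \<in> f \<longrightarrow> r \<in> {1, 2 * i, 2 * i + 1})"
        if "adj_edges ?E {2 * i, 2 * i + 1} f" for f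
        using adjacent_rim_edge[OF F(2) that] by (auto simp: Q_def spoke_def)
      from F(3) pqr(1) consider "p = {2 * i, 2 * i + 1}" | "q = {2 * i, 2 * i + 1}"
        by (auto simp: rim_def)
      then show ?thesis
      proof cases
        case 1
        then have "Inr q \<in> Q i" "r \<in> {1, 2 * i, 2 * i + 1}"
          using *[of q] pqr by auto
        then show ?thesis
          unfolding pqr(1) rim_def 1 by (auto simp: Q_def)
      next
        case 2
        then have "Inr p \<in> Q i" "r \<in> {1, 2 * i, 2 * i + 1}"
          using *[of p] pqr adj_edges_sym by auto
        then show ?thesis
          unfolding pqr(1) rim_def 2 by (auto simp: Q_def)
      qed
    qed
  qed (use n TV(2) spoke_neq in \<open>auto simp: W_def Q_def\<close>)
  then show ?thesis
    using TV by blast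
qed

theorem theorem4p4:
  fixes n :: nat
  assumes "n \<ge> 1"
  shows "cohen_macaulay_over TYPE('k::field)
           (total_vertices (friendship_vertices n) (friendship_edges n))
           (total_complex (friendship_vertices n) (friendship_edges n))"
proof -
  have "friendship_vertices n \<noteq> {}"
    using friendship_vertices_eq[OF assms] by simp
  then have "finite (total_vertices (friendship_vertices n) (friendship_edges n))"
    using simplicial_complex_total_complex[OF simple_graph_friendship] by (simp add: simplicial_complex_def)
  then show ?thesis
    unfolding total_complex_def using shellable_friendship[OF assms] by (intro shellable_cohen_macaulay) auto
qed

end
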